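(* Let $\Omega\subset\mathbb{R}^d$ be a bounded domain, $T\in L^2(\Omega)$, and let $V$, $\mathcal V=L^2([0,1],V)$, $Y$, $K$, $\mathcal D$, $\mathcal E_1$, $\mathcal E_2$ be as in the context, satisfying assumptions (A1)--(A6) listed there. Let $\lambda=(\lambda_1,\lambda_2)$ with $\lambda_1,\lambda_2>0$, and for $g\in Y$ put $$J_{\lambda,g}(v,z)=\mathcal D\bigl(K(R_{v,z}),g\bigr)+\lambda_1\mathcal E_1(v)+\lambda_2\mathcal E_2(z),\qquad (v,z)\in\mathcal V\times L^2(\Omega).$$ Consider a sequence $g_n\to g$ in $Y$ and, for each $n\in\mathbb{N}$, let $(v_n,z_n)\in\mathcal V\times L^2(\Omega)$ be a minimizer of $J_{\lambda,g_n}$. Then there exists a subsequence of $\{(v_n,z_n)\}_{n\in\mathbb{N}}$ that converges weakly to a minimizer of $J_{\lambda,g}$.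
   Context: **Setting.** $\Omega\subset\mathbb{R}^d$ is a bounded domain and $T\in L^2(\Omega)$ is a fixed template image. For $0<\alpha\le 1$, $C_0^{1,\alpha}(\Omega,\mathbb{R}^d)$ denotes the closure of $C_c^\infty(\Omega,\mathbb{R}^d)$ with respect to the Hölder norm $\|\cdot\|_{C^{1,\alpha}}$. $V$ is an admissible vector space, meaning that it embeds continuously into $C_0^{1,\alpha}(\Omega,\mathbb{R}^d)$ for some $0<\alpha\le1$, and $\mathcal V:=L^2([0,1],V)$ is the set of admissible velocity fields. $Y$ is a Banach space. **Flow and reconstruction.** For $v\in\mathcal V$, let $\varphi_v$ be the unique global solution (it exists and lies in $C([0,1],C^1(\overline\Omega,\mathbb{R}^d))$) of $\tfrac{\mathrm d}{\mathrm dt}\varphi_v(t,x)=v(t,\varphi_v(t,x))$ for $(t,x)\in[0,1]\times\Omega$, $\varphi_v(0,x)=x$ for $x\in\Omega$. Each $\varphi_v(t,\cdot)$ is a diffeomorphism; $\varphi_v^{-1}(1,\cdot)$ denotes the inverse of $\varphi_v(1,\cdot)$ with respect to the spatial variable. For $(v,z)\in\mathcal V\times L^2(\Omega)$ define $R_{v,z}:=T\circ\varphi_v^{-1}(1,\cdot)+z\in L^2(\Omega)$. **Data.** $K\colon L^2(\Omega)\to Y$ is a (not necessarily linear) operator, $\mathcal D\colon Y\times Y\to\mathbb{R}_{\ge0}$, $\mathcal E_1\colon\mathcal V\to\mathbb{R}_{\ge0}$, $\mathcal E_2\colon L^2(\Omega)\to\mathbb{R}_{\ge0}$. **Assumptions.**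 - (A1) $K$ is continuous and weak-weak-continuous: $x_n\rightharpoonup x$ in $L^2(\Omega)$ implies $K(x_n)\rightharpoonup K(x)$ in $Y$. - (A2) $\mathcal D(\cdot,g)$ is weakly lower semicontinuous for all $g\in Y$, and $\mathcal D(f,\cdot)$ is continuous for all $f\in Y$. - (A3) If $\mathcal D(f,g)=0$, then $f=g$. - (A4) There exists $C>0$ such that $|\mathcal D(f,h)-\mathcal D(f,g)|\le C\,\mathcal D(g,h)$ for all $f,g,h\in Y$. - (A5) For fixed $g\in Y$, any bounded sequence $\{f_n\}\subset L^2(\Omega)$ and any sequence $\{z_n\}\subset L^2(\Omega)$ with $\|z_n\|_2\to\infty$, one has $\mathcal D(K(f_n+z_n),g)+\mathcal E_2(z_n)\to\infty$. Further, for $\{v_n\}\subset\mathcal V$ with $\|v_n\|_{\mathcal V}\to\infty$, one has $\mathcal E_1(v_n)\to\infty$. - (A6) $\mathcal E_1$ and $\mathcal E_2$ are weakly lower semicontinuous.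
   Formalization: The formal theorem additionally assumes that V is a reflexive Banach space and that D(f,f)=0 for all f in Y (so (A3) reads "D(f,g)=0 iff f=g"); the statement fails without either assumption. *)

theory Defs
  imports "HOL-Analysis.Analysis"
begin

section \<open>Weak convergence in normed spaces, reflexivity, lower semicontinuity\<close>

definition weak_conv :: "(nat \<Rightarrow> 'y::real_normed_vector) \<Rightarrow> 'y \<Rightarrow> bool" where
  "weak_conv ys y \<longleftrightarrow>
     (\<forall>l :: 'y \<Rightarrow> real. bounded_linear l \<longrightarrow> (\<lambda>n. l (ys n)) \<longlonglongrightarrow> l y)"

definition reflexive :: "'v::real_normed_vector itself \<Rightarrow> bool" where
  "reflexive _ \<longleftrightarrow>
     (\<forall>F :: ('v \<Rightarrow>\<^sub>L real) \<Rightarrow>\<^sub>L real. \<exists>x :: 'v. \<forall>l :: 'v \<Rightarrow>\<^sub>L real.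
        blinfun_apply F l = blinfun_apply l x)"

text \<open>Sequential lower semicontinuity with respect to a notion of convergence; with a weak
  convergence in place of \<open>conv\<close> this is weak lower semicontinuity.\<close>

definition seq_lsc :: "((nat \<Rightarrow> 'x) \<Rightarrow> 'x \<Rightarrow> bool) \<Rightarrow> ('x \<Rightarrow> real) \<Rightarrow> bool" where
  "seq_lsc conv F \<longleftrightarrow>
     (\<forall>xs x. conv xs x \<longrightarrow> ereal (F x) \<le> liminf (\<lambda>n. ereal (F (xs n))))"


section \<open>Bochner spaces of square integrable functions\<close>

text \<open>Elements of \<open>L\<^sup>2(M; 'b)\<close> are represented by functions, and equality almost everywhere
  is expressed by the seminorm \<open>L2_norm\<close>. A map on representatives that is continuous for
  \<open>L2_norm\<close>, or a real-valued one that is sequentially lower semicontinuous for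
  \<open>L2_weak_conv\<close>, takes the same value on representatives that agree almost everywhere,
  so it is a map on \<open>L\<^sup>2(M; 'b)\<close>.\<close>

definition strongly_measurable :: "'a measure \<Rightarrow> ('a \<Rightarrow> 'b::real_normed_vector) \<Rightarrow> bool" where
  "strongly_measurable M f \<longleftrightarrow>
     (\<exists>s. (\<forall>i::nat. simple_function M (s i)) \<and> (AE x in M. (\<lambda>i. s i x) \<longlonglongrightarrow> f x))"

definition L2 :: "'a measure \<Rightarrow> ('a \<Rightarrow> 'b::real_normed_vector) set" where
  "L2 M = {f. strongly_measurable M f \<and> integrable M (\<lambda>x. (norm (f x))\<^sup>2)}"

definition L2_norm :: "'a measure \<Rightarrow> ('a \<Rightarrow> 'b::real_normed_vector) \<Rightarrow> real" where
  "L2_norm M f = sqrt (\<integral>x. (norm (f x))\<^sup>2 \<partial>M)"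

definition L2_functional ::
    "'a measure \<Rightarrow> (('a \<Rightarrow> 'b::real_normed_vector) \<Rightarrow> real) \<Rightarrow> bool" where
  "L2_functional M l \<longleftrightarrow>
     (\<forall>f\<in>L2 M. \<forall>g\<in>L2 M. l (\<lambda>x. f x + g x) = l f + l g) \<and>
     (\<forall>c. \<forall>f\<in>L2 M. l (\<lambda>x. c *\<^sub>R f x) = c * l f) \<and>
     (\<exists>B. \<forall>f\<in>L2 M. \<bar>l f\<bar> \<le> B * L2_norm M f)"

definition L2_weak_conv ::
    "'a measure \<Rightarrow> (nat \<Rightarrow> 'a \<Rightarrow> 'b::real_normed_vector) \<Rightarrow> ('a \<Rightarrow> 'b) \<Rightarrow> bool" where
  "L2_weak_conv M fs f \<longleftrightarrow>
     (\<forall>n. fs n \<in> L2 M) \<and> f \<in> L2 M \<and>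
     (\<forall>l. L2_functional M l \<longrightarrow> (\<lambda>n. l (fs n)) \<longlonglongrightarrow> l f)"

text \<open>\<open>L\<^sup>2(\<Omega>)\<close> is \<open>L2 (lebesgue_on \<Omega>)\<close> with real values, and \<open>L\<^sup>2([0,1], V)\<close> is the following.\<close>

abbreviation unit_time :: "real measure" where
  "unit_time \<equiv> lebesgue_on {0..1}"


section \<open>The spaces \<open>C\<^sub>0\<^sup>1\<^sup>,\<^sup>\<alpha>(\<Omega>)\<close> and admissible velocity spaces\<close>

text \<open>Functions on \<open>\<Omega>\<close> in \<open>C\<^sub>0\<^sup>1\<^sup>,\<^sup>\<alpha>(\<Omega>)\<close> are extended by zero to the whole space.\<close>

fun Ck :: "nat \<Rightarrow> ('a::euclidean_space \<Rightarrow> 'b::euclidean_space) \<Rightarrow> bool" where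
  "Ck 0 f \<longleftrightarrow> continuous_on UNIV f"
| "Ck (Suc k) f \<longleftrightarrow>
     (\<forall>x. f differentiable (at x)) \<and> (\<forall>h. Ck k (\<lambda>x. frechet_derivative f (at x) h))"

definition Cc_infinity :: "'a::euclidean_space set \<Rightarrow> ('a \<Rightarrow> 'b::euclidean_space) set" where
  "Cc_infinity \<Omega> =
     {f. (\<forall>k. Ck k f) \<and> compact (closure {x. f x \<noteq> 0}) \<and> closure {x. f x \<noteq> 0} \<subseteq> \<Omega>}"

text \<open>The Hoelder norm of a function that is differentiable on the open set \<open>\<Omega>\<close>; it takes the
  value \<open>\<infinity>\<close> outside \<open>C\<^sup>1\<^sup>,\<^sup>\<alpha>\<close>.\<close>

definition holder_norm ::
    "'a::euclidean_space set \<Rightarrow> real \<Rightarrow> ('a \<Rightarrow> 'b::euclidean_space) \<Rightarrow> ennreal" where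
  "holder_norm \<Omega> \<alpha> f =
     (SUP x\<in>\<Omega>. ennreal (norm (f x))) +
     (SUP x\<in>\<Omega>. ennreal (onorm (frechet_derivative f (at x)))) +
     (SUP x\<in>\<Omega>. SUP y\<in>\<Omega> - {x}.
        ennreal (onorm (\<lambda>h. frechet_derivative f (at x) h - frechet_derivative f (at y) h)
                 / dist x y powr \<alpha>))"

definition C0_holder ::
    "'a::euclidean_space set \<Rightarrow> real \<Rightarrow> ('a \<Rightarrow> 'b::euclidean_space) set" where
  "C0_holder \<Omega> \<alpha> =
     {f. (\<forall>x. x \<notin> \<Omega> \<longrightarrow> f x = 0) \<and> (\<forall>x\<in>\<Omega>. f differentiable (at x)) \<and>
         (\<forall>\<epsilon>>0. \<exists>g\<in>Cc_infinity \<Omega>. holder_norm \<Omega> \<alpha> (\<lambda>x. f x - g x) < \<epsilon>)}"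

text \<open>The space \<open>V\<close> is given as a normed space \<open>'v\<close> together with its embedding \<open>\<iota>\<close>.
  Reflexivity is required separately: admissible spaces such as \<open>C\<^sub>0\<^sup>1\<^sup>,\<^sup>\<alpha>(\<Omega>)\<close> itself are not
  reflexive, and bounded sequences in \<open>L\<^sup>2([0,1], V)\<close> then need not have weakly convergent
  subsequences.\<close>

definition admissible ::
    "'a::euclidean_space set \<Rightarrow> ('v::real_normed_vector \<Rightarrow> 'a \<Rightarrow> 'a) \<Rightarrow> bool" where
  "admissible \<Omega> \<iota> \<longleftrightarrow>
     (\<exists>\<alpha>. 0 < \<alpha> \<and> \<alpha> \<le> 1 \<and>
        (\<forall>v. \<iota> v \<in> C0_holder \<Omega> \<alpha>) \<and>
        (\<forall>v w x. \<iota> (v + w) x = \<iota> v x + \<iota> w x) \<and>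
        (\<forall>c v x. \<iota> (c *\<^sub>R v) x = c *\<^sub>R \<iota> v x) \<and>
        inj \<iota> \<and>
        (\<exists>C. \<forall>v. holder_norm \<Omega> \<alpha> (\<iota> v) \<le> ennreal (C * norm v)))"


section \<open>Flow, reconstruction and functional\<close>

text \<open>Velocities are only square integrable in time, so the flow equation is understood in the
  sense of Caratheodory, that is, as an integral equation.\<close>

definition is_flow ::
    "'a::euclidean_space set \<Rightarrow> (real \<Rightarrow> 'a \<Rightarrow> 'a) \<Rightarrow> (real \<Rightarrow> 'a \<Rightarrow> 'a) \<Rightarrow> bool" where
  "is_flow \<Omega> u \<phi> \<longleftrightarrow>
     (\<forall>x\<in>\<Omega>. \<forall>t\<in>{0..1}.
        \<phi> t x \<in> \<Omega> \<and>
        (\<lambda>s. u s (\<phi> s x)) absolutely_integrable_on {0..t} \<and>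
        \<phi> t x = x + integral {0..t} (\<lambda>s. u s (\<phi> s x)))"

text \<open>The flow is unique on \<open>[0,1] \<times> \<Omega>\<close>, and only its values there are used.\<close>

definition flow ::
    "'a::euclidean_space set \<Rightarrow> ('v \<Rightarrow> 'a \<Rightarrow> 'a) \<Rightarrow> (real \<Rightarrow> 'v) \<Rightarrow> real \<Rightarrow> 'a \<Rightarrow> 'a" where
  "flow \<Omega> \<iota> v = (SOME \<phi>. is_flow \<Omega> (\<lambda>t. \<iota> (v t)) \<phi>)"

definition reconstruction ::
    "'a::euclidean_space set \<Rightarrow> ('v \<Rightarrow> 'a \<Rightarrow> 'a) \<Rightarrow> ('a \<Rightarrow> real) \<Rightarrow>
     (real \<Rightarrow> 'v) \<Rightarrow> ('a \<Rightarrow> real) \<Rightarrow> 'a \<Rightarrow> real" where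
  "reconstruction \<Omega> \<iota> T v z = (\<lambda>x. T (inv_into \<Omega> (flow \<Omega> \<iota> v 1) x) + z x)"

definition J_fun ::
    "'a::euclidean_space set \<Rightarrow> ('v \<Rightarrow> 'a \<Rightarrow> 'a) \<Rightarrow> ('a \<Rightarrow> real) \<Rightarrow>
     (('a \<Rightarrow> real) \<Rightarrow> 'y) \<Rightarrow> ('y \<Rightarrow> 'y \<Rightarrow> real) \<Rightarrow>
     ((real \<Rightarrow> 'v) \<Rightarrow> real) \<Rightarrow> (('a \<Rightarrow> real) \<Rightarrow> real) \<Rightarrow> real \<Rightarrow> real \<Rightarrow> 'y \<Rightarrow>
     (real \<Rightarrow> 'v) \<Rightarrow> ('a \<Rightarrow> real) \<Rightarrow> real" where
  "J_fun \<Omega> \<iota> T K D E1 E2 lam1 lam2 g v z =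
     D (K (reconstruction \<Omega> \<iota> T v z)) g + lam1 * E1 v + lam2 * E2 z"

definition is_minimizer ::
    "'a::euclidean_space set \<Rightarrow>
     ((real \<Rightarrow> 'v::real_normed_vector) \<Rightarrow> ('a \<Rightarrow> real) \<Rightarrow> real) \<Rightarrow>
     (real \<Rightarrow> 'v) \<Rightarrow> ('a \<Rightarrow> real) \<Rightarrow> bool" where
  "is_minimizer \<Omega> J v z \<longleftrightarrow>
     v \<in> L2 unit_time \<and> z \<in> L2 (lebesgue_on \<Omega>) \<and>
     (\<forall>w\<in>L2 unit_time. \<forall>y\<in>L2 (lebesgue_on \<Omega>). J v z \<le> J w y)"

end

theory Submission
  imports Defs "HOL-Complex_Analysis.Great_Picard"
begin

text \<open>Comparing with the value at zero velocity and zero source, and using the approximate triangle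
  inequality for the distance, coercivity bounds the minimizers \<open>(v\<^sub>n, z\<^sub>n)\<close>. Bounded sequences in
  \<open>L\<^sup>2\<close> with values in a reflexive space have weakly convergent subsequences. Weak convergence of
  velocities implies pointwise convergence of the inverse flows (Gronwall, the velocity field along the
  limit trajectory being a bounded linear functional of the velocity). The flows are uniformly
  bi-Lipschitz, so the deformed templates converge strongly, and lower semicontinuity of the three terms
  of the functional gives minimality of the limit.

  Weak compactness is obtained without identifying the dual of the Bochner space in general.
  Near-minimizers of a weaker Hilbert seminorm over convex combinations converge, tested with countably
  many functionals, almost everywhere, and reflexivity provides the pointwise weak limits. Applied to
  the dual, the same argument represents a given functional on a given sequence by a strongly measurable
  function, which suffices to pass to the limit.\<close>

section \<open>Hahn--Banach and separable subspaces of reflexive spaces\<close>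

text \<open>The dual of a Bochner space is the Bochner space of the dual only under a Radon-Nikodym
  property of that dual, and in the compactness part the space of values is an arbitrary normed
  space. Vector-valued functions are therefore seen only through real functions
  \<open>l i \<circ> f\<close>, for countably many \<open>l i\<close> that norm a separable closed
  subspace containing almost all values. Mazur's lemma is run in reverse: convergent combinations
  come first and produce a candidate limit. That the candidate is the same for all subsequences is
  not automatic; it follows once the integrals of \<open>l i (v n x) * l i (v m x)\<close> converge
  in \<open>n\<close> for all \<open>i\<close> and \<open>m\<close>, which a diagonal subsequence
  achieves.

  In the variational part the obstacle is that trajectories depend nonlinearly on the velocity.
  Freezing the limit trajectory makes the defect linear in the velocity, and the stability estimate
  measures this defect in \<open>L\<^sup>2\<close> in time and at the final time, so that pointwise
  convergence and a uniform bound suffice.\<close>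

definition sublinear :: "('v::real_vector \<Rightarrow> real) \<Rightarrow> bool" where
  "sublinear p \<longleftrightarrow> (\<forall>x y. p (x + y) \<le> p x + p y) \<and> (\<forall>c\<ge>0. \<forall>x. p (c *\<^sub>R x) = c * p x)"

lemma sublinear_add: "sublinear p \<Longrightarrow> p (x + y) \<le> p x + p y"
  by (auto simp: sublinear_def)

lemma sublinear_scale: "sublinear p \<Longrightarrow> 0 \<le> c \<Longrightarrow> p (c *\<^sub>R x) = c * p x"
  by (auto simp: sublinear_def)

lemma sublinear_zero: "sublinear p \<Longrightarrow> p 0 = 0"
  using sublinear_scale[of p 0 0] by simp

lemma sublinear_minus: "sublinear p \<Longrightarrow> - p (- x) \<le> p x"
  using sublinear_add[of p x "-x"] sublinear_zero[of p] by simp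

text \<open>The largest sublinear functional below \<open>p\<close> that takes at most the value \<open>- p a\<close> at \<open>- a\<close>.\<close>

definition tilt :: "('v::real_vector \<Rightarrow> real) \<Rightarrow> 'v \<Rightarrow> 'v \<Rightarrow> real" where
  "tilt p a x = (INF t\<in>{0..}. p (x + t *\<^sub>R a) - t * p a)"

lemma tilt_bdd:
  assumes "sublinear p"
  shows "bdd_below ((\<lambda>t. p (x + t *\<^sub>R a) - t * p a) ` {0..})"
proof (rule bdd_belowI2[where m="- p (- x)"])
  fix t :: real assume "t \<in> {0..}"
  then show "- p (- x) \<le> p (x + t *\<^sub>R a) - t * p a"
    using sublinear_add[OF assms, of "x + t *\<^sub>R a" "-x"] sublinear_scale[OF assms, of t a] by simp
qed

lemma tilt_le: "sublinear p \<Longrightarrow> 0 \<le> t \<Longrightarrow> tilt p a x \<le> p (x + t *\<^sub>R a) - t * p a"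
  unfolding tilt_def by (rule cINF_lower[OF tilt_bdd]) auto

lemma tilt_greatest:
  "(\<And>t. 0 \<le> t \<Longrightarrow> m \<le> p (x + t *\<^sub>R a) - t * p a) \<Longrightarrow> m \<le> tilt p a x"
  unfolding tilt_def by (rule cINF_greatest) auto

lemma sublinear_tilt:
  assumes p: "sublinear p"
  shows "sublinear (tilt p a)"
  unfolding sublinear_def
proof (intro conjI allI impI)
  fix x y
  have "tilt p a (x + y) - (p (y + s *\<^sub>R a) - s * p a) \<le> p (x + t *\<^sub>R a) - t * p a"
    if "0 \<le> s" "0 \<le> t" for s t
  proof -
    have "tilt p a (x + y) \<le> p ((x + y) + (s + t) *\<^sub>R a) - (s + t) * p a"
      using that by (intro tilt_le[OF p]) auto
    also have "(x + y) + (s + t) *\<^sub>R a = (x + t *\<^sub>R a) + (y + s *\<^sub>R a)"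
      by (simp add: algebra_simps)
    finally show ?thesis
      using sublinear_add[OF p, of "x + t *\<^sub>R a" "y + s *\<^sub>R a"] by (simp add: algebra_simps)
  qed
  then have "tilt p a (x + y) - (p (y + s *\<^sub>R a) - s * p a) \<le> tilt p a x" if "0 \<le> s" for s
    using that by (intro tilt_greatest) auto
  then have "tilt p a (x + y) - tilt p a x \<le> tilt p a y"
    by (intro tilt_greatest) (force simp: algebra_simps)
  then show "tilt p a (x + y) \<le> tilt p a x + tilt p a y" by simp
next
  fix c :: real and x assume "0 \<le> c"
  \<comment> \<open>Applied to \<open>1/c\<close> and \<open>c *\<^sub>R x\<close>, this inequality
    is also the reverse one, so one direction for all positive \<open>c\<close> suffices.\<close>
  have le: "tilt p a (c *\<^sub>R x) \<le> c * tilt p a x" if "0 < c" for c x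
  proof -
    have "tilt p a (c *\<^sub>R x) / c \<le> p (x + t *\<^sub>R a) - t * p a" if "0 \<le> t" for t
    proof -
      have "tilt p a (c *\<^sub>R x) \<le> p (c *\<^sub>R x + (c * t) *\<^sub>R a) - (c * t) * p a"
        using \<open>0 < c\<close> that by (intro tilt_le[OF p]) auto
      also have "c *\<^sub>R x + (c * t) *\<^sub>R a = c *\<^sub>R (x + t *\<^sub>R a)" by (simp add: algebra_simps)
      finally show ?thesis using \<open>0 < c\<close> sublinear_scale[OF p, of c "x + t *\<^sub>R a"]
        by (simp add: field_simps)
    qed
    then have "tilt p a (c *\<^sub>R x) / c \<le> tilt p a x" by (rule tilt_greatest)
    then show ?thesis using that by (simp add: field_simps)
  qed
  show "tilt p a (c *\<^sub>R x) = c * tilt p a x"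
  proof (cases "c = 0")
    case True
    have "p (t *\<^sub>R a) - t * p a = 0" if "0 \<le> t" for t using sublinear_scale[OF p that] by simp
    then have "tilt p a 0 = 0"
      by (intro antisym tilt_greatest order_trans[OF tilt_le[OF p, of 0]]) (auto simp: sublinear_zero[OF p])
    then show ?thesis using True by simp
  next
    case False
    then have "0 < c" using \<open>0 \<le> c\<close> by simp
    then show ?thesis using le[of c x] le[of "1/c" "c *\<^sub>R x"]
      by (intro antisym) (auto simp: field_simps)
  qed
qed

text \<open>Zorn's lemma for the reversed pointwise order. The lower bound of a chain is its
  pointwise infimum, finite because every member satisfies \<open>- p (- x) \<le> q x\<close>. Its
  subadditivity comes from the chain property: of two members the smaller one serves for both
  arguments.\<close>

lemma minimal_sublinear_exists:
  fixes p :: "'v::real_vector \<Rightarrow> real"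
  assumes p: "sublinear p"
  shows "\<exists>q. sublinear q \<and> q \<le> p \<and> (\<forall>r. sublinear r \<and> r \<le> q \<longrightarrow> r = q)"
proof -
  define A where "A = {q. sublinear q \<and> q \<le> p}"
  have po: "partial_order_on A (relation_of (\<lambda>a b. b \<le> a) A)"
    by (rule partial_order_on_relation_ofI) auto
  have "\<exists>m\<in>A. \<forall>a\<in>A. a \<le> m \<longrightarrow> a = m"
  proof (rule predicate_Zorn[OF po])
    fix C assume "C \<in> Chains (relation_of (\<lambda>a b. b \<le> a) A)"
    then have C: "q \<in> A" "q \<le> r \<or> r \<le> q" if "q \<in> C" "r \<in> C" for q r
      using that by (auto simp: Chains_def relation_of_def)
    show "\<exists>u\<in>A. \<forall>a\<in>C. u \<le> a"
    proof (cases "C = {}")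
      case True
      then show ?thesis using p by (auto simp: A_def)
    next
      case False
      define u where "u x = (INF q\<in>C. q x)" for x
      have sub: "sublinear q" "q \<le> p" if "q \<in> C" for q using C(1)[OF that that] by (auto simp: A_def)
      have bdd: "bdd_below ((\<lambda>q. q x) ` C)" for x
      proof (rule bdd_belowI2[where m="- p (- x)"])
        fix q assume "q \<in> C"
        then show "- p (- x) \<le> q x"
          using sublinear_minus[OF sub(1), of q x] le_funD[OF sub(2), of q "- x"] by simp
      qed
      have lower: "u x \<le> q x" if "q \<in> C" for q x
        unfolding u_def by (rule cINF_lower[OF bdd that])
      have greatest: "m \<le> u x" if "\<And>q. q \<in> C \<Longrightarrow> m \<le> q x" for m x
        unfolding u_def using False that by (intro cINF_greatest) auto
      have "sublinear u"
        unfolding sublinear_def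
      proof (intro conjI allI impI)
        fix x y
        have "u (x + y) - r y \<le> q x" if qr: "q \<in> C" "r \<in> C" for q r
        proof -
          obtain s where s: "s \<in> C" "s \<le> q" "s \<le> r" using C(2)[OF qr] qr by blast
          have "u (x + y) \<le> s x + s y" using lower[OF s(1), of "x + y"] sublinear_add[OF sub(1)[OF s(1)], of x y] by simp
          also have "\<dots> \<le> q x + r y" using s by (intro add_mono) (auto simp: le_fun_def)
          finally show ?thesis by simp
        qed
        then have "u (x + y) - r y \<le> u x" if "r \<in> C" for r
          using that by (intro greatest) auto
        then have "u (x + y) - u x \<le> u y"
          by (intro greatest) (force simp: algebra_simps)
        then show "u (x + y) \<le> u x + u y" by simp
      next
        fix c :: real and x assume "0 \<le> c"
        have le: "u (c *\<^sub>R x) \<le> c * u x" if "0 < c" for c x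
        proof -
          have "u (c *\<^sub>R x) / c \<le> q x" if "q \<in> C" for q
            using lower[OF that, of "c *\<^sub>R x"] sublinear_scale[OF sub(1)[OF that], of c x] \<open>0 < c\<close>
            by (simp add: field_simps)
          then have "u (c *\<^sub>R x) / c \<le> u x" by (rule greatest)
          then show ?thesis using that by (simp add: field_simps)
        qed
        show "u (c *\<^sub>R x) = c * u x"
        proof (cases "c = 0")
          case True
          have "(\<lambda>q. q 0) ` C = {0}" using False sublinear_zero[OF sub(1)] by (force simp: image_iff)
          then have "u 0 = 0" unfolding u_def by simp
          then show ?thesis using True by simp
        next
          case False
          then have "0 < c" using \<open>0 \<le> c\<close> by simp
          then show ?thesis using le[of c x] le[of "1/c" "c *\<^sub>R x"]
            by (intro antisym) (auto simp: field_simps)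
        qed
      qed
      moreover have "u \<le> p" 
      proof (rule le_funI)
        fix x
        obtain q where q: "q \<in> C" using False by blast
        then show "u x \<le> p x" using order_trans[OF lower[OF q] le_funD[OF sub(2)[OF q]]] by blast
      qed
      ultimately show ?thesis using lower by (auto simp: A_def le_fun_def intro!: bexI[of _ u])
    qed
  qed
  then obtain m where m: "sublinear m" "m \<le> p" "\<And>a. sublinear a \<Longrightarrow> a \<le> p \<Longrightarrow> a \<le> m \<Longrightarrow> a = m"
    by (auto simp: A_def)
  have "r = m" if "sublinear r" "r \<le> m" for r
    using m(3)[OF that(1) order_trans[OF that(2) m(2)] that(2)] .
  then show ?thesis using m(1,2) by blast
qed

text \<open>A minimal sublinear functional is additive: \<open>tilt q y\<close> is sublinear and
  below \<open>q\<close>, hence equal to \<open>q\<close>, and the parameter \<open>1\<close> in the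
  infimum then gives \<open>q x + q y \<le> q (x + y)\<close>. Starting below
  \<open>tilt p a\<close> instead of \<open>p\<close> forces \<open>q (- a) \<le> - p a\<close> and
  with it the value at \<open>a\<close>.\<close>

lemma Hahn_Banach:
  fixes p :: "'v::real_vector \<Rightarrow> real"
  assumes p: "sublinear p"
  obtains l where "linear l" "\<And>x. l x \<le> p x" "l a = p a"
proof -
  obtain q where q: "sublinear q" "q \<le> tilt p a"
    and min: "\<And>r. sublinear r \<Longrightarrow> r \<le> q \<Longrightarrow> r = q"
    using minimal_sublinear_exists[OF sublinear_tilt[OF p, of a]] by blast
  have add: "q (x + y) = q x + q y" for x y
  proof (rule antisym[OF sublinear_add[OF q(1)]])
    have "tilt q y \<le> q" using tilt_le[OF q(1), of 0] by (auto simp: le_fun_def)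
    then have "tilt q y = q" by (rule min[OF sublinear_tilt[OF q(1)]])
    then show "q x + q y \<le> q (x + y)" using tilt_le[OF q(1), of 1 y x] by simp
  qed
  have minus: "q (- x) = - q x" for x
    using add[of x "-x"] sublinear_zero[OF q(1)] by simp
  have scale: "q (c *\<^sub>R x) = c *\<^sub>R q x" for c x
  proof (cases "0 \<le> c")
    case True
    then show ?thesis using sublinear_scale[OF q(1) True, of x] by simp
  next
    case False
    then show ?thesis using sublinear_scale[OF q(1), of "-c" x] minus[of "c *\<^sub>R x"] by simp
  qed
  have lin: "linear q"
    by (rule linearI) (simp_all add: add scale)
  have le: "q x \<le> p x" for x
    using q(2) tilt_le[OF p, of 0 a x] by (auto simp: le_fun_def intro: order_trans)
  have "q (- a) \<le> tilt p a (- a)" using q(2) by (auto simp: le_fun_def)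
  also have "\<dots> \<le> - p a" using tilt_le[OF p, of 1 a "-a"] sublinear_zero[OF p] by simp
  finally have "q a = p a" using minus[of a] le[of a] by simp
  from that[OF lin le this] show ?thesis .
qed

lemma bounded_linear_if_linear_le_norm:
  fixes l :: "'v::real_normed_vector \<Rightarrow> real"
  assumes "linear l" "\<And>x. l x \<le> norm x"
  shows "bounded_linear l" "\<bar>l x\<bar> \<le> norm x"
proof -
  have *: "\<bar>l x\<bar> \<le> norm x" for x
    using assms(2)[of x] assms(2)[of "-x"] linear_neg[OF assms(1), of x] by simp
  show "\<bar>l x\<bar> \<le> norm x" by (rule *)
  show "bounded_linear l"
    using * linear_add[OF assms(1)] linear_scale[OF assms(1)]
    by (intro bounded_linear_intro[of l 1]) simp_all
qed

section \<open>Norming and separating functionals\<close>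

lemma norming_functional:
  fixes a :: "'v::real_normed_vector"
  obtains l :: "'v \<Rightarrow>\<^sub>L real" where "blinfun_apply l a = norm a" "\<And>x. \<bar>l x\<bar> \<le> norm x"
proof -
  have "sublinear (norm :: 'v \<Rightarrow> real)" by (auto simp: sublinear_def norm_triangle_ineq)
  then obtain l where l: "linear l" "\<And>x. l x \<le> norm x" "l a = norm a"
    using Hahn_Banach[of norm a] by blast
  note b = bounded_linear_if_linear_le_norm[OF l(1,2)]
  show ?thesis
    using that[of "Blinfun l"] b l(3) by (simp add: bounded_linear_Blinfun_apply)
qed

text \<open>Hahn-Banach for the distance to \<open>S\<close>, which is sublinear because
  \<open>S\<close> is a subspace, is at most the norm, vanishes on \<open>S\<close> and is nonzero
  at \<open>a\<close>.\<close>

lemma separating_functional: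
  fixes S :: "'v::real_normed_vector set"
  assumes S: "subspace S" and a: "a \<notin> closure S"
  obtains l :: "'v \<Rightarrow>\<^sub>L real" where "blinfun_apply l a \<noteq> 0" "\<And>x. x \<in> S \<Longrightarrow> l x = 0"
proof -
  have ne: "S \<noteq> {}" using subspace_0[OF S] by auto
  have near: "\<exists>s\<in>S. dist x s < infdist x S + e" if "e > 0" for x e
    using cInf_lessD[of "dist x ` S" "infdist x S + e"] ne that by (auto simp: infdist_notempty)
  have "sublinear (\<lambda>x. infdist x S)"
    unfolding sublinear_def
  proof (intro conjI allI impI)
    fix x y
    show "infdist (x + y) S \<le> infdist x S + infdist y S"
    proof (rule field_le_epsilon)
      fix e :: real assume "0 < e"
      then obtain s t where st: "s \<in> S" "dist x s < infdist x S + e/2" "t \<in> S" "dist y t < infdist y S + e/2"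
        using near[of "e/2" x] near[of "e/2" y] by auto
      have "infdist (x + y) S \<le> dist (x + y) (s + t)"
        using st subspace_add[OF S] by (intro infdist_le) auto
      also have "\<dots> \<le> dist x s + dist y t" by (rule dist_triangle_add)
      finally show "infdist (x + y) S \<le> infdist x S + infdist y S + e" using st by simp
    qed
  next
    fix c :: real and x assume "0 \<le> c"
    have le: "infdist (c *\<^sub>R x) S \<le> c * infdist x S" if "0 < c" for c x
    proof -
      have "infdist (c *\<^sub>R x) S / c \<le> infdist x S"
        unfolding infdist_notempty[OF ne, of x]
      proof (rule cINF_greatest[OF ne])
        fix s assume "s \<in> S"
        then have "infdist (c *\<^sub>R x) S \<le> dist (c *\<^sub>R x) (c *\<^sub>R s)"
          using subspace_scale[OF S] by (intro infdist_le) auto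
        then show "infdist (c *\<^sub>R x) S / c \<le> dist x s" using \<open>0 < c\<close>
          by (simp add: dist_norm pos_divide_le_eq mult.commute flip: scaleR_diff_right)
      qed
      then show ?thesis using that by (simp add: field_simps)
    qed
    show "infdist (c *\<^sub>R x) S = c * infdist x S"
    proof (cases "c = 0")
      case True
      then show ?thesis using subspace_0[OF S] by simp
    next
      case False
      then have "0 < c" using \<open>0 \<le> c\<close> by simp
      then show ?thesis using le[of c x] le[of "1/c" "c *\<^sub>R x"]
        by (intro antisym) (auto simp: field_simps)
    qed
  qed
  then obtain l where l: "linear l" "\<And>x. l x \<le> infdist x S" "l a = infdist a S"
    using Hahn_Banach[of "\<lambda>x. infdist x S" a] by blast
  have "infdist x S \<le> norm x" for x using infdist_le[of 0 S x] subspace_0[OF S] by simp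
  then have "l x \<le> norm x" for x using l(2)[of x] order_trans by blast
  note b = bounded_linear_if_linear_le_norm[OF l(1) this]
  have z: "l x = 0" if "x \<in> S" for x
  proof -
    have "l x \<le> 0" "l (- x) \<le> 0" using l(2)[of x] l(2)[of "-x"] that subspace_neg[OF S that] by simp_all
    then show ?thesis using linear_neg[OF l(1), of x] by simp
  qed
  have "infdist a S \<noteq> 0" using a in_closure_iff_infdist_zero[OF ne] by blast
  then show ?thesis
    using that[of "Blinfun l"] b z l(3) by (simp add: bounded_linear_Blinfun_apply)
qed

section \<open>Reflexivity of the dual and of the real line\<close>

lemma reflexiveD:
  fixes F :: "('v::real_normed_vector \<Rightarrow>\<^sub>L real) \<Rightarrow>\<^sub>L real"
  assumes "reflexive TYPE('v)"
  shows "\<exists>x. \<forall>l. blinfun_apply F l = blinfun_apply l x"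
  using assms[unfolded reflexive_def] by (rule spec)

text \<open>Reflexivity turns every element of the bidual into an evaluation \<open>ev x\<close>, so
  a functional \<open>F\<close> on the bidual is determined by the values \<open>F (ev x)\<close>,
  which form an element of the dual. Needed because the compactness argument is also run for
  functions with values in the dual.\<close>

lemma reflexive_dual:
  assumes "reflexive TYPE('v::real_normed_vector)"
  shows "reflexive TYPE('v \<Rightarrow>\<^sub>L real)"
  unfolding reflexive_def
proof
  fix F :: "(('v \<Rightarrow>\<^sub>L real) \<Rightarrow>\<^sub>L real) \<Rightarrow>\<^sub>L real"
  define ev where "ev x = Blinfun (\<lambda>l :: 'v \<Rightarrow>\<^sub>L real. blinfun_apply l x)" for x :: 'v
  have ev: "blinfun_apply (ev x) l = l x" for x l
    unfolding ev_def by (simp add: bounded_linear_Blinfun_apply bounded_linear_blinfun_apply bounded_linear_ident)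
  have "bounded_linear (\<lambda>x. F (ev x))"
  proof (rule bounded_linear_intro[where K="norm F"])
    have "ev (x + y) = ev x + ev y" for x y
      by (rule blinfun_eqI) (simp add: ev blinfun.add_left blinfun.add_right)
    then show "F (ev (x + y)) = F (ev x) + F (ev y)" for x y by (simp add: blinfun.add_right)
    have "ev (c *\<^sub>R x) = c *\<^sub>R ev x" for c x
      by (rule blinfun_eqI) (simp add: ev blinfun.scaleR_left blinfun.scaleR_right)
    then show "F (ev (c *\<^sub>R x)) = c *\<^sub>R F (ev x)" for c x by (simp add: blinfun.scaleR_right)
    show "norm (F (ev x)) \<le> norm x * norm F" for x
    proof -
      have "norm (ev x) \<le> norm x"
      proof (rule norm_blinfun_bound)
        show "norm (blinfun_apply (ev x) l) \<le> norm x * norm l" for l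
          using norm_blinfun[of l x] by (simp add: ev mult.commute)
      qed simp
      then show ?thesis
        using norm_blinfun[of F "ev x"] mult_left_mono[of "norm (ev x)" "norm x" "norm F"]
        by (simp add: mult.commute)
    qed
  qed
  then have l: "blinfun_apply (Blinfun (\<lambda>x. F (ev x))) x = F (ev x)" for x
    by (simp add: bounded_linear_Blinfun_apply)
  have "blinfun_apply F G = blinfun_apply G (Blinfun (\<lambda>x. F (ev x)))" for G
  proof -
    obtain x where x: "\<forall>l. blinfun_apply G l = blinfun_apply l x" using reflexiveD[OF assms, of G] ..
    then have "G = ev x" by (intro blinfun_eqI) (simp add: ev)
    then show ?thesis by (simp add: ev l)
  qed
  then show "\<exists>x. \<forall>l. blinfun_apply F l = blinfun_apply l x" by blast
qed

text \<open>Lets the compactness theorem for vector-valued functions also handle the sources in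
  \<open>L\<^sup>2(\<Omega>)\<close>.\<close>

lemma reflexive_real: "reflexive TYPE(real)"
  unfolding reflexive_def
proof
  fix F :: "(real \<Rightarrow>\<^sub>L real) \<Rightarrow>\<^sub>L real"
  define e :: "real \<Rightarrow>\<^sub>L real" where "e = id_blinfun"
  have "F l = l (F e)" for l
  proof -
    have *: "l y = y * l 1" for y
      using blinfun.scaleR_right[of l y 1] by simp
    have "l y = (l 1 *\<^sub>R e) y" for y
      using *[of y] by (simp add: e_def blinfun.scaleR_left)
    then have "l = l 1 *\<^sub>R e" by (rule blinfun_eqI)
    then have "F l = l 1 * F e" using blinfun.scaleR_right[of F "l 1" e] by simp
    also have "\<dots> = l (F e)" using *[of "F e"] by simp
    finally show ?thesis .
  qed
  then show "\<exists>x. \<forall>l. blinfun_apply F l = blinfun_apply l x" by blast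
qed


text \<open>A separable closed subspace is given as the closure of a sequence \<open>x\<close>, together with
  functionals \<open>l\<close> that norm the elements of the sequence.\<close>

locale separable_norming =
  fixes x :: "nat \<Rightarrow> 'v::real_normed_vector" and l :: "nat \<Rightarrow> 'v \<Rightarrow>\<^sub>L real" and S :: "'v set"
  assumes S_def: "S = closure (range x)"
    and subspace_S: "subspace S"
    and l_norming: "l i (x i) = norm (x i)"
    and l_le_norm: "\<bar>l i y\<bar> \<le> norm y"
begin

lemma x_near:
  assumes "y \<in> S" "0 < e"
  obtains i where "norm (x i - y) < e"
  using assms closure_approachable[of y "range x"] by (auto simp: S_def dist_norm)

text \<open>\<open>l i\<close> norms \<open>x i\<close>, and some \<open>x i\<close> is arbitrarily
  close to \<open>y\<close>. On \<open>S\<close> the norm is thus a supremum of countably many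
  functionals, which later makes norms measurable.\<close>

lemma norm_le_if_functionals_le:
  assumes "y \<in> S" "\<And>i. \<bar>l i y\<bar> \<le> r"
  shows "norm y \<le> r"
proof (rule field_le_epsilon)
  fix e :: real assume "0 < e"
  then obtain i where i: "norm (x i - y) < e/2" using x_near[OF assms(1), of "e/2"] by auto
  have "norm y \<le> norm (x i) + norm (x i - y)" using norm_triangle_ineq4[of "x i" "x i - y"] by simp
  moreover have "norm (x i) = l i y + l i (x i - y)" by (simp add: blinfun.diff_right l_norming)
  moreover have "l i (x i - y) \<le> norm (x i - y)" using l_le_norm[of i "x i - y"] by simp
  ultimately show "norm y \<le> r + e" using assms(2)[of i] i by simp
qed

lemma eq_zero_if_functionals_zero: "y \<in> S \<Longrightarrow> (\<And>i. l i y = 0) \<Longrightarrow> y = 0"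
  using norm_le_if_functionals_le[of y 0] by simp

lemma functional_vanishing_on_S:
  assumes "a \<notin> S"
  obtains p :: "'v \<Rightarrow>\<^sub>L real" where "p a \<noteq> 0" "\<And>y. y \<in> S \<Longrightarrow> p y = 0"
  using separating_functional[OF subspace_S, of a] assms by (auto simp: S_def)

text \<open>A functional on the dual that vanishes on the \<open>l i\<close> and on the annihilator of \<open>S\<close> is, by
  reflexivity, the evaluation at a point of \<open>S\<close> at which all \<open>l i\<close> vanish.\<close>

lemma span_functionals_dense:
  fixes \<kappa> :: "'v \<Rightarrow>\<^sub>L real"
  assumes refl: "reflexive TYPE('v)" and e: "0 < e"
  obtains s where "s \<in> span (range l)" "\<And>y. y \<in> S \<Longrightarrow> \<bar>\<kappa> y - s y\<bar> \<le> e * norm y"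
proof -
  \<comment> \<open>The span of the \<open>l i\<close> alone need not be dense in the dual; adding
    the annihilator \<open>P\<close> of \<open>S\<close> makes it so, and \<open>P\<close> drops out
    on \<open>S\<close>, where the estimate is claimed.\<close>
  define P where "P = {p :: 'v \<Rightarrow>\<^sub>L real. \<forall>y\<in>S. p y = 0}"
  define W where "W = {s + p | s p. s \<in> span (range l) \<and> p \<in> P}"
  have P: "subspace P"
    by (auto simp: subspace_def P_def blinfun.add_left blinfun.scaleR_left)
  have W: "subspace W" unfolding W_def by (rule subspace_sums[OF subspace_span P])
  have "\<kappa> \<in> closure W"
  proof (rule ccontr)
    assume "\<kappa> \<notin> closure W"
    then obtain F :: "('v \<Rightarrow>\<^sub>L real) \<Rightarrow>\<^sub>L real"
      where F: "F \<kappa> \<noteq> 0" "\<And>w. w \<in> W \<Longrightarrow> F w = 0"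
      using separating_functional[OF W] by blast
    obtain z where z: "\<forall>m. blinfun_apply F m = blinfun_apply m z"
      using reflexiveD[OF refl, of F] ..
    have PW: "p \<in> W" if "p \<in> P" for p
      using that span_zero[of "range l"] unfolding W_def by force
    have lW: "l i \<in> W" for i
      using span_base[of "l i" "range l"] subspace_0[OF P] unfolding W_def by force
    have "z \<in> S"
    proof (rule ccontr)
      assume "z \<notin> S"
      then obtain p :: "'v \<Rightarrow>\<^sub>L real" where "p z \<noteq> 0" "\<And>y. y \<in> S \<Longrightarrow> p y = 0"
        using functional_vanishing_on_S by blast
      then show False using F(2)[OF PW, of p] z by (auto simp: P_def)
    qed
    moreover have "l i z = 0" for i using F(2)[OF lW[of i]] z by simp
    ultimately have "z = 0" by (rule eq_zero_if_functionals_zero)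
    then show False using F(1) z by (simp add: blinfun.zero_right)
  qed
  then obtain w where w: "w \<in> W" "dist w \<kappa> < e" using e closure_approachable by blast
  then obtain s p where sp: "s \<in> span (range l)" "p \<in> P" "w = s + p" unfolding W_def by blast
  show ?thesis
  proof (rule that[OF sp(1)])
    fix y assume "y \<in> S"
    then have "\<kappa> y - s y = - (w - \<kappa>) y"
      using sp by (simp add: P_def blinfun.diff_left blinfun.add_left blinfun.minus_left)
    also have "\<bar>\<dots>\<bar> \<le> norm (w - \<kappa>) * norm y"
      using norm_blinfun[of "w - \<kappa>" y] by (simp add: blinfun.minus_left)
    also have "\<dots> \<le> e * norm y" using w(2) by (intro mult_right_mono) (auto simp: dist_norm)
    finally show "\<bar>\<kappa> y - s y\<bar> \<le> e * norm y" .
  qed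
qed

lemma span_functionals_convergent:
  assumes "\<And>i. convergent (\<lambda>n. l i (y n))" "s \<in> span (range l)"
  shows "convergent (\<lambda>n. blinfun_apply s (y n))"
  using assms(2)
proof (induction rule: span_induct_alt)
  case base
  then show ?case by (simp add: convergent_const blinfun.zero_left)
next
  case (step c m s)
  then show ?case using assms(1)
    by (auto simp: blinfun.add_left blinfun.scaleR_left intro!: convergent_add convergent_mult convergent_const)
qed

text \<open>Convergence along the \<open>l i\<close> extends to every functional, because on
  \<open>S\<close> it is approximated by their span with an error relative to the norm. The limits
  form a bounded functional on the dual, which reflexivity turns into evaluation at a point
  \<open>z\<close>; functionals vanishing on \<open>S\<close> vanish at \<open>z\<close>, so
  \<open>z\<close> lies in \<open>S\<close>.\<close>

lemma weak_limit_exists: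
  fixes y :: "nat \<Rightarrow> 'v"
  assumes refl: "reflexive TYPE('v)" and y: "\<And>n. y n \<in> S" "\<And>n. norm (y n) \<le> R"
    and conv: "\<And>i. convergent (\<lambda>n. l i (y n))"
  shows "\<exists>z\<in>S. \<forall>\<kappa> :: 'v \<Rightarrow>\<^sub>L real. (\<lambda>n. \<kappa> (y n)) \<longlonglongrightarrow> \<kappa> z"
proof -
  have R: "0 \<le> R" using y(2)[of 0] norm_ge_zero order_trans by blast
  have conv': "convergent (\<lambda>n. blinfun_apply \<kappa> (y n))" for \<kappa> :: "'v \<Rightarrow>\<^sub>L real"
  proof (intro real_Cauchy_convergent metric_CauchyI)
    fix e :: real assume e: "0 < e"
    define d where "d = e / (4 * (R + 1))"
    have d: "0 < d" "d * R \<le> e / 4" using e R by (auto simp: d_def field_simps)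
    obtain s where s: "s \<in> span (range l)" "\<And>y. y \<in> S \<Longrightarrow> \<bar>\<kappa> y - s y\<bar> \<le> d * norm y"
      using span_functionals_dense[OF refl d(1)] by blast
    have near: "\<bar>\<kappa> (y n) - s (y n)\<bar> \<le> e / 4" for n
      using s(2)[OF y(1)[of n]] mult_left_mono[OF y(2)[of n], of d] d by linarith
    have "Cauchy (\<lambda>n. s (y n))"
      using span_functionals_convergent[OF conv s(1)] convergent_Cauchy by blast
    then obtain N where N: "\<And>m n. m \<ge> N \<Longrightarrow> n \<ge> N \<Longrightarrow> dist (s (y m)) (s (y n)) < e / 4"
      using e unfolding Cauchy_def by (meson zero_less_divide_iff zero_less_numeral)
    have "dist (\<kappa> (y m)) (\<kappa> (y n)) < e" if "m \<ge> N" "n \<ge> N" for m n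
      using N[OF that] near[of m] near[of n] e unfolding dist_real_def by linarith
    then show "\<exists>M. \<forall>m\<ge>M. \<forall>n\<ge>M. dist (\<kappa> (y m)) (\<kappa> (y n)) < e" by blast
  qed
  then have lim: "(\<lambda>n. blinfun_apply \<kappa> (y n)) \<longlonglongrightarrow> lim (\<lambda>n. \<kappa> (y n))" for \<kappa> :: "'v \<Rightarrow>\<^sub>L real"
    by (simp add: convergent_LIMSEQ_iff)
  have "bounded_linear (\<lambda>\<kappa> :: 'v \<Rightarrow>\<^sub>L real. lim (\<lambda>n. \<kappa> (y n)))"
  proof (rule bounded_linear_intro[where K=R])
    fix \<kappa> \<mu> :: "'v \<Rightarrow>\<^sub>L real" and c :: real
    show "lim (\<lambda>n. (\<kappa> + \<mu>) (y n)) = lim (\<lambda>n. \<kappa> (y n)) + lim (\<lambda>n. \<mu> (y n))"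
      by (rule limI) (simp add: blinfun.add_left tendsto_add[OF lim lim])
    show "lim (\<lambda>n. (c *\<^sub>R \<kappa>) (y n)) = c *\<^sub>R lim (\<lambda>n. \<kappa> (y n))"
      by (rule limI) (simp add: blinfun.scaleR_left tendsto_mult_left[OF lim])
    have "\<bar>\<kappa> (y n)\<bar> \<le> norm \<kappa> * R" for n
      using norm_blinfun[of \<kappa> "y n"] mult_left_mono[OF y(2)[of n], of "norm \<kappa>"] by simp
    then show "norm (lim (\<lambda>n. \<kappa> (y n))) \<le> norm \<kappa> * R"
      by (intro LIMSEQ_le_const2[OF tendsto_norm[OF lim]]) auto
  qed
  then obtain z where z: "\<forall>\<kappa> :: 'v \<Rightarrow>\<^sub>L real. lim (\<lambda>n. blinfun_apply \<kappa> (y n)) = blinfun_apply \<kappa> z"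
    using reflexiveD[OF refl, of "Blinfun (\<lambda>\<kappa>. lim (\<lambda>n. blinfun_apply \<kappa> (y n)))"]
    by (auto simp: bounded_linear_Blinfun_apply)
  show ?thesis
  proof (intro bexI allI)
    show "(\<lambda>n. blinfun_apply \<kappa> (y n)) \<longlonglongrightarrow> blinfun_apply \<kappa> z" for \<kappa> :: "'v \<Rightarrow>\<^sub>L real" using lim[of \<kappa>] z by simp
    show "z \<in> S"
    proof (rule ccontr)
      assume "z \<notin> S"
      then obtain p :: "'v \<Rightarrow>\<^sub>L real" where p: "p z \<noteq> 0" "\<And>y. y \<in> S \<Longrightarrow> p y = 0"
        using functional_vanishing_on_S by blast
      have "lim (\<lambda>n. p (y n)) = 0" using p(2) y(1) by (simp add: limI)
      then show False using p(1) z by simp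
    qed
  qed
qed

end

text \<open>Finite rational combinations of \<open>A\<close>, coded as lists, are countably many and
  stable under sums and rational multiples, so their closure is a real subspace. The empty list
  provides zero.\<close>

lemma separable_norming_exists:
  fixes A :: "'v::real_normed_vector set"
  assumes "countable A"
  obtains x l S where "separable_norming x l S" "A \<subseteq> S"
proof -
  define f :: "(rat \<times> 'v) list \<Rightarrow> 'v" where "f ps = (\<Sum>p\<leftarrow>ps. of_rat (fst p) *\<^sub>R snd p)" for ps
  define X where "X = f ` lists (UNIV \<times> A)"
  have "countable X" unfolding X_def using assms by (intro countable_image countable_lists countable_SIGMA) auto
  moreover have "f [] \<in> X" unfolding X_def by (intro imageI) auto
  ultimately obtain x :: "nat \<Rightarrow> 'v" where x: "range x = X"
    using range_from_nat_into[of X] by blast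
  have add: "a + b \<in> X" if ab: "a \<in> X" "b \<in> X" for a b
  proof -
    obtain ps qs where "ps \<in> lists (UNIV \<times> A)" "a = f ps" "qs \<in> lists (UNIV \<times> A)" "b = f qs"
      using ab unfolding X_def by blast
    then show ?thesis unfolding X_def by (intro image_eqI[of _ _ "ps @ qs"]) (auto simp: f_def)
  qed
  have scale: "of_rat r *\<^sub>R a \<in> X" if a: "a \<in> X" for r a
  proof -
    obtain ps where ps: "ps \<in> lists (UNIV \<times> A)" "a = f ps" using a unfolding X_def by blast
    have "of_rat r *\<^sub>R f qs = f (map (\<lambda>p. (r * fst p, snd p)) qs)" for qs
      by (induction qs) (auto simp: f_def of_rat_mult scaleR_add_right)
    then show ?thesis using ps unfolding X_def
      by (intro image_eqI[of _ _ "map (\<lambda>p. (r * fst p, snd p)) ps"]) (auto simp: in_lists_conv_set)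
  qed
  have "subspace (closure X)"
    unfolding subspace_def
  proof (intro conjI ballI allI)
    show "0 \<in> closure X" using \<open>f [] \<in> X\<close> closure_subset[of X] by (auto simp: f_def)
  next
    fix a b assume "a \<in> closure X" "b \<in> closure X"
    then obtain g h where "\<And>n. g n \<in> X" "g \<longlonglongrightarrow> a" "\<And>n. h n \<in> X" "h \<longlonglongrightarrow> b"
      unfolding closure_sequential by blast
    then show "a + b \<in> closure X" unfolding closure_sequential
      by (intro exI[of _ "\<lambda>n. g n + h n"]) (auto intro: tendsto_add add)
  next
    fix c :: real and a assume "a \<in> closure X"
    then obtain g where g: "\<And>n. g n \<in> X" "g \<longlonglongrightarrow> a" unfolding closure_sequential by blast
    have "\<exists>r. \<bar>of_rat r - c\<bar> < 1 / Suc n" for n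
      using of_rat_dense[of "c - 1 / Suc n" "c + 1 / Suc n"] by (auto simp: abs_less_iff algebra_simps)
    then obtain r where r: "\<And>n. \<bar>of_rat (r n) - c\<bar> < 1 / Suc n" by metis
    have "(\<lambda>n. of_rat (r n) - c) \<longlonglongrightarrow> 0"
      by (rule Lim_null_comparison[OF _ LIMSEQ_inverse_real_of_nat])
        (use r in \<open>auto simp: inverse_eq_divide intro!: always_eventually less_imp_le\<close>)
    then have "(\<lambda>n. of_rat (r n)) \<longlonglongrightarrow> c" by (simp add: LIM_zero_iff)
    then show "c *\<^sub>R a \<in> closure X" unfolding closure_sequential using g
      by (intro exI[of _ "\<lambda>n. of_rat (r n) *\<^sub>R g n"]) (auto intro: tendsto_scaleR scale)
  qed
  have "\<forall>a. \<exists>l :: 'v \<Rightarrow>\<^sub>L real. l a = norm a \<and> (\<forall>y. \<bar>l y\<bar> \<le> norm y)"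
    by (metis norming_functional)
  then obtain m :: "'v \<Rightarrow> 'v \<Rightarrow>\<^sub>L real" where m: "\<And>a. m a a = norm a" "\<And>a y. \<bar>m a y\<bar> \<le> norm y"
    by metis
  have "a \<in> X" if "a \<in> A" for a
    unfolding X_def using that by (intro image_eqI[of _ _ "[(1, a)]"]) (auto simp: f_def)
  then have "A \<subseteq> closure X" using closure_subset[of X] by blast
  moreover have "separable_norming x (\<lambda>i. m (x i)) (closure X)"
    by unfold_locales (use x m \<open>subspace (closure X)\<close> in auto)
  ultimately show ?thesis using that by blast
qed

section \<open>Square integrable functions on complete finite measure spaces\<close>

text \<open>Strong measurability prescribes only almost everywhere limits, and completeness makes
  such limits measurable. Finiteness makes bounded functions square integrable.\<close>

locale complete_finite_measure = finite_measure M + complete_measure M for M :: "'a measure"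
begin

section \<open>Measurability of vector-valued functions\<close>

lemma borel_measurable_AE_cong:
  fixes f g :: "'a \<Rightarrow> 'c::topological_space"
  assumes "f \<in> borel_measurable M" "AE x in M. f x = g x"
  shows "g \<in> borel_measurable M"
proof (rule measurableI)
  fix A :: "'c set" assume "A \<in> sets borel"
  then have f: "f -` A \<inter> space M \<in> sets M" using assms(1) by (rule measurable_sets[rotated])
  have "AE x in M. (x \<in> f -` A \<inter> space M) = (x \<in> g -` A \<inter> space M)"
    using assms(2) by eventually_elim auto
  then show "g -` A \<inter> space M \<in> sets M" using f by (rule in_sets_AE) auto
qed simp

lemma borel_measurable_AE_limit:
  fixes g :: "nat \<Rightarrow> 'a \<Rightarrow> 'c::{banach, second_countable_topology}"
  assumes "\<And>i. g i \<in> borel_measurable M" "AE x in M. (\<lambda>i. g i x) \<longlonglongrightarrow> f x"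
  shows "f \<in> borel_measurable M"
proof (rule borel_measurable_AE_cong)
  show "(\<lambda>x. lim (\<lambda>i. g i x)) \<in> borel_measurable M"
    using assms(1) by (rule borel_measurable_lim_metric)
  show "AE x in M. lim (\<lambda>i. g i x) = f x"
    using assms(2) by eventually_elim (rule limI)
qed

text \<open>A simple function takes finitely many values, so \<open>\<phi> x (s i x)\<close> is
  patched from finitely many measurable functions, and continuity in the second argument passes to
  the limit. This form fits a velocity field evaluated along a curve, where \<open>\<phi>\<close>
  depends on time through the position.\<close>

lemma strongly_measurable_Caratheodory:
  fixes f :: "'a \<Rightarrow> 'b::real_normed_vector" and \<phi> :: "'a \<Rightarrow> 'b \<Rightarrow> 'c::{banach, second_countable_topology}"
  assumes f: "strongly_measurable M f"
    and meas: "\<And>b. (\<lambda>x. \<phi> x b) \<in> borel_measurable M"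
    and cont: "\<And>x. x \<in> space M \<Longrightarrow> continuous_on UNIV (\<phi> x)"
  shows "(\<lambda>x. \<phi> x (f x)) \<in> borel_measurable M"
proof -
  obtain s where s: "\<And>i :: nat. simple_function M (s i)" "AE x in M. (\<lambda>i. s i x) \<longlonglongrightarrow> f x"
    using f unfolding strongly_measurable_def by blast
  show ?thesis
  proof (rule borel_measurable_AE_limit)
    fix i
    have fin: "finite (s i ` space M)" using s(1)[of i] by (rule simple_functionD)
    have "s i \<in> measurable M (count_space (s i ` space M))"
      unfolding measurable_count_space_eq2[OF fin]
      using simple_functionD(2)[OF s(1)[of i]] by auto
    then show "(\<lambda>x. \<phi> x (s i x)) \<in> borel_measurable M"
      by (rule measurable_compose_countable'[where f="\<lambda>b x. \<phi> x b", OF meas _ countable_finite[OF fin]])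
  next
    show "AE x in M. (\<lambda>i. \<phi> x (s i x)) \<longlonglongrightarrow> \<phi> x (f x)"
      using s(2) AE_space
    proof eventually_elim
      case (elim x)
      then show ?case using cont[of x]
        by (intro continuous_on_tendsto_compose[where s=UNIV and f="\<phi> x"]) auto
    qed
  qed
qed

lemma strongly_measurable_compose:
  fixes f :: "'a \<Rightarrow> 'b::real_normed_vector" and \<phi> :: "'b \<Rightarrow> 'c::{banach, second_countable_topology}"
  assumes "strongly_measurable M f" "continuous_on UNIV \<phi>"
  shows "(\<lambda>x. \<phi> (f x)) \<in> borel_measurable M"
  using strongly_measurable_Caratheodory[of f "\<lambda>_. \<phi>"] assms by simp

lemma strongly_measurable_simple: "simple_function M f \<Longrightarrow> strongly_measurable M f"
  unfolding strongly_measurable_def by (intro exI[of _ "\<lambda>_. f"]) auto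

lemma strongly_measurable_compose2:
  fixes f :: "'a \<Rightarrow> 'b::real_normed_vector" and g :: "'a \<Rightarrow> 'c::real_normed_vector"
    and \<phi> :: "'b \<times> 'c \<Rightarrow> 'd::real_normed_vector"
  assumes f: "strongly_measurable M f" and g: "strongly_measurable M g"
    and \<phi>: "continuous_on UNIV \<phi>"
  shows "strongly_measurable M (\<lambda>x. \<phi> (f x, g x))"
proof -
  obtain s where s: "\<And>i :: nat. simple_function M (s i)" "AE x in M. (\<lambda>i. s i x) \<longlonglongrightarrow> f x"
    using f unfolding strongly_measurable_def by blast
  obtain t where t: "\<And>i :: nat. simple_function M (t i)" "AE x in M. (\<lambda>i. t i x) \<longlonglongrightarrow> g x"
    using g unfolding strongly_measurable_def by blast
  show ?thesis unfolding strongly_measurable_def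
  proof (intro exI conjI allI)
    show "simple_function M (\<lambda>x. \<phi> (s i x, t i x))" for i
      by (rule simple_function_compose1[OF simple_function_Pair[OF s(1) t(1)]])
    show "AE x in M. (\<lambda>i. \<phi> (s i x, t i x)) \<longlonglongrightarrow> \<phi> (f x, g x)"
      using s(2) t(2)
      by eventually_elim (intro continuous_on_tendsto_compose[OF \<phi>] tendsto_Pair, auto)
  qed
qed

lemma strongly_measurable_add:
  fixes f g :: "'a \<Rightarrow> 'b::real_normed_vector"
  assumes "strongly_measurable M f" "strongly_measurable M g"
  shows "strongly_measurable M (\<lambda>x. f x + g x)"
  using strongly_measurable_compose2[OF assms, of "\<lambda>p. fst p + snd p"]
  by (simp add: continuous_on_add continuous_on_fst continuous_on_snd continuous_on_id)

lemma strongly_measurable_scaleR: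
  fixes f :: "'a \<Rightarrow> 'b::real_normed_vector" and c :: "'a \<Rightarrow> real"
  assumes "strongly_measurable M c" "strongly_measurable M f"
  shows "strongly_measurable M (\<lambda>x. c x *\<^sub>R f x)"
  using strongly_measurable_compose2[OF assms, of "\<lambda>p. fst p *\<^sub>R snd p"]
  by (simp add: continuous_on_scaleR continuous_on_fst continuous_on_snd continuous_on_id)

lemma strongly_measurable_real_iff:
  fixes f :: "'a \<Rightarrow> real"
  shows "strongly_measurable M f \<longleftrightarrow> f \<in> borel_measurable M"
proof
  assume "strongly_measurable M f"
  then show "f \<in> borel_measurable M"
    using strongly_measurable_compose[of f "\<lambda>x. x"] by (simp add: continuous_on_id)
next
  assume "f \<in> borel_measurable M"
  then obtain F where "\<And>i. simple_function M (F i)" "\<And>x. x \<in> space M \<Longrightarrow> (\<lambda>i. F i x) \<longlonglongrightarrow> f x"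
    using borel_measurable_implies_sequence_metric[of f M 0] by metis
  then show "strongly_measurable M f" unfolding strongly_measurable_def
    by (intro exI[of _ F]) auto
qed

text \<open>A function with values in a separable set is approximated by the nearest among
  \<open>y 0, ..., y k\<close>; selecting this point involves distances only, so their measurability
  is enough.\<close>

lemma strongly_measurable_if_dist_measurable:
  fixes v :: "'a \<Rightarrow> 'b::real_normed_vector" and y :: "nat \<Rightarrow> 'b"
  assumes v: "AE x in M. v x \<in> closure (range y)"
    and meas: "\<And>j. (\<lambda>x. norm (v x - y j)) \<in> borel_measurable M"
  shows "strongly_measurable M v"
proof -
  define s where "s = rec_nat (\<lambda>x. y 0) (\<lambda>k s x. if norm (v x - y (Suc k)) < norm (v x - s x) then y (Suc k) else s x)"
  have s0: "s 0 x = y 0" for x by (simp add: s_def)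
  have sS: "s (Suc k) x = (if norm (v x - y (Suc k)) < norm (v x - s k x) then y (Suc k) else s k x)" for k x
    by (simp add: s_def)
  have "simple_function M (s k) \<and> (\<lambda>x. norm (v x - s k x)) \<in> borel_measurable M" for k
  proof (induction k)
    case 0
    then show ?case using meas[of 0] by (simp add: s0[abs_def])
  next
    case (Suc k)
    note [measurable] = meas Suc[THEN conjunct2]
    have "simple_function M (s (Suc k))"
      unfolding sS[abs_def] using Suc by (intro simple_function_If) auto
    moreover have "norm (v x - s (Suc k) x) = min (norm (v x - y (Suc k))) (norm (v x - s k x))" for x
      by (simp add: sS)
    ultimately show ?case by simp
  qed
  then have simple: "simple_function M (s k)" for k by simp
  have le: "norm (v x - s k x) \<le> norm (v x - y i)" if "i \<le> k" for x k i
    using that by (induction k) (auto simp: s0 sS le_Suc_eq)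
  have "AE x in M. (\<lambda>k. s k x) \<longlonglongrightarrow> v x"
    using v
  proof eventually_elim
    case (elim x)
    show ?case
    proof (rule LIMSEQ_I)
      fix r :: real assume "0 < r"
      then obtain i where "norm (v x - y i) < r"
        using elim closure_approachable[of "v x" "range y"] by (auto simp: dist_norm norm_minus_commute)
      then have "norm (s k x - v x) < r" if "i \<le> k" for k
        using le[OF that, of x] by (simp add: norm_minus_commute)
      then show "\<exists>no. \<forall>n\<ge>no. norm (s n x - v x) < r" by blast
    qed
  qed
  with simple show ?thesis unfolding strongly_measurable_def by blast
qed

section \<open>Square integrable functions and density of simple functions\<close>

lemma L2I:
  assumes "strongly_measurable M f" "integrable M (\<lambda>x. (norm (f x))\<^sup>2)"
  shows "f \<in> L2 M"
  using assms by (simp add: L2_def)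

lemma L2_strongly_measurable: "f \<in> L2 M \<Longrightarrow> strongly_measurable M f"
  and L2_integrable: "f \<in> L2 M \<Longrightarrow> integrable M (\<lambda>x. (norm (f x))\<^sup>2)"
  by (auto simp: L2_def)

lemma L2_bound:
  assumes "strongly_measurable M f" "integrable M h" "AE x in M. (norm (f x))\<^sup>2 \<le> h x"
  shows "f \<in> L2 M"
proof (rule L2I[OF assms(1)])
  have "(\<lambda>x. (norm (f x))\<^sup>2) \<in> borel_measurable M"
    using strongly_measurable_compose[OF assms(1), of "\<lambda>y. (norm y)\<^sup>2"]
    by (auto intro!: continuous_intros)
  then show "integrable M (\<lambda>x. (norm (f x))\<^sup>2)"
    using assms(3) by (intro Bochner_Integration.integrable_bound[OF assms(2)]) auto
qed

lemma norm_add_sq: "(norm (a + b))\<^sup>2 \<le> 2 * (norm a)\<^sup>2 + 2 * (norm (b :: 'b::real_normed_vector))\<^sup>2"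
proof -
  have "(norm (a + b))\<^sup>2 \<le> (norm a + norm b)\<^sup>2" by (intro power_mono norm_triangle_ineq) auto
  also have "\<dots> \<le> 2 * (norm a)\<^sup>2 + 2 * (norm b)\<^sup>2"
    using sum_squares_bound[of "norm a" "norm b"] by (simp add: power2_sum)
  finally show ?thesis .
qed

lemma L2_add:
  assumes "f \<in> L2 M" "g \<in> L2 M"
  shows "(\<lambda>x. f x + g x) \<in> L2 M"
  by (rule L2_bound[where h="\<lambda>x. 2 * (norm (f x))\<^sup>2 + 2 * (norm (g x))\<^sup>2"])
    (use assms norm_add_sq in \<open>auto simp: L2_def intro: strongly_measurable_add\<close>)

lemma L2_scaleR:
  assumes "f \<in> L2 M"
  shows "(\<lambda>x. c *\<^sub>R f x) \<in> L2 M"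
proof (rule L2I)
  show "strongly_measurable M (\<lambda>x. c *\<^sub>R f x)"
    using assms by (intro strongly_measurable_scaleR strongly_measurable_simple L2_strongly_measurable) auto
  show "integrable M (\<lambda>x. (norm (c *\<^sub>R f x))\<^sup>2)"
    using L2_integrable[OF assms] by (simp add: power_mult_distrib)
qed

lemma L2_diff:
  assumes "f \<in> L2 M" "g \<in> L2 M"
  shows "(\<lambda>x. f x - g x) \<in> L2 M"
  using L2_add[OF assms(1) L2_scaleR[OF assms(2), of "-1"]] by simp

lemma L2_simple:
  assumes "simple_function M f"
  shows "f \<in> L2 M"
proof (rule L2_bound[OF strongly_measurable_simple[OF assms]])
  show "AE x in M. (norm (f x))\<^sup>2 \<le> Max ((\<lambda>y. (norm y)\<^sup>2) ` f ` space M)"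
    using simple_functionD(1)[OF assms] by (auto intro!: AE_I2 Max_ge)
qed simp

lemma L2_zero: "(\<lambda>x. 0) \<in> L2 M"
  by (rule L2_simple) simp

lemma L2_norm_sq: "(L2_norm M f)\<^sup>2 = (\<integral>x. (norm (f x))\<^sup>2 \<partial>M)"
  unfolding L2_norm_def by (simp add: integral_nonneg_AE)

lemma L2_norm_nonneg: "0 \<le> L2_norm M f"
  unfolding L2_norm_def by (simp add: integral_nonneg_AE)

text \<open>The simple functions from strong measurability converge only pointwise. Cutting them off
  at \<open>2 * norm (f x)\<close> gives the dominating function
  \<open>9 * (norm (f x))\<^sup>2\<close>; the factor \<open>2\<close> leaves room so that, where
  \<open>f x\<close> is nonzero, eventually nothing is cut.\<close>

lemma L2_simple_dense:
  fixes f :: "'a \<Rightarrow> 'b::real_normed_vector"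
  assumes f: "f \<in> L2 M" and e: "0 < e"
  shows "\<exists>s. simple_function M s \<and> (\<integral>x. (norm (f x - s x))\<^sup>2 \<partial>M) < e"
proof -
  obtain s where s: "\<And>i :: nat. simple_function M (s i)" "AE x in M. (\<lambda>i. s i x) \<longlonglongrightarrow> f x"
    using L2_strongly_measurable[OF f] unfolding strongly_measurable_def by blast
  define t where "t i x = (if norm (s i x) \<le> 2 * norm (f x) then s i x else 0)" for i x
  have [measurable]: "(\<lambda>x. norm (f x)) \<in> borel_measurable M"
    by (rule strongly_measurable_compose[OF L2_strongly_measurable[OF f]]) (intro continuous_intros)
  have [measurable]: "(\<lambda>x. norm (s i x)) \<in> borel_measurable M" for i
    by (rule strongly_measurable_compose[OF strongly_measurable_simple[OF s(1)]]) (intro continuous_intros)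
  have t: "simple_function M (t i)" for i
    unfolding t_def by (intro simple_function_If s(1)) auto
  have lim: "AE x in M. (\<lambda>i. (norm (f x - t i x))\<^sup>2) \<longlonglongrightarrow> 0"
    using s(2)
  proof eventually_elim
    case (elim x)
    have "(\<lambda>i. t i x) \<longlonglongrightarrow> f x"
    proof (cases "f x = 0")
      case True
      then have "t i x = 0" for i by (auto simp: t_def)
      then show ?thesis using True by simp
    next
      case False
      have "eventually (\<lambda>i. norm (s i x) < 2 * norm (f x)) sequentially"
        using False by (intro order_tendstoD(2)[OF tendsto_norm[OF elim]]) auto
      then have "eventually (\<lambda>i. s i x = t i x) sequentially"
        by eventually_elim (auto simp: t_def)
      then show ?thesis using elim by (rule Lim_transform_eventually[rotated])
    qed
    then have "(\<lambda>i. (norm (f x - t i x))\<^sup>2) \<longlonglongrightarrow> (norm (f x - f x))\<^sup>2" by (intro tendsto_intros)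
    then show ?case by simp
  qed
  have le: "(norm (f x - t i x))\<^sup>2 \<le> 9 * (norm (f x))\<^sup>2" for i x
  proof -
    have "norm (t i x) \<le> 2 * norm (f x)" by (auto simp: t_def)
    then have "norm (f x - t i x) \<le> 3 * norm (f x)" using norm_triangle_ineq4[of "f x" "t i x"] by simp
    then have "(norm (f x - t i x))\<^sup>2 \<le> (3 * norm (f x))\<^sup>2" by (rule power_mono) simp
    then show ?thesis by (simp add: power_mult_distrib)
  qed
  have "(\<lambda>i. \<integral>x. (norm (f x - t i x))\<^sup>2 \<partial>M) \<longlonglongrightarrow> (\<integral>x. 0 \<partial>M)"
  proof (rule integral_dominated_convergence[where w="\<lambda>x. 9 * (norm (f x))\<^sup>2"])
    show "(\<lambda>x. (norm (f x - t i x))\<^sup>2) \<in> borel_measurable M" for i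
      using L2_integrable[OF L2_diff[OF f L2_simple[OF t]]] by simp
  qed (use lim le L2_integrable[OF f] in auto)
  then have "eventually (\<lambda>i. (\<integral>x. (norm (f x - t i x))\<^sup>2 \<partial>M) < e) sequentially"
    using e by (intro order_tendstoD(2)[of _ 0]) auto
  then obtain i where "(\<integral>x. (norm (f x - t i x))\<^sup>2 \<partial>M) < e"
    by (auto simp: eventually_sequentially)
  with t show ?thesis by (intro exI conjI)
qed

section \<open>Bounded functionals and the Cauchy-Schwarz inequality\<close>

lemma L2_functional_bound:
  fixes l :: "('a \<Rightarrow> 'b::real_normed_vector) \<Rightarrow> real"
  assumes "L2_functional M l"
  obtains B where "0 < B" "\<And>f. f \<in> L2 M \<Longrightarrow> \<bar>l f\<bar> \<le> B * L2_norm M f"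
proof -
  have "\<exists>B. \<forall>f\<in>L2 M. \<bar>l f\<bar> \<le> B * L2_norm M f"
    using assms unfolding L2_functional_def by (elim conjE)
  then obtain B where "\<And>f. f \<in> L2 M \<Longrightarrow> \<bar>l f\<bar> \<le> B * L2_norm M f" by auto
  moreover have "B * L2_norm M f \<le> max B 1 * L2_norm M f" for f :: "'a \<Rightarrow> 'b"
    using L2_norm_nonneg[of f] by (intro mult_right_mono) auto
  ultimately have "\<bar>l f\<bar> \<le> max B 1 * L2_norm M f" if "f \<in> L2 M" for f
    using that order_trans by blast
  then show ?thesis using that[of "max B 1"] by simp
qed

lemma L2_functional_add:
  "L2_functional M l \<Longrightarrow> f \<in> L2 M \<Longrightarrow> g \<in> L2 M \<Longrightarrow> l (\<lambda>x. f x + g x) = l f + l g"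
  unfolding L2_functional_def by blast

lemma L2_functional_scaleR: "L2_functional M l \<Longrightarrow> f \<in> L2 M \<Longrightarrow> l (\<lambda>x. c *\<^sub>R f x) = c * l f"
  unfolding L2_functional_def by blast

lemma L2_functional_diff:
  assumes "L2_functional M l" "f \<in> L2 M" "g \<in> L2 M"
  shows "l (\<lambda>x. f x - g x) = l f - l g"
  using L2_functional_add[OF assms(1,2) L2_scaleR[OF assms(3), of "-1"]]
    L2_functional_scaleR[OF assms(1,3), of "-1"] by simp

lemma L2_functional_tendsto_zero:
  assumes l: "L2_functional M l" and u: "\<And>n. u n \<in> L2 M"
    and lim: "(\<lambda>n. \<integral>x. (norm (u n x))\<^sup>2 \<partial>M) \<longlonglongrightarrow> 0"
  shows "(\<lambda>n. l (u n)) \<longlonglongrightarrow> 0"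
proof -
  obtain B where B: "0 < B" "\<And>f. f \<in> L2 M \<Longrightarrow> \<bar>l f\<bar> \<le> B * L2_norm M f"
    using L2_functional_bound[OF l] by blast
  have "(\<lambda>n. B * sqrt (\<integral>x. (norm (u n x))\<^sup>2 \<partial>M)) \<longlonglongrightarrow> B * sqrt 0"
    by (intro tendsto_intros lim)
  then have lim0: "(\<lambda>n. B * L2_norm M (u n)) \<longlonglongrightarrow> 0" by (simp add: L2_norm_def)
  have "\<forall>n. norm (l (u n)) \<le> B * L2_norm M (u n)" using B(2)[OF u] by simp
  then show ?thesis by (rule Lim_null_comparison[OF always_eventually lim0])
qed

text \<open>Functionals act on representatives; being bounded by the seminorm, they do not see null
  sets.\<close>

lemma L2_functional_AE_cong:
  assumes l: "L2_functional M l" and f: "f \<in> L2 M" and g: "g \<in> L2 M" and eq: "AE x in M. f x = g x"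
  shows "l f = l g"
proof -
  have "(\<integral>x. (norm (f x - g x))\<^sup>2 \<partial>M) = 0"
    using eq by (subst integral_eq_zero_AE) auto
  then have "(\<lambda>n::nat. l (\<lambda>x. f x - g x)) \<longlonglongrightarrow> 0"
    by (intro L2_functional_tendsto_zero[OF l L2_diff[OF f g]]) simp
  then show ?thesis using L2_functional_diff[OF l f g] by (simp add: LIMSEQ_const_iff)
qed

text \<open>Cauchy-Schwarz from the weighted inequality of arithmetic and geometric means,
  \<open>2 * I \<le> c * F + G / c\<close> for every positive \<open>c\<close>.\<close>

lemma integrable_mult_L2:
  fixes f g :: "'a \<Rightarrow> real"
  assumes "f \<in> borel_measurable M" "g \<in> borel_measurable M"
    and "integrable M (\<lambda>x. (f x)\<^sup>2)" "integrable M (\<lambda>x. (g x)\<^sup>2)"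
  shows "integrable M (\<lambda>x. f x * g x)"
    "\<bar>\<integral>x. f x * g x \<partial>M\<bar> \<le> sqrt (\<integral>x. (f x)\<^sup>2 \<partial>M) * sqrt (\<integral>x. (g x)\<^sup>2 \<partial>M)"
proof -
  have amgm: "\<bar>f x * g x\<bar> \<le> (c * (f x)\<^sup>2 + (g x)\<^sup>2 / c) / 2" if "0 < c" for c x
  proof -
    have "0 \<le> (sqrt c * \<bar>f x\<bar> - \<bar>g x\<bar> / sqrt c)\<^sup>2" by simp
    also have "\<dots> = c * (f x)\<^sup>2 + (g x)\<^sup>2 / c - 2 * \<bar>f x * g x\<bar>"
      using that by (simp add: power2_diff power_mult_distrib power_divide abs_mult)
    finally show ?thesis by simp
  qed
  show int: "integrable M (\<lambda>x. f x * g x)"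
    by (rule Bochner_Integration.integrable_bound[where f="\<lambda>x. (1 * (f x)\<^sup>2 + (g x)\<^sup>2 / 1) / 2"])
      (use assms amgm[of 1] in auto)
  define F G where "F = (\<integral>x. (f x)\<^sup>2 \<partial>M)" and "G = (\<integral>x. (g x)\<^sup>2 \<partial>M)"
  have FG: "0 \<le> F" "0 \<le> G" by (auto simp: F_def G_def)
  have le: "\<bar>\<integral>x. f x * g x \<partial>M\<bar> \<le> (c * F + G / c) / 2" if "0 < c" for c
  proof -
    have "\<bar>\<integral>x. f x * g x \<partial>M\<bar> \<le> (\<integral>x. \<bar>f x * g x\<bar> \<partial>M)" by (rule integral_abs_bound)
    also have "\<dots> \<le> (\<integral>x. (c * (f x)\<^sup>2 + (g x)\<^sup>2 / c) / 2 \<partial>M)"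
      by (rule integral_mono) (use assms int amgm[OF that] in auto)
    also have "\<dots> = (c * F + G / c) / 2" using assms by (simp add: F_def G_def)
    finally show ?thesis .
  qed
  define I where "I = \<bar>\<integral>x. f x * g x \<partial>M\<bar>"
  have le2: "2 * I \<le> c * F + G / c" if "0 < c" for c
  proof -
    have "I \<le> (c * F + G / c) / 2" using le[OF that] by (simp only: I_def)
    then show ?thesis unfolding le_divide_eq_numeral1 by (simp only: mult.commute)
  qed
  have "I \<le> sqrt F * sqrt G"
  proof (rule ccontr)
    assume "\<not> ?thesis"
    then have I: "sqrt F * sqrt G < I" by simp
    have "0 \<le> sqrt F * sqrt G" using FG by simp
    then have I0: "0 < I" using I by linarith
    \<comment> \<open>For \<open>F = 0\<close> a large weight and for \<open>G = 0\<close> a small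
      weight give \<open>2 * I \<le> I\<close>; otherwise \<open>c = sqrt G / sqrt F\<close> is the
      optimal weight.\<close>
    consider "F = 0" | "G = 0" | "0 < F" "0 < G" using FG by linarith
    then show False
    proof cases
      case 1
      have "G / (G / I + 1) \<le> I" using I0 FG by (simp add: pos_divide_le_eq add_nonneg_pos field_simps)
      moreover have "2 * I \<le> G / (G / I + 1)" using le2[of "G / I + 1"] 1 I0 FG
        by (simp add: add_nonneg_pos)
      ultimately show False using I0 by simp
    next
      case 2
      have "I / (F + 1) * F \<le> I" using I0 FG by (simp add: field_simps)
      moreover have "2 * I \<le> I / (F + 1) * F" using le2[of "I / (F + 1)"] 2 I0 FG by simp
      ultimately show False using I0 by simp
    next
      case 3
      have FG': "F / sqrt F = sqrt F" "G / sqrt G = sqrt G" using 3 by (simp_all add: real_div_sqrt)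
      have "sqrt G / sqrt F * F = sqrt G * (F / sqrt F)" by simp
      moreover have "G / (sqrt G / sqrt F) = sqrt F * (G / sqrt G)" by simp
      ultimately show False using le2[of "sqrt G / sqrt F"] 3 I unfolding FG' by (simp add: mult.commute)
    qed
  qed
  then show "\<bar>\<integral>x. f x * g x \<partial>M\<bar> \<le> sqrt (\<integral>x. (f x)\<^sup>2 \<partial>M) * sqrt (\<integral>x. (g x)\<^sup>2 \<partial>M)"
    unfolding F_def G_def I_def .
qed

lemma integral_sq_le:
  fixes f :: "'a \<Rightarrow> real"
  assumes "f \<in> borel_measurable M" "integrable M (\<lambda>x. (f x)\<^sup>2)"
  shows "integrable M f" "(\<integral>x. \<bar>f x\<bar> \<partial>M) \<le> sqrt (measure M (space M)) * sqrt (\<integral>x. (f x)\<^sup>2 \<partial>M)"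
  using integrable_mult_L2(1)[of "\<lambda>_. 1" f] integrable_mult_L2(2)[of "\<lambda>_. 1" "\<lambda>x. \<bar>f x\<bar>"] assms
  by simp_all

end

section \<open>Weakly convergent forward convex combinations\<close>

text \<open>Convex combinations with dyadic weights, built from midpoints alone: the parallelogram
  law involves nothing else, and an affine identity or a convex bound passes to all of them by one
  induction step.\<close>

inductive_set mid_combs :: "(nat \<Rightarrow> 'a \<Rightarrow> 'b::real_vector) \<Rightarrow> nat \<Rightarrow> ('a \<Rightarrow> 'b) set"
  for v :: "nat \<Rightarrow> 'a \<Rightarrow> 'b" and n :: nat where
  base: "n \<le> k \<Longrightarrow> v k \<in> mid_combs v n"
| mid: "f \<in> mid_combs v n \<Longrightarrow> g \<in> mid_combs v n \<Longrightarrow> (\<lambda>x. (1/2) *\<^sub>R (f x + g x)) \<in> mid_combs v n"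

lemma mid_combs_antimono:
  assumes "f \<in> mid_combs v n" "m \<le> n"
  shows "f \<in> mid_combs v m"
  using assms by (induction rule: mid_combs.induct) (auto intro: mid_combs.intros)

text \<open>Near-minimizers over the tails are Cauchy by the parallelogram law, as in the proof of the
  Hilbert projection theorem; \<open>R f g\<close> stands for \<open>Q (f - g)\<close>.\<close>

lemma mid_combs_Cauchy:
  fixes Q :: "('a \<Rightarrow> 'b::real_vector) \<Rightarrow> real"
  assumes Q: "\<And>f. f \<in> mid_combs v 0 \<Longrightarrow> 0 \<le> Q f" "\<And>f. f \<in> mid_combs v 0 \<Longrightarrow> Q f \<le> B"
    and R: "\<And>f g. f \<in> mid_combs v 0 \<Longrightarrow> g \<in> mid_combs v 0 \<Longrightarrow>
      R f g = 2 * Q f + 2 * Q g - 4 * Q (\<lambda>x. (1/2) *\<^sub>R (f x + g x))"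
  obtains w where "\<And>n. w n \<in> mid_combs v n"
    "\<And>e. 0 < e \<Longrightarrow> \<exists>N. \<forall>m\<ge>N. \<forall>n\<ge>N. R (w m) (w n) < e"
proof -
  define d where "d n = Inf (Q ` mid_combs v n)" for n
  have ne: "mid_combs v n \<noteq> {}" for n using mid_combs.base[of n n v] by auto
  have bdd: "bdd_below (Q ` mid_combs v n)" for n
    using Q(1) mid_combs_antimono by (intro bdd_belowI2[where m=0]) blast
  have d_le: "d n \<le> Q f" if "f \<in> mid_combs v n" for f n
    unfolding d_def using bdd that by (rule cINF_lower)
  have "incseq d"
  proof (rule incseq_SucI)
    show "d n \<le> d (Suc n)" for n
      unfolding d_def by (rule cINF_superset_mono[OF ne bdd]) (auto intro: mid_combs_antimono)
  qed
  moreover have "d n \<le> B" for n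
    using d_le[OF mid_combs.base[of n n v]] Q(2)[OF mid_combs.base[of 0 n v]] by simp
  ultimately obtain D where D: "d \<longlonglongrightarrow> D" "\<And>n. d n \<le> D" using incseq_convergent[of d B] by blast
  have "\<exists>f\<in>mid_combs v n. Q f < d n + 1 / Suc n" for n
    using cInf_lessD[of "Q ` mid_combs v n" "d n + 1 / Suc n"] ne[of n] by (auto simp: d_def)
  then obtain w where w: "\<And>n. w n \<in> mid_combs v n" "\<And>n. Q (w n) < d n + 1 / Suc n" by metis
  show ?thesis
  proof (rule that[of w])
    fix e :: real assume e: "0 < e"
    have "(\<lambda>n. 4 * (D - d n) + 4 * (1 / Suc n)) \<longlonglongrightarrow> 4 * (D - D) + 4 * 0"
      using D(1) LIMSEQ_inverse_real_of_nat by (intro tendsto_intros) (simp_all add: inverse_eq_divide)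
    then have "eventually (\<lambda>n. 4 * (D - d n) + 4 * (1 / Suc n) < e) sequentially"
      using e by (intro order_tendstoD(2)) auto
    then obtain N where N: "4 * (D - d N) + 4 * (1 / Suc N) < e" by (auto simp: eventually_sequentially)
    have "R (w m) (w n) < e" if "N \<le> m" "N \<le> n" for m n
    proof -
      have in0: "w k \<in> mid_combs v 0" for k using mid_combs_antimono[OF w(1)] by simp
      \<comment> \<open>The midpoint again belongs to the tail from \<open>N\<close>, so its
        \<open>Q\<close> is at least \<open>d N\<close>, while both endpoints are below
        \<open>D + 1 / Suc N\<close>. The parallelogram identity leaves
        \<open>4 * (D - d N) + 4 * (1 / Suc N)\<close>.\<close>
      have "(\<lambda>x. (1/2) *\<^sub>R (w m x + w n x)) \<in> mid_combs v N"
        using w(1) that by (intro mid_combs.mid) (auto intro: mid_combs_antimono)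
      then have "d N \<le> Q (\<lambda>x. (1/2) *\<^sub>R (w m x + w n x))" by (rule d_le)
      moreover have "Q (w k) < D + 1 / Suc N" if "N \<le> k" for k
      proof -
        have "1 / real (Suc k) \<le> 1 / real (Suc N)" using that by (simp add: frac_le)
        then show ?thesis using w(2)[of k] D(2)[of k] by linarith
      qed
      ultimately show ?thesis using R[OF in0 in0, of m n] that N by (smt (verit))
    qed
    then show "\<exists>N. \<forall>m\<ge>N. \<forall>n\<ge>N. R (w m) (w n) < e" by blast
  qed (rule w(1))
qed

lemma convergent_if_geometric_increments:
  fixes a :: "nat \<Rightarrow> real"
  assumes "\<And>k. \<bar>a (Suc k) - a k\<bar> \<le> D * (1/2) ^ k"
  shows "convergent a"
proof -
  have "summable (\<lambda>k. a (Suc k) - a k)"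
    by (rule summable_comparison_test[where g="\<lambda>k. D * (1/2) ^ k"])
      (use assms in \<open>auto intro!: summable_mult summable_geometric\<close>)
  then have "convergent (\<lambda>n. \<Sum>k<n. a (Suc k) - a k)" by (simp add: summable_iff_convergent)
  then have "convergent (\<lambda>n. a n - a 0)" by (simp add: sum_lessThan_telescope)
  then have "convergent (\<lambda>n. (a n - a 0) + a 0)" by (intro convergent_add convergent_const)
  then show ?thesis by simp
qed

context separable_norming
begin

text \<open>A Hilbert seminorm on \<open>'v\<close> whose convergence controls all functionals \<open>l i\<close>.\<close>

definition hform :: "'v \<Rightarrow> 'v \<Rightarrow> real" where
  "hform y z = (\<Sum>i. (1/2) ^ i * (l i y * l i z))"

lemma hform_summable: "summable (\<lambda>i. (1/2) ^ i * (l i y * l i z))"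
proof (rule summable_comparison_test[where g="\<lambda>i. (1/2) ^ i * (norm y * norm z)"])
  show "\<exists>N. \<forall>n\<ge>N. norm ((1/2) ^ n * (l n y * l n z)) \<le> (1/2) ^ n * (norm y * norm z)"
    using l_le_norm by (auto simp: abs_mult intro!: exI mult_left_mono mult_mono)
qed (intro summable_mult2 summable_geometric, simp)

lemma hform_commute: "hform y z = hform z y"
  by (simp add: hform_def mult.commute)

lemma hform_add: "hform (y + y') z = hform y z + hform y' z"
  unfolding hform_def
  by (subst suminf_add[OF hform_summable hform_summable]) (simp add: blinfun.add_right algebra_simps)

lemma hform_scaleR: "hform (c *\<^sub>R y) z = c * hform y z"
  unfolding hform_def
  by (subst suminf_mult[OF hform_summable, symmetric]) (simp add: blinfun.scaleR_right algebra_simps)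

lemma hform_diff: "hform (y - y') z = hform y z - hform y' z"
  using hform_add[of y "(-1) *\<^sub>R y'" z] hform_scaleR[of "-1" y' z] by simp

lemma hform_nonneg: "0 \<le> hform y y"
  unfolding hform_def by (intro suminf_nonneg hform_summable) auto

lemma hform_parallelogram:
  "hform (y - z) (y - z) = 2 * hform y y + 2 * hform z z - 4 * hform ((1/2) *\<^sub>R (y + z)) ((1/2) *\<^sub>R (y + z))"
proof -
  have r: "hform a (b + c) = hform a b + hform a c" "hform a (b - c) = hform a b - hform a c"
    "hform a (t *\<^sub>R b) = t * hform a b" for a b c t
    using hform_add[of b c a] hform_diff[of b c a] hform_scaleR[of t b a] by (simp_all add: hform_commute[of a])
  show ?thesis
    by (simp add: hform_add hform_diff hform_scaleR r) (simp add: hform_commute[of z y] field_simps)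
qed

lemma functional_sq_le_hform: "(l i y)\<^sup>2 \<le> 2 ^ i * hform y y"
proof -
  have "(1/2) ^ i * (l i y)\<^sup>2 \<le> hform y y"
    using sum_le_suminf[OF hform_summable[of y y], of "{i}"] by (simp add: hform_def power2_eq_square)
  then show ?thesis by (simp add: power_divide field_simps)
qed

lemma abs_hform_le: "\<bar>hform y z\<bar> \<le> 2 * (norm y * norm z)"
proof -
  have "norm (hform y z) \<le> (\<Sum>i. (1/2) ^ i * (norm y * norm z))"
    unfolding hform_def
    by (rule norm_suminf_le)
      (use l_le_norm in \<open>auto simp: abs_mult intro!: mult_left_mono mult_mono summable_mult2 summable_geometric\<close>)
  also have "\<dots> = (\<Sum>i. (1/2) ^ i) * (norm y * norm z)"
    by (rule suminf_mult2[symmetric]) (simp add: summable_geometric)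
  finally show ?thesis by (simp add: suminf_geometric)
qed

end

context complete_finite_measure
begin

section \<open>Square integrable combinations and their almost everywhere limits\<close>

lemma mid_combs_L2:
  assumes v: "\<And>n. v n \<in> L2 M" "\<And>n. (\<integral>x. (norm (v n x))\<^sup>2 \<partial>M) \<le> B" and f: "f \<in> mid_combs v n"
  shows "f \<in> L2 M" "(\<integral>x. (norm (f x))\<^sup>2 \<partial>M) \<le> B"
proof -
  have "f \<in> L2 M \<and> (\<integral>x. (norm (f x))\<^sup>2 \<partial>M) \<le> B"
    using f
  proof induction
    case (mid f g)
    have fg: "(\<lambda>x. (1/2) *\<^sub>R (f x + g x)) \<in> L2 M"
      using mid by (intro L2_scaleR L2_add) auto
    have le: "(norm ((1/2) *\<^sub>R (f x + g x)))\<^sup>2 \<le> (1/2) * (norm (f x))\<^sup>2 + (1/2) * (norm (g x))\<^sup>2" for x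
      using norm_add_sq[of "f x" "g x"] by (simp add: power_divide)
    have "(\<integral>x. (norm ((1/2) *\<^sub>R (f x + g x)))\<^sup>2 \<partial>M)
        \<le> (\<integral>x. (1/2) * (norm (f x))\<^sup>2 + (1/2) * (norm (g x))\<^sup>2 \<partial>M)"
      using L2_integrable[OF fg] mid le by (intro integral_mono) (auto simp: L2_integrable)
    also have "\<dots> = (1/2) * (\<integral>x. (norm (f x))\<^sup>2 \<partial>M) + (1/2) * (\<integral>x. (norm (g x))\<^sup>2 \<partial>M)"
      using mid by (subst Bochner_Integration.integral_add) (auto simp: L2_integrable)
    also have "\<dots> \<le> B" using mid by linarith
    finally show ?case using fg by simp
  qed (use v in simp)
  then show "f \<in> L2 M" "(\<integral>x. (norm (f x))\<^sup>2 \<partial>M) \<le> B" by auto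
qed

lemma L2_blinfun:
  fixes \<kappa> :: "'b::real_normed_vector \<Rightarrow>\<^sub>L real"
  assumes "f \<in> L2 M"
  shows "(\<lambda>x. \<kappa> (f x)) \<in> borel_measurable M" "integrable M (\<lambda>x. (\<kappa> (f x))\<^sup>2)"
proof -
  show meas: "(\<lambda>x. \<kappa> (f x)) \<in> borel_measurable M"
    by (rule strongly_measurable_compose[OF L2_strongly_measurable[OF assms]]) (intro continuous_intros)
  have "(\<kappa> (f x))\<^sup>2 \<le> (norm \<kappa>)\<^sup>2 * (norm (f x))\<^sup>2" for x
    using power_mono[OF norm_blinfun[of \<kappa> "f x"], of 2] by (simp add: power_mult_distrib)
  then show "integrable M (\<lambda>x. (\<kappa> (f x))\<^sup>2)"
    using meas
    by (intro Bochner_Integration.integrable_bound[OF integrable_mult_right[OF L2_integrable[OF assms], of "(norm \<kappa>)\<^sup>2"]]) simp_all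
qed

lemma integral_norm_diff_sq_le:
  assumes "f \<in> L2 M" "g \<in> L2 M"
  shows "(\<integral>x. (norm (f x - g x))\<^sup>2 \<partial>M) \<le> 2 * (\<integral>x. (norm (f x))\<^sup>2 \<partial>M) + 2 * (\<integral>x. (norm (g x))\<^sup>2 \<partial>M)"
proof -
  have "(\<integral>x. (norm (f x - g x))\<^sup>2 \<partial>M) \<le> (\<integral>x. 2 * (norm (f x))\<^sup>2 + 2 * (norm (g x))\<^sup>2 \<partial>M)"
    using L2_integrable[OF L2_diff[OF assms]] assms norm_add_sq[of "f _" "- g _"]
    by (intro integral_mono) (auto simp: L2_integrable)
  then show ?thesis using assms by (simp add: L2_integrable)
qed

text \<open>The sum of the \<open>h k\<close> has a finite integral, so it is finite almost
  everywhere, and it bounds each of its terms.\<close>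

lemma AE_bounded_terms_of_summable_integrals:
  fixes h :: "nat \<Rightarrow> 'a \<Rightarrow> real"
  assumes h: "\<And>k. integrable M (h k)" "\<And>k x. 0 \<le> h k x" and le: "\<And>k. (\<integral>x. h k x \<partial>M) \<le> (1/2) ^ k"
  shows "AE x in M. \<exists>C. \<forall>k. h k x \<le> C"
proof -
  have "(\<integral>\<^sup>+x. (\<Sum>k. ennreal (h k x)) \<partial>M) = (\<Sum>k. \<integral>\<^sup>+x. ennreal (h k x) \<partial>M)"
    using h by (intro nn_integral_suminf) auto
  also have "\<dots> \<le> (\<Sum>k. ennreal ((1/2) ^ k))"
    using h le by (intro suminf_le) (auto simp: nn_integral_eq_integral)
  also have "\<dots> = ennreal (\<Sum>k. (1/2) ^ k)"
    by (intro suminf_ennreal2 summable_geometric) auto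
  also have "\<dots> < \<infinity>" by simp
  finally have "AE x in M. (\<Sum>k. ennreal (h k x)) \<noteq> \<infinity>"
    using h by (intro nn_integral_PInf_AE) auto
  then show ?thesis
  proof eventually_elim
    case (elim x)
    have "h k x \<le> enn2real (\<Sum>k. ennreal (h k x))" for k
    proof -
      have "ennreal (h k x) \<le> (\<Sum>k. ennreal (h k x))"
        using sum_le_suminf[of "\<lambda>k. ennreal (h k x)" "{k}"] by simp
      also have "\<dots> = ennreal (enn2real (\<Sum>k. ennreal (h k x)))" using elim by (simp add: top.not_eq_extremum)
      finally show ?thesis by simp
    qed
    then show ?case by blast
  qed
qed

text \<open>At a given point, Fatou's lemma bounds the norms only along a subsequence depending on
  that point, which is extracted here.\<close>

lemma frequently_bounded_if_liminf_finite:
  fixes a :: "nat \<Rightarrow> real"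
  assumes "liminf (\<lambda>k. ennreal (a k)) \<noteq> \<infinity>"
  shows "\<exists>r C. strict_mono (r :: nat \<Rightarrow> nat) \<and> (\<forall>k. a (r k) \<le> C)"
proof -
  define C where "C = enn2real (liminf (\<lambda>k. ennreal (a k))) + 1"
  have L: "liminf (\<lambda>k. ennreal (a k)) < ennreal C"
    using assms by (cases "liminf (\<lambda>k. ennreal (a k))") (auto simp: C_def ennreal_less_iff)
  have "infinite {k. a k \<le> C}"
  proof
    assume "finite {k. a k \<le> C}"
    then obtain N where N: "\<forall>k\<in>{k. a k \<le> C}. k < N" unfolding finite_nat_set_iff_bounded ..
    have "ennreal C \<le> ennreal (a k)" if "N \<le> k" for k
      using N that by (intro ennreal_leI) (metis leD linear mem_Collect_eq)
    then have "eventually (\<lambda>k. ennreal C \<le> ennreal (a k)) sequentially"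
      unfolding eventually_sequentially by blast
    then have "ennreal C \<le> liminf (\<lambda>k. ennreal (a k))" by (rule Liminf_bounded)
    then show False using L by simp
  qed
  from infinite_enumerate[OF this] obtain r :: "nat \<Rightarrow> nat" where "strict_mono r" "\<forall>k. r k \<in> {k. a k \<le> C}"
    by auto
  then show ?thesis by auto
qed

lemma Fatou_real:
  fixes h :: "nat \<Rightarrow> 'a \<Rightarrow> real"
  assumes h: "\<And>k. integrable M (h k)" "\<And>k x. 0 \<le> h k x"
    and le: "eventually (\<lambda>k. (\<integral>x. h k x \<partial>M) \<le> C) sequentially"
  shows "(\<integral>\<^sup>+x. liminf (\<lambda>k. ennreal (h k x)) \<partial>M) \<le> ennreal C"
proof -
  have "(\<integral>\<^sup>+x. liminf (\<lambda>k. ennreal (h k x)) \<partial>M) \<le> liminf (\<lambda>k. \<integral>\<^sup>+x. ennreal (h k x) \<partial>M)"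
    using h by (intro nn_integral_liminf) auto
  also have "\<dots> = liminf (\<lambda>k. ennreal (\<integral>x. h k x \<partial>M))"
    using h by (simp add: nn_integral_eq_integral)
  also have "\<dots> \<le> ennreal C"
  proof -
    have "eventually (\<lambda>k. ennreal (\<integral>x. h k x \<partial>M) \<le> ennreal C) sequentially"
      using le by eventually_elim (rule ennreal_leI)
    then have "liminf (\<lambda>k. ennreal (\<integral>x. h k x \<partial>M)) \<le> liminf (\<lambda>k. ennreal C)"
      by (rule Liminf_mono)
    then show ?thesis by (simp add: Liminf_const)
  qed
  finally show ?thesis .
qed


lemma hform_L2:
  fixes f g :: "'a \<Rightarrow> 'b::real_normed_vector"
  assumes sn: "separable_norming y l S" and f: "f \<in> L2 M" and g: "g \<in> L2 M"
  shows "integrable M (\<lambda>x. separable_norming.hform l (f x) (g x))"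
proof -
  interpret separable_norming y l S by (rule sn)
  have m: "(\<lambda>x. l i (f x)) \<in> borel_measurable M" "(\<lambda>x. l i (g x)) \<in> borel_measurable M" for i
    using L2_blinfun(1) f g by auto
  have meas: "(\<lambda>x. hform (f x) (g x)) \<in> borel_measurable M"
    unfolding hform_def using m by measurable
  have le: "\<bar>hform (f x) (g x)\<bar> \<le> (norm (f x))\<^sup>2 + (norm (g x))\<^sup>2" for x
    using abs_hform_le[of "f x" "g x"] sum_squares_bound[of "norm (f x)" "norm (g x)"] by simp
  show ?thesis
    by (rule Bochner_Integration.integrable_bound[OF Bochner_Integration.integrable_add[OF L2_integrable[OF f] L2_integrable[OF g]]])
      (use meas le in auto)
qed

text \<open>Almost everywhere limits of the scalar functions \<open>l i \<circ> w n\<close> are, by Fatou's lemma and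
  reflexivity, of the form \<open>l i \<circ> u\<close>.\<close>

lemma pointwise_weak_limit:
  fixes w :: "nat \<Rightarrow> 'a \<Rightarrow> 'b::real_normed_vector"
  assumes refl: "reflexive TYPE('b)" and sn: "separable_norming y l S"
    and w: "\<And>n. w n \<in> L2 M" "\<And>n. (\<integral>x. (norm (w n x))\<^sup>2 \<partial>M) \<le> B" "\<And>n. AE x in M. w n x \<in> S"
    and conv: "AE x in M. \<forall>i. convergent (\<lambda>n. l i (w n x))"
  shows "\<exists>u. u \<in> L2 M \<and> (AE x in M. u x \<in> S) \<and> (AE x in M. \<forall>i. (\<lambda>n. l i (w n x)) \<longlonglongrightarrow> l i (u x))"
proof -
  interpret separable_norming y l S by (rule sn)
  have "(\<integral>\<^sup>+x. liminf (\<lambda>k. ennreal ((norm (w k x))\<^sup>2)) \<partial>M) \<le> ennreal B"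
    using w by (intro Fatou_real) (auto simp: L2_integrable)
  then have fin: "(\<integral>\<^sup>+x. liminf (\<lambda>k. ennreal ((norm (w k x))\<^sup>2)) \<partial>M) < \<infinity>"
    by (rule le_less_trans) simp
  have [measurable]: "(\<lambda>x. ennreal ((norm (w k x))\<^sup>2)) \<in> borel_measurable M" for k
    using L2_integrable[OF w(1)] by (intro measurable_compose[OF _ measurable_ennreal]) simp
  have AE_fin: "AE x in M. liminf (\<lambda>k. ennreal ((norm (w k x))\<^sup>2)) \<noteq> \<infinity>"
    using fin by (intro nn_integral_PInf_AE) auto
  have wS: "AE x in M. \<forall>n. w n x \<in> S" using w(3) by (simp add: AE_all_countable)
  have ex: "AE x in M. \<exists>z\<in>S. \<forall>i. (\<lambda>n. l i (w n x)) \<longlonglongrightarrow> l i z"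
    using AE_fin wS conv
  proof eventually_elim
    case (elim x)
    \<comment> \<open>The subsequence depends on \<open>x\<close> and serves only to find
      \<open>z\<close>: the scalar limits exist along the full sequence, hence agree with the values
      at \<open>z\<close>.\<close>
    obtain r :: "nat \<Rightarrow> nat" and C where r: "strict_mono r" "\<And>k. (norm (w (r k) x))\<^sup>2 \<le> C"
      using frequently_bounded_if_liminf_finite[OF elim(1)] by auto
    have bdd: "norm (w (r k) x) \<le> sqrt C" for k using r(2) by (rule real_le_rsqrt)
    have "convergent (\<lambda>k. l i (w (r k) x))" for i
      using convergent_subseq_convergent[OF _ r(1)] elim(3) by (auto simp: o_def)
    then obtain z where z: "z \<in> S" "\<And>\<kappa> :: 'b \<Rightarrow>\<^sub>L real. (\<lambda>k. \<kappa> (w (r k) x)) \<longlonglongrightarrow> \<kappa> z"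
      using weak_limit_exists[OF refl, of "\<lambda>k. w (r k) x" "sqrt C"] bdd elim(2) by auto
    have "(\<lambda>n. l i (w n x)) \<longlonglongrightarrow> l i z" for i
    proof -
      obtain L where L: "(\<lambda>n. l i (w n x)) \<longlonglongrightarrow> L" using elim(3) unfolding convergent_def by blast
      then have "(\<lambda>k. l i (w (r k) x)) \<longlonglongrightarrow> L" using LIMSEQ_subseq_LIMSEQ[OF L r(1)] by (simp add: o_def)
      then have "L = l i z" using z(2)[of "l i"] by (rule LIMSEQ_unique)
      then show ?thesis using L by simp
    qed
    then show ?case using z(1) by blast
  qed
  define u where "u x = (SOME z. z \<in> S \<and> (\<forall>i. (\<lambda>n. l i (w n x)) \<longlonglongrightarrow> l i z))" for x
  have u: "AE x in M. u x \<in> S \<and> (\<forall>i. (\<lambda>n. l i (w n x)) \<longlonglongrightarrow> l i (u x))"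
    using ex unfolding u_def by eventually_elim (rule someI_ex, blast)
  then have uS: "AE x in M. u x \<in> S" and lim: "AE x in M. \<forall>i. (\<lambda>n. l i (w n x)) \<longlonglongrightarrow> l i (u x)"
    by auto
  have lu [measurable]: "(\<lambda>x. l i (u x)) \<in> borel_measurable M" for i
  proof (rule borel_measurable_AE_limit)
    show "(\<lambda>x. l i (w n x)) \<in> borel_measurable M" for n by (rule L2_blinfun(1)[OF w(1)])
    show "AE x in M. (\<lambda>n. l i (w n x)) \<longlonglongrightarrow> l i (u x)" using lim by eventually_elim blast
  qed
  \<comment> \<open>On \<open>S\<close> the norm is the supremum of the \<open>l i\<close>, so
    distances to the dense sequence \<open>y\<close> are measurable; this is what strong
    measurability of \<open>u\<close> requires.\<close>
  have dist: "(\<lambda>x. norm (u x - y j)) \<in> borel_measurable M" for j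
  proof (rule borel_measurable_AE_cong)
    have bdd: "bdd_above (range (\<lambda>i. \<bar>l i z - l i (y j)\<bar>))" for z
      using l_le_norm[of _ "z - y j"] by (intro bdd_aboveI2[where M="norm (z - y j)"]) (simp add: blinfun.diff_right)
    show "(\<lambda>x. SUP i. \<bar>l i (u x) - l i (y j)\<bar>) \<in> borel_measurable M"
    proof (rule borel_measurable_cSUP)
      show "(\<lambda>x. \<bar>l i (u x) - l i (y j)\<bar>) \<in> borel_measurable M" for i using lu[of i] by measurable
    qed (use bdd in auto)
    have "y j \<in> S" unfolding S_def by (rule subsetD[OF closure_subset rangeI])
    show "AE x in M. (SUP i. \<bar>l i (u x) - l i (y j)\<bar>) = norm (u x - y j)"
      using uS
    proof eventually_elim
      case (elim x)
      have le: "\<bar>l i (u x) - l i (y j)\<bar> \<le> norm (u x - y j)" for i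
        using l_le_norm[of i "u x - y j"] by (simp only: blinfun.diff_right)
      have "(SUP i. \<bar>l i (u x) - l i (y j)\<bar>) \<le> norm (u x - y j)"
        by (rule cSUP_least[OF UNIV_not_empty le])
      moreover have "norm (u x - y j) \<le> (SUP i. \<bar>l i (u x) - l i (y j)\<bar>)"
      proof (rule norm_le_if_functionals_le)
        show "u x - y j \<in> S" using elim \<open>y j \<in> S\<close> by (rule subspace_diff[OF subspace_S])
        show "\<bar>l i (u x - y j)\<bar> \<le> (SUP i. \<bar>l i (u x) - l i (y j)\<bar>)" for i
          unfolding blinfun.diff_right by (rule cSUP_upper[OF UNIV_I bdd])
      qed
      ultimately show ?case by (rule antisym)
    qed
  qed
  have "strongly_measurable M u"
    by (rule strongly_measurable_if_dist_measurable[where y=y]) (use uS dist in \<open>auto simp: S_def\<close>)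
  moreover have "integrable M (\<lambda>x. (norm (u x))\<^sup>2)"
  proof (rule integrableI_bounded)
    have "AE x in M. ennreal (norm ((norm (u x))\<^sup>2)) \<le> liminf (\<lambda>k. ennreal ((norm (w k x))\<^sup>2))"
      using uS lim AE_fin
    proof eventually_elim
      case (elim x)
      define L where "L = enn2real (liminf (\<lambda>k. ennreal ((norm (w k x))\<^sup>2)))"
      have L: "liminf (\<lambda>k. ennreal ((norm (w k x))\<^sup>2)) = ennreal L" "0 \<le> L"
        using elim(3) by (simp_all add: L_def top.not_eq_extremum)
      have "\<bar>l i (u x)\<bar> \<le> sqrt L" for i
      proof -
        have "(\<lambda>k. ennreal ((l i (w k x))\<^sup>2)) \<longlonglongrightarrow> ennreal ((l i (u x))\<^sup>2)"
          using elim(2) by (intro tendsto_ennrealI tendsto_power) auto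
        then have "ennreal ((l i (u x))\<^sup>2) = liminf (\<lambda>k. ennreal ((l i (w k x))\<^sup>2))"
          by (intro lim_imp_Liminf[symmetric]) simp
        also have "\<dots> \<le> liminf (\<lambda>k. ennreal ((norm (w k x))\<^sup>2))"
          using l_le_norm by (intro Liminf_mono always_eventually allI ennreal_leI) (simp add: abs_le_square_iff[symmetric])
        finally have "(l i (u x))\<^sup>2 \<le> L" using L by simp
        then have "sqrt ((l i (u x))\<^sup>2) \<le> sqrt L" by (rule real_sqrt_le_mono)
        then show ?thesis by simp
      qed
      then have "norm (u x) \<le> sqrt L" using elim(1) by (rule norm_le_if_functionals_le[rotated])
      then have "(norm (u x))\<^sup>2 \<le> L" using power_mono[of "norm (u x)" "sqrt L" 2] L(2) by simp
      then show ?case using L by simp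
    qed
    then have "(\<integral>\<^sup>+x. ennreal (norm ((norm (u x))\<^sup>2)) \<partial>M) \<le> (\<integral>\<^sup>+x. liminf (\<lambda>k. ennreal ((norm (w k x))\<^sup>2)) \<partial>M)"
      by (rule nn_integral_mono_AE)
    then show "(\<integral>\<^sup>+x. ennreal (norm ((norm (u x))\<^sup>2)) \<partial>M) < \<infinity>" using fin by (rule le_less_trans)
    show "(\<lambda>x. (norm (u x))\<^sup>2) \<in> borel_measurable M"
      using strongly_measurable_compose[OF \<open>strongly_measurable M u\<close>, of "\<lambda>z. (norm z)\<^sup>2"]
      by (auto intro!: continuous_intros)
  qed
  ultimately have "u \<in> L2 M" by (rule L2I)
  then show ?thesis using uS lim by (intro exI conjI)
qed

text \<open>On \<open>S\<close> an arbitrary functional differs from a finite combination of the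
  \<open>l i\<close> by at most \<open>d * norm y\<close>, and the bound in \<open>L\<^sup>2\<close>
  makes this error uniformly small.\<close>

lemma integral_functional_sq_tendsto_zero:
  fixes w :: "nat \<Rightarrow> 'a \<Rightarrow> 'b::real_normed_vector" and \<kappa> :: "'b \<Rightarrow>\<^sub>L real"
  assumes refl: "reflexive TYPE('b)" and sn: "separable_norming y l S"
    and w: "\<And>n. w n \<in> L2 M" "\<And>n. (\<integral>x. (norm (w n x))\<^sup>2 \<partial>M) \<le> B" "\<And>n. AE x in M. w n x \<in> S"
    and lim: "\<And>i. (\<lambda>n. \<integral>x. (l i (w n x))\<^sup>2 \<partial>M) \<longlonglongrightarrow> 0"
  shows "(\<lambda>n. \<integral>x. (blinfun_apply \<kappa> (w n x))\<^sup>2 \<partial>M) \<longlonglongrightarrow> 0"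
proof -
  interpret separable_norming y l S by (rule sn)
  have span: "(\<lambda>n. \<integral>x. (blinfun_apply s (w n x))\<^sup>2 \<partial>M) \<longlonglongrightarrow> 0" if "s \<in> span (range l)" for s
    using that
  proof (induction rule: span_induct_alt)
    case base
    then show ?case by (simp add: blinfun.zero_left)
  next
    case (step c m s)
    then obtain i where m: "m = l i" by blast
    have le: "(\<integral>x. (blinfun_apply (c *\<^sub>R m + s) (w n x))\<^sup>2 \<partial>M)
      \<le> 2 * c\<^sup>2 * (\<integral>x. (m (w n x))\<^sup>2 \<partial>M) + 2 * (\<integral>x. (s (w n x))\<^sup>2 \<partial>M)" for n
    proof -
      have "(\<integral>x. (blinfun_apply (c *\<^sub>R m + s) (w n x))\<^sup>2 \<partial>M)
        \<le> (\<integral>x. 2 * c\<^sup>2 * (m (w n x))\<^sup>2 + 2 * (s (w n x))\<^sup>2 \<partial>M)"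
      proof (rule integral_mono)
        show "(blinfun_apply (c *\<^sub>R m + s) (w n x))\<^sup>2 \<le> 2 * c\<^sup>2 * (m (w n x))\<^sup>2 + 2 * (s (w n x))\<^sup>2" for x
          using norm_add_sq[of "c * m (w n x)" "s (w n x)"]
          by (simp add: blinfun.add_left blinfun.scaleR_left power_mult_distrib)
      qed (use L2_blinfun(2)[OF w(1)] in auto)
      then show ?thesis using L2_blinfun(2)[OF w(1)] by simp
    qed
    have "(\<lambda>n. 2 * c\<^sup>2 * (\<integral>x. (m (w n x))\<^sup>2 \<partial>M) + 2 * (\<integral>x. (s (w n x))\<^sup>2 \<partial>M)) \<longlonglongrightarrow> 2 * c\<^sup>2 * 0 + 2 * 0"
      unfolding m by (intro tendsto_intros lim step)
    then have lim': "(\<lambda>n. 2 * c\<^sup>2 * (\<integral>x. (m (w n x))\<^sup>2 \<partial>M) + 2 * (\<integral>x. (s (w n x))\<^sup>2 \<partial>M)) \<longlonglongrightarrow> 0"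
      by simp
    have "\<forall>n. norm (\<integral>x. (blinfun_apply (c *\<^sub>R m + s) (w n x))\<^sup>2 \<partial>M)
        \<le> 2 * c\<^sup>2 * (\<integral>x. (m (w n x))\<^sup>2 \<partial>M) + 2 * (\<integral>x. (s (w n x))\<^sup>2 \<partial>M)"
      using le by simp
    then show ?case by (rule Lim_null_comparison[OF always_eventually lim'])
  qed
  have B: "0 \<le> B" using w(2)[of 0] by (rule order_trans[rotated]) simp
  show ?thesis
  proof (rule LIMSEQ_I)
    fix e :: real assume e: "0 < e"
    \<comment> \<open>Chosen so that the approximation error \<open>2 * d\<^sup>2 * B\<close> stays
      below \<open>e / 2\<close>; the finite combination contributes less than
      \<open>2 * (e / 4)\<close>.\<close>
    define d where "d = sqrt (e / (4 * (B + 1)))"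
    have d: "0 < d" "2 * d\<^sup>2 * B < e / 2" using e B by (auto simp: d_def field_simps)
    obtain s where s: "s \<in> span (range l)" "\<And>y. y \<in> S \<Longrightarrow> \<bar>\<kappa> y - s y\<bar> \<le> d * norm y"
      using span_functionals_dense[OF refl d(1)] by blast
    have "eventually (\<lambda>n. (\<integral>x. (s (w n x))\<^sup>2 \<partial>M) < e / 4) sequentially"
      using e by (intro order_tendstoD(2)[OF span[OF s(1)]]) auto
    then obtain N where N: "\<And>n. N \<le> n \<Longrightarrow> (\<integral>x. (s (w n x))\<^sup>2 \<partial>M) < e / 4"
      by (auto simp: eventually_sequentially)
    have "(\<integral>x. (\<kappa> (w n x))\<^sup>2 \<partial>M) < e" if "N \<le> n" for n
    proof -
      have "(\<integral>x. (\<kappa> (w n x))\<^sup>2 \<partial>M) \<le> (\<integral>x. 2 * d\<^sup>2 * (norm (w n x))\<^sup>2 + 2 * (s (w n x))\<^sup>2 \<partial>M)"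
      proof (rule integral_mono_AE)
        show "AE x in M. (\<kappa> (w n x))\<^sup>2 \<le> 2 * d\<^sup>2 * (norm (w n x))\<^sup>2 + 2 * (s (w n x))\<^sup>2"
          using w(3)[of n]
        proof eventually_elim
          case (elim x)
          have "(\<kappa> (w n x) - s (w n x))\<^sup>2 \<le> (d * norm (w n x))\<^sup>2"
            using power_mono[OF s(2)[OF elim], of 2] by simp
          then show ?case using norm_add_sq[of "\<kappa> (w n x) - s (w n x)" "s (w n x)"]
            by (simp add: power_mult_distrib)
        qed
      qed (use L2_blinfun(2)[OF w(1)] L2_integrable[OF w(1)] in auto)
      also have "\<dots> = 2 * d\<^sup>2 * (\<integral>x. (norm (w n x))\<^sup>2 \<partial>M) + 2 * (\<integral>x. (s (w n x))\<^sup>2 \<partial>M)"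
        using L2_blinfun(2)[OF w(1)] L2_integrable[OF w(1)] by simp
      also have "2 * d\<^sup>2 * (\<integral>x. (norm (w n x))\<^sup>2 \<partial>M) \<le> 2 * d\<^sup>2 * B"
        using w(2)[of n] by (intro mult_left_mono) auto
      finally show ?thesis using d(2) N[OF that] by linarith
    qed
    then show "\<exists>N. \<forall>n\<ge>N. norm ((\<integral>x. (\<kappa> (w n x))\<^sup>2 \<partial>M) - 0) < e" by auto
  qed
qed


text \<open>The values of all approximating simple functions form a countable set; a closed
  separable subspace containing them also contains their limits.\<close>

lemma L2_sequence_in_separable_subspace:
  fixes v :: "nat \<Rightarrow> 'a \<Rightarrow> 'b::real_normed_vector"
  assumes "\<And>n. strongly_measurable M (v n)"
  shows "\<exists>y l S. separable_norming y l S \<and> (\<forall>n. AE x in M. v n x \<in> S)"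
proof -
  have "\<forall>n. \<exists>s. (\<forall>i::nat. simple_function M (s i)) \<and> (AE x in M. (\<lambda>i. s i x) \<longlonglongrightarrow> v n x)"
    using assms unfolding strongly_measurable_def by simp
  from choice[OF this] obtain s
    where s: "\<And>n i. simple_function M (s n (i::nat))" "\<And>n. AE x in M. (\<lambda>i. s n i x) \<longlonglongrightarrow> v n x" by auto
  define A where "A = (\<Union>n. \<Union>i. s n i ` space M)"
  have "countable A"
    unfolding A_def by (intro countable_UN countableI_type countable_finite simple_functionD(1)[OF s(1)])
  then obtain y l S where sn: "separable_norming y l S" "A \<subseteq> S" using separable_norming_exists[of A] by auto
  have cl: "closed S" using sn(1) unfolding separable_norming_def by simp
  have "AE x in M. v n x \<in> S" for n
    using s(2)[of n] AE_space
  proof eventually_elim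
    case (elim x)
    have "\<forall>i. s n i x \<in> S" using elim(2) sn(2) by (auto simp: A_def)
    then show ?case using closed_sequentially[OF cl _ elim(1)] by simp
  qed
  then show ?thesis using sn(1) by auto
qed

lemma mid_combs_AE_mem:
  assumes S: "subspace S" and v: "\<And>n. AE x in M. v n x \<in> S" and f: "f \<in> mid_combs v n"
  shows "AE x in M. f x \<in> S"
  using f
proof induction
  case (mid f g)
  show ?case using mid.IH
    by eventually_elim (intro subspace_scale[OF S] subspace_add[OF S])
qed (rule v)

text \<open>The combinations from \<open>mid_combs_Cauchy\<close> are Cauchy for the integrated
  \<open>hform\<close>. A rapidly converging subsequence makes all \<open>l i\<close> converge
  almost everywhere, \<open>pointwise_weak_limit\<close> supplies \<open>u\<close>, and Fatou's
  lemma turns the Cauchy estimate into convergence to \<open>u\<close>, one functional at a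
  time.\<close>

lemma weak_combs_in_subspace:
  fixes v :: "nat \<Rightarrow> 'a \<Rightarrow> 'b::real_normed_vector"
  assumes refl: "reflexive TYPE('b)" and sn: "separable_norming y l S"
    and v: "\<And>n. v n \<in> L2 M" "\<And>n. (\<integral>x. (norm (v n x))\<^sup>2 \<partial>M) \<le> B" "\<And>n. AE x in M. v n x \<in> S"
  shows "\<exists>w u. (\<forall>n. w n \<in> mid_combs v n) \<and> u \<in> L2 M \<and> (AE x in M. u x \<in> S) \<and>
    (\<forall>\<kappa> :: 'b \<Rightarrow>\<^sub>L real. (\<lambda>n. \<integral>x. (\<kappa> (w n x - u x))\<^sup>2 \<partial>M) \<longlonglongrightarrow> 0)"
proof -
  interpret separable_norming y l S by (rule sn)
  define Q where "Q f = (\<integral>x. hform (f x) (f x) \<partial>M)" for f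
  define R where "R f g = Q (\<lambda>x. f x - g x)" for f g
  have mL2: "f \<in> L2 M" "(\<integral>x. (norm (f x))\<^sup>2 \<partial>M) \<le> B" if "f \<in> mid_combs v n" for f n
    using mid_combs_L2[OF v(1,2) that] by auto
  note int = hform_L2[OF sn]
  have Q_nonneg: "0 \<le> Q f" for f unfolding Q_def by (simp add: hform_nonneg)
  have Q_le: "Q f \<le> 2 * B" if "f \<in> mid_combs v 0" for f
  proof -
    have "Q f \<le> (\<integral>x. 2 * (norm (f x))\<^sup>2 \<partial>M)"
      unfolding Q_def
    proof (rule integral_mono)
      show "hform (f x) (f x) \<le> 2 * (norm (f x))\<^sup>2" for x
        using abs_hform_le[of "f x" "f x"] by (simp add: power2_eq_square)
    qed (use int mL2[OF that] in \<open>auto simp: L2_integrable\<close>)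
    then show ?thesis using mL2[OF that] by simp
  qed
  have R: "R f g = 2 * Q f + 2 * Q g - 4 * Q (\<lambda>x. (1/2) *\<^sub>R (f x + g x))"
    if "f \<in> mid_combs v 0" "g \<in> mid_combs v 0" for f g
  proof -
    have L: "f \<in> L2 M" "g \<in> L2 M" "(\<lambda>x. (1/2) *\<^sub>R (f x + g x)) \<in> L2 M"
      using mL2(1)[OF that(1)] mL2(1)[OF that(2)] by (auto intro: L2_scaleR L2_add)
    show ?thesis
      unfolding R_def Q_def hform_parallelogram[of "f _" "g _"]
      using int[OF L(1) L(1)] int[OF L(2) L(2)] int[OF L(3) L(3)] by simp
  qed
  obtain w where w: "\<And>n. w n \<in> mid_combs v n" "\<And>e. 0 < e \<Longrightarrow> \<exists>N. \<forall>m\<ge>N. \<forall>n\<ge>N. R (w m) (w n) < e"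
    using mid_combs_Cauchy[of v Q "2 * B" R, OF Q_nonneg Q_le R] by blast
  \<comment> \<open>With the rate \<open>(1/8) ^ k\<close> the increments weighted by
    \<open>4 ^ k\<close> still have integrals at most \<open>(1/2) ^ k\<close>. Almost everywhere
    \<open>hform\<close> of the increments is then of order \<open>(1/4) ^ k\<close>, and their
    image under \<open>l i\<close> of order \<open>(1/2) ^ k\<close>, which is summable.\<close>
  have "\<forall>k. \<exists>N. \<forall>m\<ge>N. \<forall>n\<ge>N. R (w m) (w n) < (1/8) ^ k" using w(2) by simp
  from choice[OF this] obtain N where N: "\<And>k m n. N k \<le> m \<Longrightarrow> N k \<le> n \<Longrightarrow> R (w m) (w n) < (1/8) ^ k"
    by blast
  \<comment> \<open>The sum makes \<open>r j\<close> at least every \<open>N k\<close> with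
    \<open>k \<le> j\<close>; the summand \<open>k\<close> keeps \<open>f k\<close> a combination of
    the tail from \<open>k\<close>.\<close>
  define r where "r k = k + (\<Sum>j\<le>k. N j)" for k
  have r_ge: "N k \<le> r j" if "k \<le> j" for k j
  proof -
    have "N k \<le> (\<Sum>j\<le>j. N j)" using that by (intro member_le_sum) auto
    then show ?thesis by (simp add: r_def)
  qed
  define f where "f k = w (r k)" for k
  have f: "f k \<in> mid_combs v k" for k
    unfolding f_def by (rule mid_combs_antimono[OF w(1)]) (simp add: r_def)
  have fL2: "f k \<in> L2 M" "(\<integral>x. (norm (f k x))\<^sup>2 \<partial>M) \<le> B" for k using mL2[OF f] by auto
  have fS: "AE x in M. f k x \<in> S" for k using mid_combs_AE_mem[OF subspace_S v(3) f] .
  have fR: "R (f m) (f n) < (1/8) ^ k" if "k \<le> m" "k \<le> n" for k m n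
    unfolding f_def using r_ge that by (intro N) auto
  have dint: "integrable M (\<lambda>x. hform (f m x - f n x) (f m x - f n x))" for m n
    using int[OF L2_diff[OF fL2(1) fL2(1)] L2_diff[OF fL2(1) fL2(1)]] .
  have "AE x in M. \<exists>C. \<forall>k. 4 ^ k * hform (f (Suc k) x - f k x) (f (Suc k) x - f k x) \<le> C"
  proof (rule AE_bounded_terms_of_summable_integrals)
    show "(\<integral>x. 4 ^ k * hform (f (Suc k) x - f k x) (f (Suc k) x - f k x) \<partial>M) \<le> (1/2) ^ k" for k
    proof -
      have "4 ^ k * R (f (Suc k)) (f k) \<le> 4 ^ k * (1/8) ^ k"
        using fR[of k "Suc k" k] by (intro mult_left_mono) auto
      then show ?thesis by (simp add: R_def Q_def flip: power_mult_distrib)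
    qed
  qed (use dint hform_nonneg in auto)
  then have conv: "AE x in M. \<forall>i. convergent (\<lambda>n. l i (f n x))"
  proof eventually_elim
    case (elim x)
    then obtain C where C: "\<And>k. 4 ^ k * hform (f (Suc k) x - f k x) (f (Suc k) x - f k x) \<le> C" by blast
    have "convergent (\<lambda>n. l i (f n x))" for i
    proof (rule convergent_if_geometric_increments)
      fix k
      have "(l i (f (Suc k) x - f k x))\<^sup>2 \<le> 2 ^ i * hform (f (Suc k) x - f k x) (f (Suc k) x - f k x)"
        by (rule functional_sq_le_hform)
      also have "\<dots> \<le> 2 ^ i * (C / 4 ^ k)" using C[of k] by (intro mult_left_mono) (simp_all add: field_simps)
      also have "\<dots> = (sqrt (2 ^ i * C) * (1/2) ^ k)\<^sup>2"
      proof -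
        have "0 \<le> C" using C[of 0] hform_nonneg[of "f (Suc 0) x - f 0 x"] by simp
        moreover have "(4::real) ^ k = (2 ^ k)\<^sup>2" by (simp add: power2_eq_square flip: power_mult_distrib)
        ultimately show ?thesis by (simp add: power_mult_distrib power_divide)
      qed
      finally have "\<bar>l i (f (Suc k) x - f k x)\<bar> \<le> \<bar>sqrt (2 ^ i * C) * (1/2) ^ k\<bar>"
        by (simp only: abs_le_square_iff)
      moreover have "0 \<le> C" using C[of 0] hform_nonneg[of "f (Suc 0) x - f 0 x"] by simp
      ultimately show "\<bar>l i (f (Suc k) x) - l i (f k x)\<bar> \<le> sqrt (2 ^ i * C) * (1/2) ^ k"
        by (simp add: blinfun.diff_right abs_mult)
    qed
    then show ?case by blast
  qed
  obtain u where u: "u \<in> L2 M" "AE x in M. u x \<in> S" "AE x in M. \<forall>i. (\<lambda>n. l i (f n x)) \<longlonglongrightarrow> l i (u x)"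
    using pointwise_weak_limit[OF refl sn fL2 fS conv] by (elim exE conjE)
  have dL2: "(\<lambda>x. f n x - u x) \<in> L2 M" for n by (rule L2_diff[OF fL2(1) u(1)])
  have dS: "AE x in M. f n x - u x \<in> S" for n
    using fS[of n] u(2) by eventually_elim (rule subspace_diff[OF subspace_S])
  have lim: "(\<lambda>n. \<integral>x. (l i (f n x - u x))\<^sup>2 \<partial>M) \<longlonglongrightarrow> 0" for i
  proof -
    have le: "(\<integral>x. (l i (f n x - u x))\<^sup>2 \<partial>M) \<le> 2 ^ i * (1/8) ^ n" for n
    proof -
      have int': "integrable M (\<lambda>x. (l i (f n x - f m x))\<^sup>2)" for m
        by (rule L2_blinfun(2)[OF L2_diff[OF fL2(1) fL2(1)]])
      have "(\<integral>x. (l i (f n x - f m x))\<^sup>2 \<partial>M) \<le> 2 ^ i * (1/8) ^ n" if "n \<le> m" for m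
      proof -
        have "(\<integral>x. (l i (f n x - f m x))\<^sup>2 \<partial>M) \<le> (\<integral>x. 2 ^ i * hform (f n x - f m x) (f n x - f m x) \<partial>M)"
          by (rule integral_mono) (use int' dint functional_sq_le_hform in auto)
        also have "\<dots> = 2 ^ i * R (f n) (f m)" by (simp add: R_def Q_def)
        also have "\<dots> \<le> 2 ^ i * (1/8) ^ n" using fR[of n n m] that by (intro mult_left_mono) auto
        finally show ?thesis .
      qed
      then have "(\<integral>\<^sup>+x. liminf (\<lambda>m. ennreal ((l i (f n x - f m x))\<^sup>2)) \<partial>M) \<le> ennreal (2 ^ i * (1/8) ^ n)"
        using int' by (intro Fatou_real) (auto simp: eventually_sequentially)
      moreover have "(\<integral>\<^sup>+x. ennreal ((l i (f n x - u x))\<^sup>2) \<partial>M) = (\<integral>\<^sup>+x. liminf (\<lambda>m. ennreal ((l i (f n x - f m x))\<^sup>2)) \<partial>M)"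
      proof (rule nn_integral_cong_AE)
        show "AE x in M. ennreal ((l i (f n x - u x))\<^sup>2) = liminf (\<lambda>m. ennreal ((l i (f n x - f m x))\<^sup>2))"
          using u(3)
        proof eventually_elim
          case (elim x)
          have "(\<lambda>m. ennreal ((l i (f n x) - l i (f m x))\<^sup>2)) \<longlonglongrightarrow> ennreal ((l i (f n x) - l i (u x))\<^sup>2)"
            using elim by (intro tendsto_ennrealI tendsto_power tendsto_diff tendsto_const) auto
          then show ?case
            unfolding blinfun.diff_right by (intro lim_imp_Liminf[symmetric]) simp
        qed
      qed
      ultimately have "ennreal (\<integral>x. (l i (f n x - u x))\<^sup>2 \<partial>M) \<le> ennreal (2 ^ i * (1/8) ^ n)"
        using L2_blinfun(2)[OF dL2] by (simp add: nn_integral_eq_integral)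
      then show ?thesis by (simp add: ennreal_le_iff)
    qed
    have "(\<lambda>n. 2 ^ i * (1/8::real) ^ n) \<longlonglongrightarrow> 2 ^ i * 0"
      by (intro tendsto_intros LIMSEQ_realpow_zero) auto
    then have lim': "(\<lambda>n. 2 ^ i * (1/8::real) ^ n) \<longlonglongrightarrow> 0" by simp
    have "\<forall>n. norm (\<integral>x. (l i (f n x - u x))\<^sup>2 \<partial>M) \<le> 2 ^ i * (1/8) ^ n" using le by simp
    then show ?thesis by (rule Lim_null_comparison[OF always_eventually lim'])
  qed
  have bound: "(\<integral>x. (norm (f n x - u x))\<^sup>2 \<partial>M) \<le> 2 * B + 2 * (\<integral>x. (norm (u x))\<^sup>2 \<partial>M)" for n
    using integral_norm_diff_sq_le[OF fL2(1)[of n] u(1)] fL2(2)[of n] by simp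
  show ?thesis
    using f u(1,2) integral_functional_sq_tendsto_zero[OF refl sn dL2 bound dS lim]
    by (intro exI[of _ f] exI[of _ u] conjI allI)
qed

lemma weak_combs:
  fixes v :: "nat \<Rightarrow> 'a \<Rightarrow> 'b::real_normed_vector"
  assumes refl: "reflexive TYPE('b)"
    and v: "\<And>n. v n \<in> L2 M" "\<And>n. (\<integral>x. (norm (v n x))\<^sup>2 \<partial>M) \<le> B"
  shows "\<exists>w u. (\<forall>n. w n \<in> mid_combs v n) \<and> u \<in> L2 M \<and>
    (\<forall>\<kappa> :: 'b \<Rightarrow>\<^sub>L real. (\<lambda>n. \<integral>x. (\<kappa> (w n x - u x))\<^sup>2 \<partial>M) \<longlonglongrightarrow> 0)"
proof -
  obtain y l S where sn: "separable_norming y l S" and S: "\<And>n. AE x in M. v n x \<in> S"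
    using L2_sequence_in_separable_subspace[of v, OF L2_strongly_measurable[OF v(1)]] by auto
  show ?thesis using weak_combs_in_subspace[where v=v, OF refl sn v S] by auto
qed

end

section \<open>Weak compactness of bounded sequences\<close>

context complete_finite_measure
begin

section \<open>Representation of a functional on a sequence of simple functions\<close>

lemma simple_function_decompose:
  fixes F :: "'c \<Rightarrow> 'a \<Rightarrow> 'b::real_vector"
  assumes p: "simple_function M p" and x: "x \<in> space M"
  shows "(\<Sum>c\<in>p ` space M. indicator (p -` {c} \<inter> space M) x *\<^sub>R F c x) = F (p x) x"
proof -
  have "(\<Sum>c\<in>p ` space M. indicator (p -` {c} \<inter> space M) x *\<^sub>R F c x)
      = (\<Sum>c\<in>p ` space M. if c = p x then F c x else 0)"
    using x by (intro sum.cong) (auto simp: indicator_def)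
  also have "\<dots> = F (p x) x" using simple_functionD(1)[OF p] x by (subst sum.delta) auto
  finally show ?thesis .
qed

lemma L2_indicator_scaleR:
  assumes "A \<in> sets M" "f \<in> L2 M"
  shows "(\<lambda>x. indicator A x *\<^sub>R f x) \<in> L2 M"
proof (rule L2_bound[OF _ L2_integrable[OF assms(2)]])
  show "strongly_measurable M (\<lambda>x. indicator A x *\<^sub>R f x)"
    using assms by (intro strongly_measurable_scaleR strongly_measurable_simple L2_strongly_measurable) auto
  show "AE x in M. (norm (indicator A x *\<^sub>R f x))\<^sup>2 \<le> (norm (f x))\<^sup>2"
    by (auto simp: indicator_def)
qed

lemma L2_functional_sum:
  assumes l: "L2_functional M l" and "finite C" and "\<And>c. c \<in> C \<Longrightarrow> f c \<in> L2 M"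
  shows "(\<lambda>x. \<Sum>c\<in>C. f c x) \<in> L2 M \<and> l (\<lambda>x. \<Sum>c\<in>C. f c x) = (\<Sum>c\<in>C. l (f c))"
  using assms(2,3)
proof (induction C)
  case empty
  then show ?case using L2_functional_scaleR[OF l L2_zero, of 0] L2_zero by simp
next
  case (insert c C)
  then have "(\<lambda>x. \<Sum>c\<in>C. f c x) \<in> L2 M" "l (\<lambda>x. \<Sum>c\<in>C. f c x) = (\<Sum>c\<in>C. l (f c))" by auto
  then show ?case
    using insert.hyps insert.prems[of c] L2_add[of "f c" "\<lambda>x. \<Sum>c\<in>C. f c x"]
      L2_functional_add[OF l, of "f c" "\<lambda>x. \<Sum>c\<in>C. f c x"] by simp
qed

lemma L2_functional_simple_expand:
  fixes \<phi> :: "'c \<Rightarrow> 'b::real_normed_vector"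
  assumes l: "L2_functional M l" and p: "simple_function M p"
  shows "l (\<lambda>x. \<phi> (p x)) = (\<Sum>c\<in>p ` space M. l (\<lambda>x. indicator (p -` {c} \<inter> space M) x *\<^sub>R \<phi> c))"
proof -
  have s: "(\<lambda>x. indicator (p -` {c} \<inter> space M) x *\<^sub>R \<phi> c) \<in> L2 M" for c
    using simple_functionD(2)[OF p, of "{c}"] by (intro L2_indicator_scaleR L2_simple) auto
  note sum = L2_functional_sum[OF l simple_functionD(1)[OF p], of "\<lambda>c x. indicator (p -` {c} \<inter> space M) x *\<^sub>R \<phi> c", OF s]
  have "l (\<lambda>x. \<phi> (p x)) = l (\<lambda>x. \<Sum>c\<in>p ` space M. indicator (p -` {c} \<inter> space M) x *\<^sub>R \<phi> c)"
  proof (rule L2_functional_AE_cong[OF l])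
    show "(\<lambda>x. \<phi> (p x)) \<in> L2 M" by (rule L2_simple[OF simple_function_compose1[OF p]])
    show "AE x in M. \<phi> (p x) = (\<Sum>c\<in>p ` space M. indicator (p -` {c} \<inter> space M) x *\<^sub>R \<phi> c)"
      using simple_function_decompose[OF p, of _ "\<lambda>c x. \<phi> c"] by (intro AE_I2) simp
  qed (use sum in simp)
  then show ?thesis using sum by simp
qed

lemma L2_real_iff:
  fixes f :: "'a \<Rightarrow> real"
  shows "f \<in> L2 M \<longleftrightarrow> f \<in> borel_measurable M \<and> integrable M (\<lambda>x. (f x)\<^sup>2)"
  by (simp add: L2_def strongly_measurable_real_iff)

lemma L2_real_integrable:
  fixes f :: "'a \<Rightarrow> real"
  assumes "f \<in> L2 M"
  shows "integrable M f" "(\<integral>x. \<bar>f x\<bar> \<partial>M) \<le> sqrt (measure M (space M)) * sqrt (\<integral>x. (f x)\<^sup>2 \<partial>M)"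
  using integral_sq_le[OF conjunct1[OF L2_real_iff[THEN iffD1, OF assms]] conjunct2[OF L2_real_iff[THEN iffD1, OF assms]]] .

lemma L2_functional_integral: "L2_functional M (\<lambda>f. \<integral>x. f x \<partial>M)"
  unfolding L2_functional_def
proof (intro conjI ballI allI exI)
  fix f g :: "'a \<Rightarrow> real" assume fg: "f \<in> L2 M" "g \<in> L2 M"
  from L2_real_integrable(1)[OF fg(1)] L2_real_integrable(1)[OF fg(2)]
  show "(\<integral>x. f x + g x \<partial>M) = (\<integral>x. f x \<partial>M) + (\<integral>x. g x \<partial>M)" by simp
next
  fix c :: real and f :: "'a \<Rightarrow> real" assume "f \<in> L2 M"
  show "(\<integral>x. c *\<^sub>R f x \<partial>M) = c * (\<integral>x. f x \<partial>M)" by simp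
next
  fix f :: "'a \<Rightarrow> real" assume "f \<in> L2 M"
  then have "(\<integral>x. \<bar>f x\<bar> \<partial>M) \<le> sqrt (measure M (space M)) * sqrt (\<integral>x. (f x)\<^sup>2 \<partial>M)"
    by (rule L2_real_integrable(2))
  from order_trans[OF integral_abs_bound this]
  show "\<bar>\<integral>x. f x \<partial>M\<bar> \<le> sqrt (measure M (space M)) * L2_norm M f"
    by (simp add: L2_norm_def)
qed

lemma integral_simple_expand:
  fixes \<psi> :: "'c \<Rightarrow> real"
  assumes p: "simple_function M p"
  shows "(\<integral>x. \<psi> (p x) \<partial>M) = (\<Sum>c\<in>p ` space M. measure M (p -` {c} \<inter> space M) * \<psi> c)"
  using L2_functional_simple_expand[OF L2_functional_integral p, of \<psi>] by simp

text \<open>A vector nearly attaining the norm, scaled to length at most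
  \<open>norm \<Lambda>\<close>. It replaces the duality map when a functional is tested against its
  own representative.\<close>

lemma blinfun_nearly_norming:
  fixes \<Lambda> :: "'b::real_normed_vector \<Rightarrow>\<^sub>L real"
  shows "\<exists>b. norm b \<le> norm \<Lambda> \<and> (norm \<Lambda>)\<^sup>2 / 2 \<le> \<Lambda> b"
proof -
  have "\<exists>b. norm b \<le> 1 \<and> norm \<Lambda> / 2 \<le> \<Lambda> b"
  proof (rule ccontr)
    assume "\<not> ?thesis"
    then have lt: "\<Lambda> b < norm \<Lambda> / 2" if "norm b \<le> 1" for b using that by force
    have pos: "0 < norm \<Lambda>" using lt[of 0] by (simp add: blinfun.zero_right)
    have le: "\<Lambda> b \<le> norm \<Lambda> / 2 * norm b" for b
    proof (cases "b = 0")
      case False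
      then have "\<Lambda> ((1 / norm b) *\<^sub>R b) < norm \<Lambda> / 2" by (intro lt) simp
      then show ?thesis using False by (simp add: blinfun.scaleR_right field_simps)
    qed (simp add: blinfun.zero_right)
    have "norm \<Lambda> \<le> norm \<Lambda> / 2"
    proof (rule norm_blinfun_bound)
      fix b show "norm (\<Lambda> b) \<le> norm \<Lambda> / 2 * norm b"
        using le[of b] le[of "-b"] by (simp add: blinfun.minus_right abs_le_iff)
    qed simp
    then show False using pos by simp
  qed
  then obtain b where "norm b \<le> 1" "norm \<Lambda> / 2 \<le> \<Lambda> b" by blast
  then have "norm (norm \<Lambda> *\<^sub>R b) \<le> norm \<Lambda>" "norm \<Lambda> * (norm \<Lambda> / 2) \<le> \<Lambda> (norm \<Lambda> *\<^sub>R b)"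
    by (simp_all add: mult_left_le blinfun.scaleR_right mult_left_mono del: times_divide_eq_right)
  then show ?thesis by (intro exI[of _ "norm \<Lambda> *\<^sub>R b"]) (simp add: power2_eq_square)
qed

text \<open>On functions of \<open>p\<close> the representative is the mean of \<open>l\<close> over
  each level set. Testing with nearly norming vectors \<open>y c\<close> gives
  \<open>s / 2 \<le> B * sqrt s\<close> for its squared norm \<open>s\<close>, hence a bound
  independent of how fine \<open>p\<close> is.\<close>

lemma L2_functional_representation_on_simple:
  fixes l :: "('a \<Rightarrow> 'b::real_normed_vector) \<Rightarrow> real" and p :: "'a \<Rightarrow> 'c"
  assumes l: "L2_functional M l" and B: "0 < B" "\<And>f. f \<in> L2 M \<Longrightarrow> \<bar>l f\<bar> \<le> B * L2_norm M f"
    and p: "simple_function M p"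
  shows "\<exists>g :: 'a \<Rightarrow> 'b \<Rightarrow>\<^sub>L real. simple_function M g \<and> (\<integral>x. (norm (g x))\<^sup>2 \<partial>M) \<le> 4 * B\<^sup>2 \<and>
    (\<forall>\<phi>. l (\<lambda>x. \<phi> (p x)) = (\<integral>x. blinfun_apply (g x) (\<phi> (p x)) \<partial>M))"
proof -
  define A where "A c = p -` {c} \<inter> space M" for c
  have A: "A c \<in> sets M" for c unfolding A_def using simple_functionD(2)[OF p] .
  have ind: "(\<lambda>x. indicator (A c) x *\<^sub>R b) \<in> L2 M" for c and b :: 'b
    using A by (intro L2_indicator_scaleR L2_simple) auto
  have norm_ind: "L2_norm M (\<lambda>x. indicator (A c) x *\<^sub>R b) = sqrt (measure M (A c)) * norm b" for c and b :: 'b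
  proof -
    have "(\<integral>x. (norm (indicator (A c) x *\<^sub>R b))\<^sup>2 \<partial>M) = (\<integral>x. indicator (A c) x * (norm b)\<^sup>2 \<partial>M)"
      by (intro Bochner_Integration.integral_cong) (auto simp: indicator_def)
    also have "\<dots> = measure M (A c) * (norm b)\<^sup>2"
      using A sets.sets_into_space[OF A] by (simp add: Int_absorb2)
    finally show ?thesis by (simp add: L2_norm_def real_sqrt_mult)
  qed
  define m where "m c = Blinfun (\<lambda>b. l (\<lambda>x. indicator (A c) x *\<^sub>R b))" for c
  have m: "m c b = l (\<lambda>x. indicator (A c) x *\<^sub>R b)" for c b
  proof -
    have "bounded_linear (\<lambda>b. l (\<lambda>x. indicator (A c) x *\<^sub>R b))"
    proof (rule bounded_linear_intro[where K="B * sqrt (measure M (A c))"])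
      fix b b' :: 'b and t :: real
      show "l (\<lambda>x. indicator (A c) x *\<^sub>R (b + b')) = l (\<lambda>x. indicator (A c) x *\<^sub>R b) + l (\<lambda>x. indicator (A c) x *\<^sub>R b')"
        using L2_functional_add[OF l ind ind] by (simp add: scaleR_add_right)
      show "l (\<lambda>x. indicator (A c) x *\<^sub>R t *\<^sub>R b) = t *\<^sub>R l (\<lambda>x. indicator (A c) x *\<^sub>R b)"
        using L2_functional_scaleR[OF l ind, of t c b] by (simp add: mult.commute)
      show "norm (l (\<lambda>x. indicator (A c) x *\<^sub>R b)) \<le> norm b * (B * sqrt (measure M (A c)))"
        using B(2)[OF ind, of c b] by (simp add: norm_ind mult_ac)
    qed
    then show ?thesis unfolding m_def by (simp add: bounded_linear_Blinfun_apply)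
  qed
  \<comment> \<open>On a null level set division by zero gives \<open>\<Lambda> c = 0\<close>, in
    agreement with \<open>l\<close> vanishing on functions supported there.\<close>
  define \<Lambda> where "\<Lambda> c = (1 / measure M (A c)) *\<^sub>R m c" for c
  have mult: "measure M (A c) * \<Lambda> c b = l (\<lambda>x. indicator (A c) x *\<^sub>R b)" for c b
  proof (cases "measure M (A c) = 0")
    case True
    then show ?thesis using B(2)[OF ind, of c b] by (simp add: norm_ind)
  next
    case False
    then show ?thesis by (simp add: \<Lambda>_def m blinfun.scaleR_left)
  qed
  define g where "g x = \<Lambda> (p x)" for x
  have g: "simple_function M g" unfolding g_def by (rule simple_function_compose1[OF p])
  have rep: "l (\<lambda>x. \<phi> (p x)) = (\<integral>x. g x (\<phi> (p x)) \<partial>M)" for \<phi>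
    using L2_functional_simple_expand[OF l p, of \<phi>] integral_simple_expand[OF p, of "\<lambda>c. \<Lambda> c (\<phi> c)"]
    by (simp add: g_def mult flip: A_def)
  have "\<forall>c. \<exists>b. norm b \<le> norm (\<Lambda> c) \<and> (norm (\<Lambda> c))\<^sup>2 / 2 \<le> \<Lambda> c b"
    using blinfun_nearly_norming by blast
  from choice[OF this] obtain y where y: "\<And>c. norm (y c) \<le> norm (\<Lambda> c)" "\<And>c. (norm (\<Lambda> c))\<^sup>2 / 2 \<le> \<Lambda> c (y c)"
    by auto
  define s where "s = (\<integral>x. (norm (g x))\<^sup>2 \<partial>M)"
  have s0: "0 \<le> s" by (simp add: s_def)
  have "s / 2 = (\<integral>x. (norm (\<Lambda> (p x)))\<^sup>2 / 2 \<partial>M)" by (simp add: s_def g_def)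
  also have "\<dots> \<le> (\<integral>x. g x (y (p x)) \<partial>M)"
    unfolding g_def integral_simple_expand[OF p, of "\<lambda>c. (norm (\<Lambda> c))\<^sup>2 / 2"]
      integral_simple_expand[OF p, of "\<lambda>c. \<Lambda> c (y c)"]
    by (intro sum_mono mult_left_mono y) simp
  also have "\<dots> = l (\<lambda>x. y (p x))" by (rule rep[symmetric])
  also have "\<dots> \<le> B * L2_norm M (\<lambda>x. y (p x))"
    using B(2)[OF L2_simple[OF simple_function_compose1[OF p, of y]]] by simp
  also have "L2_norm M (\<lambda>x. y (p x)) \<le> sqrt s"
    unfolding L2_norm_def s_def g_def
    unfolding integral_simple_expand[OF p, of "\<lambda>c. (norm (y c))\<^sup>2"]
      integral_simple_expand[OF p, of "\<lambda>c. (norm (\<Lambda> c))\<^sup>2"]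
    by (intro real_sqrt_le_mono sum_mono mult_left_mono power_mono y) auto
  finally have "s / 2 \<le> B * sqrt s" using B(1) by (simp add: mult_left_mono)
  then have ss: "sqrt s * sqrt s \<le> 2 * B * sqrt s" using s0 by simp
  have "sqrt s \<le> 2 * B"
  proof (cases "s = 0")
    case False
    then have "0 < sqrt s" using s0 by simp
    with ss show ?thesis by (rule mult_right_le_imp_le)
  qed (use B in simp)
  then have "s \<le> (2 * B)\<^sup>2" by (rule sqrt_le_D)
  then show ?thesis using g rep by (auto simp: s_def power_mult_distrib)
qed

lemma pairing_L2:
  fixes f :: "'a \<Rightarrow> 'b::real_normed_vector \<Rightarrow>\<^sub>L real" and u :: "'a \<Rightarrow> 'b"
  assumes f: "f \<in> L2 M" and u: "u \<in> L2 M"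
  shows "integrable M (\<lambda>x. f x (u x))"
    "\<bar>\<integral>x. f x (u x) \<partial>M\<bar> \<le> sqrt (\<integral>x. (norm (f x))\<^sup>2 \<partial>M) * sqrt (\<integral>x. (norm (u x))\<^sup>2 \<partial>M)"
proof -
  have nf: "(\<lambda>x. norm (f x)) \<in> borel_measurable M" and nu: "(\<lambda>x. norm (u x)) \<in> borel_measurable M"
    using strongly_measurable_compose[OF L2_strongly_measurable[OF f], of norm]
      strongly_measurable_compose[OF L2_strongly_measurable[OF u], of norm]
    by (simp_all add: continuous_on_norm_id)
  note cs = integrable_mult_L2[OF nf nu L2_integrable[OF f] L2_integrable[OF u]]
  have "continuous_on UNIV (\<lambda>q :: ('b \<Rightarrow>\<^sub>L real) \<times> 'b. blinfun_apply (fst q) (snd q))"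
    by (intro continuous_intros)
  then have meas: "(\<lambda>x. f x (u x)) \<in> borel_measurable M"
    using strongly_measurable_compose2[OF L2_strongly_measurable[OF f] L2_strongly_measurable[OF u], of "\<lambda>q. blinfun_apply (fst q) (snd q)"]
    by (simp add: strongly_measurable_real_iff)
  have le: "\<bar>f x (u x)\<bar> \<le> norm (f x) * norm (u x)" for x
    using norm_blinfun[of "f x" "u x"] by simp
  show int: "integrable M (\<lambda>x. f x (u x))"
    by (rule Bochner_Integration.integrable_bound[OF cs(1) meas]) (simp add: le)
  have "\<bar>\<integral>x. f x (u x) \<partial>M\<bar> \<le> (\<integral>x. \<bar>f x (u x)\<bar> \<partial>M)" by (rule integral_abs_bound)
  also have "\<dots> \<le> (\<integral>x. norm (f x) * norm (u x) \<partial>M)"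
    using int cs(1) le by (intro integral_mono) auto
  also have "\<dots> \<le> sqrt (\<integral>x. (norm (f x))\<^sup>2 \<partial>M) * sqrt (\<integral>x. (norm (u x))\<^sup>2 \<partial>M)"
    using cs(2) by linarith
  finally show "\<bar>\<integral>x. f x (u x) \<partial>M\<bar> \<le> sqrt (\<integral>x. (norm (f x))\<^sup>2 \<partial>M) * sqrt (\<integral>x. (norm (u x))\<^sup>2 \<partial>M)" .
qed

text \<open>Convergence is known only for each fixed \<open>c\<close>. Along a simple function
  finitely many \<open>c\<close> occur, and the integral splits over the level sets.\<close>

lemma integral_along_simple_tendsto_zero:
  fixes F :: "nat \<Rightarrow> 'c \<Rightarrow> 'a \<Rightarrow> real"
  assumes p: "simple_function M p" and F: "\<And>n c. F n c \<in> L2 M"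
    and lim: "\<And>c. (\<lambda>n. \<integral>x. (F n c x)\<^sup>2 \<partial>M) \<longlonglongrightarrow> 0"
  shows "(\<lambda>n. \<integral>x. F n (p x) x \<partial>M) \<longlonglongrightarrow> 0"
proof -
  let ?A = "\<lambda>c. p -` {c} \<inter> space M"
  have A: "?A c \<in> sets M" for c using simple_functionD(2)[OF p] .
  have G: "(\<lambda>x. indicator (?A c) x *\<^sub>R F n c x) \<in> L2 M" for n c
    by (rule L2_indicator_scaleR[OF A F])
  have Gint: "integrable M (\<lambda>x. indicator (?A c) x *\<^sub>R F n c x)" for n c
    by (rule L2_real_integrable(1)[OF G])
  have eq: "(\<integral>x. F n (p x) x \<partial>M) = (\<Sum>c\<in>p ` space M. \<integral>x. indicator (?A c) x *\<^sub>R F n c x \<partial>M)" for n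
  proof -
    have "(\<integral>x. F n (p x) x \<partial>M) = (\<integral>x. (\<Sum>c\<in>p ` space M. indicator (?A c) x *\<^sub>R F n c x) \<partial>M)"
      by (intro Bochner_Integration.integral_cong refl simple_function_decompose[OF p, symmetric])
    also have "\<dots> = (\<Sum>c\<in>p ` space M. \<integral>x. indicator (?A c) x *\<^sub>R F n c x \<partial>M)"
      by (rule Bochner_Integration.integral_sum) (rule Gint)
    finally show ?thesis .
  qed
  have "(\<lambda>n. \<integral>x. indicator (?A c) x *\<^sub>R F n c x \<partial>M) \<longlonglongrightarrow> 0" for c
  proof (rule L2_functional_tendsto_zero[OF L2_functional_integral G])
    have le: "(\<integral>x. (norm (indicator (?A c) x *\<^sub>R F n c x))\<^sup>2 \<partial>M) \<le> (\<integral>x. (F n c x)\<^sup>2 \<partial>M)" for n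
      by (rule integral_mono[OF L2_integrable[OF G]])
        (use F[of n c] in \<open>auto simp: L2_real_iff indicator_def\<close>)
    then have "\<forall>n. norm (\<integral>x. (norm (indicator (?A c) x *\<^sub>R F n c x))\<^sup>2 \<partial>M) \<le> (\<integral>x. (F n c x)\<^sup>2 \<partial>M)"
      by simp
    then show "(\<lambda>n. \<integral>x. (norm (indicator (?A c) x *\<^sub>R F n c x))\<^sup>2 \<partial>M) \<longlonglongrightarrow> 0"
      by (rule Lim_null_comparison[OF always_eventually lim])
  qed
  then have "(\<lambda>n. \<Sum>c\<in>p ` space M. \<integral>x. indicator (?A c) x *\<^sub>R F n c x \<partial>M) \<longlonglongrightarrow> (\<Sum>c\<in>p ` space M. 0)"
    by (rule tendsto_sum)
  then show ?thesis unfolding eq by simp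
qed


text \<open>Collects the first \<open>k\<close> functions in one simple function with lists as
  values, so that a representative adapted to it serves all of them at once.\<close>

lemma simple_function_initial_segment:
  assumes "\<And>n. simple_function M (u n)"
  shows "simple_function M (\<lambda>x. map (\<lambda>n. u n x) [0..<k])"
proof (induction k)
  case (Suc k)
  have "simple_function M (\<lambda>x. (\<lambda>q. fst q @ [snd q]) (map (\<lambda>n. u n x) [0..<k], u k x))"
    by (rule simple_function_compose1[OF simple_function_Pair[OF Suc assms]])
  then show ?case by simp
qed simp

text \<open>For simple \<open>u n\<close> the functional is represented on the span of \<open>u 0, \<dots>, u k\<close> by a simple
  function with values in the dual. As the dual is reflexive, midpoint combinations of these
  representatives converge, and the limit represents the functional on all \<open>u n\<close>.\<close>

lemma L2_functional_represented_on_sequence: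
  fixes u :: "nat \<Rightarrow> 'a \<Rightarrow> 'b::real_normed_vector"
  assumes refl: "reflexive TYPE('b)" and l: "L2_functional M l" and u: "\<And>n. simple_function M (u n)"
  shows "\<exists>h :: 'a \<Rightarrow> 'b \<Rightarrow>\<^sub>L real. h \<in> L2 M \<and> (\<forall>n. l (u n) = (\<integral>x. blinfun_apply (h x) (u n x) \<partial>M))"
proof -
  obtain B where B: "0 < B" "\<And>f. f \<in> L2 M \<Longrightarrow> \<bar>l f\<bar> \<le> B * L2_norm M f"
    using L2_functional_bound[OF l] by blast
  have "\<forall>k. \<exists>g :: 'a \<Rightarrow> 'b \<Rightarrow>\<^sub>L real. simple_function M g \<and> (\<integral>x. (norm (g x))\<^sup>2 \<partial>M) \<le> 4 * B\<^sup>2 \<and>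
    (\<forall>n\<le>k. l (u n) = (\<integral>x. blinfun_apply (g x) (u n x) \<partial>M))"
  proof
    fix k
    have ex: "\<exists>g :: 'a \<Rightarrow> 'b \<Rightarrow>\<^sub>L real. simple_function M g \<and> (\<integral>x. (norm (g x))\<^sup>2 \<partial>M) \<le> 4 * B\<^sup>2 \<and>
      (\<forall>\<phi>. l (\<lambda>x. \<phi> (map (\<lambda>n. u n x) [0..<Suc k])) = (\<integral>x. blinfun_apply (g x) (\<phi> (map (\<lambda>n. u n x) [0..<Suc k])) \<partial>M))"
      by (rule L2_functional_representation_on_simple[OF l B(1) _ simple_function_initial_segment[where u=u and k="Suc k", OF u]])
        (rule B(2))
    obtain g :: "'a \<Rightarrow> 'b \<Rightarrow>\<^sub>L real" where g: "simple_function M g" "(\<integral>x. (norm (g x))\<^sup>2 \<partial>M) \<le> 4 * B\<^sup>2"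
      and rep: "\<forall>\<phi>. l (\<lambda>x. \<phi> (map (\<lambda>n. u n x) [0..<Suc k])) = (\<integral>x. blinfun_apply (g x) (\<phi> (map (\<lambda>n. u n x) [0..<Suc k])) \<partial>M)"
      using ex by (elim exE conjE)
    have "l (u n) = (\<integral>x. blinfun_apply (g x) (u n x) \<partial>M)" if "n \<le> k" for n
      using rep[THEN spec, of "\<lambda>xs. xs ! n"] that by (simp del: upt_Suc add: less_Suc_eq_le)
    then show "\<exists>g :: 'a \<Rightarrow> 'b \<Rightarrow>\<^sub>L real. simple_function M g \<and> (\<integral>x. (norm (g x))\<^sup>2 \<partial>M) \<le> 4 * B\<^sup>2 \<and>
      (\<forall>n\<le>k. l (u n) = (\<integral>x. blinfun_apply (g x) (u n x) \<partial>M))"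
      using g by (intro exI[of _ g]) simp
  qed
  from choice[OF this] obtain g :: "nat \<Rightarrow> 'a \<Rightarrow> 'b \<Rightarrow>\<^sub>L real"
    where g: "\<And>k. simple_function M (g k)" "\<And>k. (\<integral>x. (norm (g k x))\<^sup>2 \<partial>M) \<le> 4 * B\<^sup>2"
      and rep: "\<And>n k. n \<le> k \<Longrightarrow> l (u n) = (\<integral>x. blinfun_apply (g k x) (u n x) \<partial>M)"
    by auto
  have uL2: "u n \<in> L2 M" for n by (rule L2_simple[OF u])
  have gL2: "g k \<in> L2 M" for k by (rule L2_simple[OF g(1)])
  obtain w h where w: "\<And>k. w k \<in> mid_combs g k" and h: "h \<in> L2 M"
    and lim: "\<And>\<kappa> :: ('b \<Rightarrow>\<^sub>L real) \<Rightarrow>\<^sub>L real. (\<lambda>k. \<integral>x. (\<kappa> (w k x - h x))\<^sup>2 \<partial>M) \<longlonglongrightarrow> 0"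
    using weak_combs[where v=g, OF reflexive_dual[OF refl] gL2 g(2)] by auto
  \<comment> \<open>The identity is affine in the representative and survives midpoints, so
    combinations of the tail from \<open>k\<close> represent \<open>l\<close> on every
    \<open>u n\<close> with \<open>n \<le> k\<close>.\<close>
  have rep_comb: "f \<in> L2 M \<and> (\<integral>x. blinfun_apply (f x) (u n x) \<partial>M) = l (u n)" if "f \<in> mid_combs g k" "n \<le> k" for f n k
    using that(1)
  proof induction
    case (base j)
    then show ?case using rep[of n j] that(2) gL2 by simp
  next
    case (mid f f')
    then have L: "f \<in> L2 M" "f' \<in> L2 M" by auto
    have "(\<integral>x. blinfun_apply ((1/2) *\<^sub>R (f x + f' x)) (u n x) \<partial>M)
        = (\<integral>x. (1/2) * (blinfun_apply (f x) (u n x) + blinfun_apply (f' x) (u n x)) \<partial>M)"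
      by (simp add: blinfun.scaleR_left blinfun.add_left)
    also have "\<dots> = (1/2) * (l (u n) + l (u n))"
      using mid pairing_L2(1)[OF L(1) uL2[of n]] pairing_L2(1)[OF L(2) uL2[of n]] by simp
    finally show ?case using L2_scaleR[OF L2_add[OF L]] by simp
  qed
  have wL2: "w k \<in> L2 M" for k using rep_comb[OF w, of 0] by simp
  have "l (u n) = (\<integral>x. blinfun_apply (h x) (u n x) \<partial>M)" for n
  proof -
    \<comment> \<open>Evaluation at a fixed vector is a functional on the dual, so
      \<open>w k - h\<close> tends to zero at each of the finitely many values of
      \<open>u n\<close>.\<close>
    have "(\<lambda>k. \<integral>x. blinfun_apply (w k x - h x) (u n x) \<partial>M) \<longlonglongrightarrow> 0"
    proof (rule integral_along_simple_tendsto_zero[OF u, of "\<lambda>k c x. blinfun_apply (w k x - h x) c"])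
      fix c :: 'b
      have bl: "bounded_linear (\<lambda>m :: 'b \<Rightarrow>\<^sub>L real. blinfun_apply m c)"
        by (rule blinfun.bounded_linear_left)
      have ev: "blinfun_apply (Blinfun (\<lambda>m :: 'b \<Rightarrow>\<^sub>L real. blinfun_apply m c)) m = blinfun_apply m c" for m
        by (simp add: bounded_linear_Blinfun_apply[OF bl])
      show "(\<lambda>x. blinfun_apply (w k x - h x) c) \<in> L2 M" for k
        using L2_blinfun[OF L2_diff[OF wL2 h], of "Blinfun (\<lambda>m. blinfun_apply m c)" k]
        unfolding ev L2_real_iff by simp
      show "(\<lambda>k. \<integral>x. (blinfun_apply (w k x - h x) c)\<^sup>2 \<partial>M) \<longlonglongrightarrow> 0"
        using lim[of "Blinfun (\<lambda>m. blinfun_apply m c)"] unfolding ev .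
    qed
    moreover have "(\<integral>x. blinfun_apply (w k x - h x) (u n x) \<partial>M) = l (u n) - (\<integral>x. blinfun_apply (h x) (u n x) \<partial>M)"
      if "n \<le> k" for k
      using rep_comb[OF w that] pairing_L2(1)[OF wL2[of k] uL2[of n]] pairing_L2(1)[OF h uL2[of n]]
      by (simp add: blinfun.diff_left)
    then have "eventually (\<lambda>k. (\<integral>x. blinfun_apply (w k x - h x) (u n x) \<partial>M) = l (u n) - (\<integral>x. blinfun_apply (h x) (u n x) \<partial>M)) sequentially"
      unfolding eventually_sequentially by blast
    ultimately have "(\<lambda>k. l (u n) - (\<integral>x. blinfun_apply (h x) (u n x) \<partial>M)) \<longlonglongrightarrow> 0"
      by (rule Lim_transform_eventually)
    then show ?thesis by (simp add: LIMSEQ_const_iff)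
  qed
  then show ?thesis using h by blast
qed

text \<open>Replacing \<open>u n\<close> by simple functions \<open>s n\<close> with vanishing error
  allows one function \<open>h\<close> to represent \<open>l\<close> on the whole sequence.
  Replacing \<open>h\<close> by a simple \<open>k\<close> then costs a uniformly small error, and
  \<open>k\<close> tests the sequence with finitely many functionals only.\<close>

lemma L2_functional_tendsto_zero_if_scalarly_null:
  fixes u :: "nat \<Rightarrow> 'a \<Rightarrow> 'b::real_normed_vector"
  assumes refl: "reflexive TYPE('b)" and l: "L2_functional M l"
    and u: "\<And>n. u n \<in> L2 M" "\<And>n. (\<integral>x. (norm (u n x))\<^sup>2 \<partial>M) \<le> C"
    and lim: "\<And>\<kappa> :: 'b \<Rightarrow>\<^sub>L real. (\<lambda>n. \<integral>x. (\<kappa> (u n x))\<^sup>2 \<partial>M) \<longlonglongrightarrow> 0"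
  shows "(\<lambda>n. l (u n)) \<longlonglongrightarrow> 0"
proof -
  have "\<forall>n. \<exists>s. simple_function M s \<and> (\<integral>x. (norm (u n x - s x))\<^sup>2 \<partial>M) < 1 / Suc n"
    by (intro allI L2_simple_dense[OF u(1)]) simp
  from choice[OF this] obtain s where s: "\<And>n. simple_function M (s n)"
    and us: "\<And>n. (\<integral>x. (norm (u n x - s n x))\<^sup>2 \<partial>M) < 1 / Suc n" by auto
  have sL2: "s n \<in> L2 M" for n by (rule L2_simple[OF s])
  have dL2: "(\<lambda>x. u n x - s n x) \<in> L2 M" for n by (rule L2_diff[OF u(1) sL2])
  have dlim: "(\<lambda>n. \<integral>x. (norm (u n x - s n x))\<^sup>2 \<partial>M) \<longlonglongrightarrow> 0"
  proof -
    have "\<forall>n. norm (\<integral>x. (norm (u n x - s n x))\<^sup>2 \<partial>M) \<le> inverse (real (Suc n))"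
      using us by (auto simp: inverse_eq_divide intro: less_imp_le)
    then show ?thesis by (rule Lim_null_comparison[OF always_eventually LIMSEQ_inverse_real_of_nat])
  qed
  obtain h :: "'a \<Rightarrow> 'b \<Rightarrow>\<^sub>L real" where h: "h \<in> L2 M"
    and rep: "\<And>n. l (s n) = (\<integral>x. blinfun_apply (h x) (s n x) \<partial>M)"
    using L2_functional_represented_on_sequence[where u=s, OF refl l s] by blast
  define C' where "C' = 2 * C + 2"
  have sC: "(\<integral>x. (norm (s n x))\<^sup>2 \<partial>M) \<le> C'" for n
  proof -
    have "(\<integral>x. (norm (u n x - (u n x - s n x)))\<^sup>2 \<partial>M) \<le> 2 * (\<integral>x. (norm (u n x))\<^sup>2 \<partial>M) + 2 * (\<integral>x. (norm (u n x - s n x))\<^sup>2 \<partial>M)"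
      by (rule integral_norm_diff_sq_le[OF u(1) dL2])
    moreover have "(\<integral>x. (norm (u n x - s n x))\<^sup>2 \<partial>M) < 1" using us[of n] by (rule less_le_trans) simp
    ultimately show ?thesis using u(2)[of n] unfolding C'_def by simp
  qed
  have C': "0 \<le> C'" using sC[of 0] by (rule order_trans[rotated]) simp
  have slim: "(\<lambda>n. \<integral>x. (\<kappa> (s n x))\<^sup>2 \<partial>M) \<longlonglongrightarrow> 0" for \<kappa> :: "'b \<Rightarrow>\<^sub>L real"
  proof -
    have le: "(\<integral>x. (\<kappa> (s n x))\<^sup>2 \<partial>M) \<le> 2 * (\<integral>x. (\<kappa> (u n x))\<^sup>2 \<partial>M) + 2 * (norm \<kappa>)\<^sup>2 * (\<integral>x. (norm (u n x - s n x))\<^sup>2 \<partial>M)" for n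
    proof -
      have "(\<integral>x. (\<kappa> (s n x))\<^sup>2 \<partial>M) \<le> (\<integral>x. 2 * (\<kappa> (u n x))\<^sup>2 + 2 * (norm \<kappa>)\<^sup>2 * (norm (u n x - s n x))\<^sup>2 \<partial>M)"
      proof (rule integral_mono[OF L2_blinfun(2)[OF sL2]])
        fix x
        have "(\<kappa> (s n x - u n x))\<^sup>2 \<le> (norm \<kappa> * norm (s n x - u n x))\<^sup>2"
          using power_mono[OF norm_blinfun[of \<kappa> "s n x - u n x"], of 2] by simp
        then show "(\<kappa> (s n x))\<^sup>2 \<le> 2 * (\<kappa> (u n x))\<^sup>2 + 2 * (norm \<kappa>)\<^sup>2 * (norm (u n x - s n x))\<^sup>2"
          using norm_add_sq[of "\<kappa> (u n x)" "\<kappa> (s n x - u n x)"]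
          by (simp add: blinfun.diff_right power_mult_distrib norm_minus_commute)
      qed (use L2_blinfun(2)[OF u(1)] L2_integrable[OF dL2] in simp)
      then show ?thesis using L2_blinfun(2)[OF u(1)] L2_integrable[OF dL2] by simp
    qed
    have "(\<lambda>n. 2 * (\<integral>x. (\<kappa> (u n x))\<^sup>2 \<partial>M) + 2 * (norm \<kappa>)\<^sup>2 * (\<integral>x. (norm (u n x - s n x))\<^sup>2 \<partial>M)) \<longlonglongrightarrow> 2 * 0 + 2 * (norm \<kappa>)\<^sup>2 * 0"
      by (intro tendsto_intros lim dlim)
    then have lim': "(\<lambda>n. 2 * (\<integral>x. (\<kappa> (u n x))\<^sup>2 \<partial>M) + 2 * (norm \<kappa>)\<^sup>2 * (\<integral>x. (norm (u n x - s n x))\<^sup>2 \<partial>M)) \<longlonglongrightarrow> 0"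
      by simp
    have "\<forall>n. norm (\<integral>x. (\<kappa> (s n x))\<^sup>2 \<partial>M) \<le> 2 * (\<integral>x. (\<kappa> (u n x))\<^sup>2 \<partial>M) + 2 * (norm \<kappa>)\<^sup>2 * (\<integral>x. (norm (u n x - s n x))\<^sup>2 \<partial>M)"
      using le by simp
    then show ?thesis by (rule Lim_null_comparison[OF always_eventually lim'])
  qed
  have "(\<lambda>n. l (s n)) \<longlonglongrightarrow> 0"
  proof (rule LIMSEQ_I)
    fix e :: real assume e: "0 < e"
    \<comment> \<open>\<open>z\<close> exceeds \<open>sqrt C'\<close>, so the error
      \<open>sqrt d * sqrt C' = t * sqrt C'\<close> is strictly below \<open>t * z = e / 2\<close>,
      also for \<open>C' = 0\<close>.\<close>
    define z where "z = sqrt C' + 1"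
    define t where "t = e / (2 * z)"
    define d where "d = t\<^sup>2"
    have sC': "0 \<le> sqrt C'" using C' by simp
    have z: "0 < z" using sC' unfolding z_def by linarith
    have t: "0 < t" unfolding t_def using e z by simp
    have d: "0 < d" unfolding d_def using t by (rule zero_less_power)
    have sd: "sqrt d = t" unfolding d_def using t by simp
    have "t * sqrt C' < t * z" using t by (simp add: z_def)
    also have "t * z = e / 2" using z by (simp add: t_def)
    finally have dC: "sqrt d * sqrt C' < e / 2" unfolding sd .
    obtain k where k: "simple_function M k" "(\<integral>x. (norm (h x - k x))\<^sup>2 \<partial>M) < d"
      using L2_simple_dense[OF h d] by (elim exE conjE)
    have kL2: "k \<in> L2 M" by (rule L2_simple[OF k(1)])
    have "(\<lambda>n. \<integral>x. blinfun_apply (k x) (s n x) \<partial>M) \<longlonglongrightarrow> 0"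
    proof (rule integral_along_simple_tendsto_zero[OF k(1), of "\<lambda>n c x. blinfun_apply c (s n x)"])
      show "(\<lambda>x. blinfun_apply c (s n x)) \<in> L2 M" for n and c :: "'b \<Rightarrow>\<^sub>L real"
        using L2_blinfun[OF sL2, of c n] unfolding L2_real_iff by simp
    qed (rule slim)
    then have "eventually (\<lambda>n. norm (\<integral>x. blinfun_apply (k x) (s n x) \<partial>M) < e / 2) sequentially"
      using e by (intro order_tendstoD(2)[OF tendsto_norm_zero]) auto
    then obtain N where N: "\<And>n. N \<le> n \<Longrightarrow> norm (\<integral>x. blinfun_apply (k x) (s n x) \<partial>M) < e / 2"
      unfolding eventually_sequentially by blast
    have "norm (l (s n) - 0) < e" if "N \<le> n" for n
    proof -
      have "l (s n) = (\<integral>x. blinfun_apply (h x - k x) (s n x) \<partial>M) + (\<integral>x. blinfun_apply (k x) (s n x) \<partial>M)"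
        unfolding blinfun.diff_left
        using Bochner_Integration.integral_diff[OF pairing_L2(1)[OF h sL2[of n]] pairing_L2(1)[OF kL2 sL2[of n]]] rep[of n]
        by linarith
      moreover have "\<bar>\<integral>x. blinfun_apply (h x - k x) (s n x) \<partial>M\<bar> \<le> sqrt d * sqrt C'"
      proof (rule order_trans[OF pairing_L2(2)[OF L2_diff[OF h kL2] sL2[of n]]])
        show "sqrt (\<integral>x. (norm (h x - k x))\<^sup>2 \<partial>M) * sqrt (\<integral>x. (norm (s n x))\<^sup>2 \<partial>M) \<le> sqrt d * sqrt C'"
          using k(2) sC[of n] d C' by (intro mult_mono real_sqrt_le_mono) auto
      qed
      ultimately show ?thesis using N[OF that] dC by simp
    qed
    then show "\<exists>N. \<forall>n\<ge>N. norm (l (s n) - 0) < e" by blast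
  qed
  from tendsto_add[OF L2_functional_tendsto_zero[OF l dL2 dlim] this]
  show ?thesis using L2_functional_diff[OF l u(1) sL2] by simp
qed

end

context complete_finite_measure
begin

section \<open>Uniqueness of the candidate limit and weak compactness\<close>

lemma L2_functional_mult:
  fixes b :: "'a \<Rightarrow> real"
  assumes b: "b \<in> L2 M"
  shows "L2_functional M (\<lambda>f. \<integral>x. f x * b x \<partial>M)"
  unfolding L2_functional_def
proof (intro conjI ballI allI exI)
  have int: "integrable M (\<lambda>x. f x * b x)" if "f \<in> L2 M" for f
    using that b integrable_mult_L2(1)[of f b] by (simp add: L2_real_iff)
  fix f g :: "'a \<Rightarrow> real" assume fg: "f \<in> L2 M" "g \<in> L2 M"
  show "(\<integral>x. (f x + g x) * b x \<partial>M) = (\<integral>x. f x * b x \<partial>M) + (\<integral>x. g x * b x \<partial>M)"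
    using int[OF fg(1)] int[OF fg(2)] by (simp add: distrib_right)
next
  fix c :: real and f :: "'a \<Rightarrow> real" assume "f \<in> L2 M"
  show "(\<integral>x. c *\<^sub>R f x * b x \<partial>M) = c * (\<integral>x. f x * b x \<partial>M)" by (simp add: mult.assoc)
next
  fix f :: "'a \<Rightarrow> real" assume "f \<in> L2 M"
  then show "\<bar>\<integral>x. f x * b x \<partial>M\<bar> \<le> sqrt (\<integral>x. (b x)\<^sup>2 \<partial>M) * L2_norm M f"
    using b integrable_mult_L2(2)[of f b] by (simp add: L2_real_iff L2_norm_def mult.commute)
qed

text \<open>An interval around \<open>c\<close> is stable under midpoints; once it contains the
  values of a tail, it contains those of all combinations of the tail.\<close>

lemma mid_combs_tendsto:
  fixes v :: "nat \<Rightarrow> 'a \<Rightarrow> 'b::real_vector" and \<Phi> :: "('a \<Rightarrow> 'b) \<Rightarrow> real"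
  assumes mid: "\<And>f g. f \<in> mid_combs v 0 \<Longrightarrow> g \<in> mid_combs v 0 \<Longrightarrow> \<Phi> (\<lambda>x. (1/2) *\<^sub>R (f x + g x)) = (\<Phi> f + \<Phi> g) / 2"
    and lim: "(\<lambda>n. \<Phi> (v n)) \<longlonglongrightarrow> c" and w: "\<And>n. w n \<in> mid_combs v n"
  shows "(\<lambda>n. \<Phi> (w n)) \<longlonglongrightarrow> c"
proof (rule LIMSEQ_I)
  fix e :: real assume "0 < e"
  then obtain N where N: "\<And>n. N \<le> n \<Longrightarrow> norm (\<Phi> (v n) - c) < e" using LIMSEQ_D[OF lim] by blast
  have *: "\<bar>\<Phi> f - c\<bar> < e" if "f \<in> mid_combs v N" for f
    using that
  proof induction
    case (base k)
    then show ?case using N by simp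
  next
    case (mid f g)
    have "\<Phi> (\<lambda>x. (1/2) *\<^sub>R (f x + g x)) = (\<Phi> f + \<Phi> g) / 2"
      using mid mid_combs_antimono[of _ v N 0] by (intro assms(1)) auto
    then show ?case using mid.IH by (simp add: abs_if field_simps split: if_splits)
  qed
  show "\<exists>no. \<forall>n\<ge>no. norm (\<Phi> (w n) - c) < e"
    using *[OF mid_combs_antimono[OF w]] by auto
qed

lemma L2_functional_midpoint:
  assumes "L2_functional M l" "f \<in> L2 M" "g \<in> L2 M"
  shows "l (\<lambda>x. (1/2) *\<^sub>R (f x + g x)) = (l f + l g) / 2"
  using L2_functional_scaleR[OF assms(1) L2_add[OF assms(2,3)], of "1/2"] L2_functional_add[OF assms] by simp

text \<open>The hypothesis on \<open>v\<close> determines the pairing of each \<open>l i \<circ> u\<close> with all \<open>l i \<circ> v m\<close>, and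
  \<open>l i \<circ> u\<close> is a limit of combinations of these.\<close>

lemma limit_of_mid_combs_unique:
  fixes v :: "nat \<Rightarrow> 'a \<Rightarrow> 'b::real_normed_vector"
  assumes sn: "separable_norming y l S" and v: "\<And>n. v n \<in> L2 M" "\<And>n. (\<integral>x. (norm (v n x))\<^sup>2 \<partial>M) \<le> B"
    and lim: "\<And>i m. (\<lambda>n. \<integral>x. l i (v n x) * l i (v m x) \<partial>M) \<longlonglongrightarrow> c i m"
    and s: "\<And>j. strict_mono (s j :: nat \<Rightarrow> nat)"
    and w: "\<And>j n. w j n \<in> mid_combs (\<lambda>n. v (s j n)) n"
    and u: "\<And>j. u j \<in> L2 M" "\<And>j. AE x in M. u j x \<in> S"
    and wu: "\<And>j i. (\<lambda>n. \<integral>x. (l i (w j n x - u j x))\<^sup>2 \<partial>M) \<longlonglongrightarrow> 0"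
  shows "AE x in M. u (j :: bool) x = u j' x"
proof -
  interpret separable_norming y l S by (rule sn)
  have lL2: "(\<lambda>x. l i (f x)) \<in> L2 M" if "f \<in> L2 M" for f i
    using L2_blinfun[OF that, of "l i"] by (simp add: L2_real_iff)
  have mL2: "f \<in> L2 M" if "f \<in> mid_combs (\<lambda>n. v (s j n)) n" for f j n
    using mid_combs_L2(1)[where v="\<lambda>n. v (s j n)", OF v(1) v(2) that] .
  have wL2: "w j n \<in> L2 M" for j n by (rule mL2[OF w])
  have to_u: "(\<lambda>n. \<integral>x. l i (w j n x) * b x \<partial>M) \<longlonglongrightarrow> (\<integral>x. l i (u j x) * b x \<partial>M)"
    if b: "b \<in> L2 M" for i j b
  proof -
    have dL2: "(\<lambda>x. l i (w j n x - u j x)) \<in> L2 M" for n by (rule lL2[OF L2_diff[OF wL2 u(1)]])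
    have "(\<lambda>n. \<integral>x. l i (w j n x - u j x) * b x \<partial>M) \<longlonglongrightarrow> 0"
      by (rule L2_functional_tendsto_zero[OF L2_functional_mult[OF b] dL2]) (simp add: wu)
    moreover have "(\<integral>x. l i (w j n x - u j x) * b x \<partial>M) = (\<integral>x. l i (w j n x) * b x \<partial>M) - (\<integral>x. l i (u j x) * b x \<partial>M)" for n
      unfolding blinfun.diff_right
      by (rule L2_functional_diff[OF L2_functional_mult[OF b] lL2[OF wL2] lL2[OF u(1)]])
    ultimately show ?thesis by (simp add: LIM_zero_iff)
  qed
  have mid: "(\<integral>x. l i ((1/2) *\<^sub>R (f x + g x)) * b x \<partial>M) = ((\<integral>x. l i (f x) * b x \<partial>M) + (\<integral>x. l i (g x) * b x \<partial>M)) / 2"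
    if "b \<in> L2 M" "f \<in> L2 M" "g \<in> L2 M" for i b f g
    using L2_functional_midpoint[OF L2_functional_mult[OF that(1)] lL2[OF that(2)] lL2[OF that(3)], of i i]
    by (simp add: blinfun.scaleR_right blinfun.add_right)
  have pair: "(\<integral>x. l i (u j x) * l i (v m x) \<partial>M) = c i m" for i j m
  proof -
    have "(\<lambda>n. \<integral>x. l i (w j n x) * l i (v m x) \<partial>M) \<longlonglongrightarrow> c i m"
    proof (rule mid_combs_tendsto[where v="\<lambda>n. v (s j n)" and \<Phi>="\<lambda>f. \<integral>x. l i (f x) * l i (v m x) \<partial>M"])
      show "(\<lambda>n. \<integral>x. l i (v (s j n) x) * l i (v m x) \<partial>M) \<longlonglongrightarrow> c i m"
        using LIMSEQ_subseq_LIMSEQ[OF lim[of i m] s[of j]] by (simp add: o_def)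
    qed (use w mid[OF lL2[OF v(1)]] mL2 in auto)
    with to_u[OF lL2[OF v(1)]] show ?thesis by (rule LIMSEQ_unique)
  qed
  have "AE x in M. l i (u j x) - l i (u j' x) = 0" for i
  proof -
    \<comment> \<open>\<open>b\<close> is orthogonal to every \<open>l i \<circ> v m\<close>, hence
      to the combinations and to their limits \<open>l i \<circ> u j\<close> and
      \<open>l i \<circ> u j'\<close>, hence to itself.\<close>
    define b where "b x = l i (u j x) - l i (u j' x)" for x
    have b: "b \<in> L2 M" unfolding b_def by (rule L2_diff[OF lL2[OF u(1)] lL2[OF u(1)]])
    note midb = mid[OF b]
    have "(\<integral>x. l i (v m x) * b x \<partial>M) = 0" for m
    proof -
      have "(\<integral>x. (l i (u j x) - l i (u j' x)) * l i (v m x) \<partial>M)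
          = (\<integral>x. l i (u j x) * l i (v m x) \<partial>M) - (\<integral>x. l i (u j' x) * l i (v m x) \<partial>M)"
        by (rule L2_functional_diff[OF L2_functional_mult[OF lL2[OF v(1)]] lL2[OF u(1)] lL2[OF u(1)]])
      then show ?thesis by (simp add: pair b_def mult.commute)
    qed
    note vm = this
    have comb: "(\<integral>x. l i (f x) * b x \<partial>M) = 0" if "f \<in> mid_combs (\<lambda>n. v (s k n)) n" for k f n
      using that
    proof induction
      case (mid f g)
      then show ?case using midb[OF mL2[OF mid.hyps(1)] mL2[OF mid.hyps(2)], of i] by simp
    qed (rule vm)
    have "(\<integral>x. l i (w k n x) * b x \<partial>M) = 0" for k n by (rule comb[OF w])
    then have z: "(\<integral>x. l i (u k x) * b x \<partial>M) = 0" for k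
      using to_u[OF b, of i k] by (simp add: LIMSEQ_const_iff)
    have "(\<integral>x. (l i (u j x) - l i (u j' x)) * b x \<partial>M) = (\<integral>x. l i (u j x) * b x \<partial>M) - (\<integral>x. l i (u j' x) * b x \<partial>M)"
      by (rule L2_functional_diff[OF L2_functional_mult[OF b] lL2[OF u(1)] lL2[OF u(1)]])
    then have "(\<integral>x. (b x)\<^sup>2 \<partial>M) = 0" by (simp add: z power2_eq_square flip: b_def)
    then have "AE x in M. (b x)\<^sup>2 = 0"
      using b by (subst integral_nonneg_eq_0_iff_AE[symmetric]) (auto simp: L2_real_iff)
    then show ?thesis by (simp add: b_def)
  qed
  then have "AE x in M. \<forall>i. l i (u j x) - l i (u j' x) = 0" by (simp add: AE_all_countable)
  then show ?thesis using u(2)[of j] u(2)[of j']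
  proof eventually_elim
    case (elim x)
    then have "u j x - u j' x = 0"
      by (intro eq_zero_if_functionals_zero subspace_diff[OF subspace_S]) (auto simp: blinfun.diff_right)
    then show ?case by simp
  qed
qed

text \<open>A diagonal subsequence makes the pairings of \<open>l i \<circ> v n\<close> with every
  \<open>l i \<circ> v m\<close> converge, which fixes the candidate \<open>u\<close> for all
  further subsequences. If some \<open>\<Lambda>\<close> failed to converge to
  \<open>\<Lambda> u\<close>, it would have a limit \<open>\<beta>\<close> along a subsequence
  staying away from \<open>\<Lambda> u\<close>; on combinations of that subsequence it tends both to
  \<open>\<beta>\<close> and to \<open>\<Lambda> u\<close>.\<close>

lemma weakly_convergent_subsequence:
  fixes v :: "nat \<Rightarrow> 'a \<Rightarrow> 'b::real_normed_vector"
  assumes refl: "reflexive TYPE('b)"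
    and v: "\<And>n. v n \<in> L2 M" "\<And>n. (\<integral>x. (norm (v n x))\<^sup>2 \<partial>M) \<le> B"
  shows "\<exists>r u. strict_mono (r :: nat \<Rightarrow> nat) \<and> L2_weak_conv M (\<lambda>n. v (r n)) u"
proof -
  obtain y l S where sn: "separable_norming y l S" and S: "\<And>n. AE x in M. v n x \<in> S"
    using L2_sequence_in_separable_subspace[of v, OF L2_strongly_measurable[OF v(1)]] by auto
  interpret separable_norming y l S by (rule sn)
  have lL2: "(\<lambda>x. l i (f x)) \<in> L2 M" if "f \<in> L2 M" for f i
    using L2_blinfun[OF that, of "l i"] by (simp add: L2_real_iff)
  have B0: "0 \<le> B" using v(2)[of 0] by (rule order_trans[rotated]) simp
  have lB: "(\<integral>x. (l i (v n x))\<^sup>2 \<partial>M) \<le> B" for i n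
  proof -
    have "(\<integral>x. (l i (v n x))\<^sup>2 \<partial>M) \<le> (\<integral>x. (norm (v n x))\<^sup>2 \<partial>M)"
      using l_le_norm by (intro integral_mono L2_blinfun(2)[OF v(1)] L2_integrable[OF v(1)]) (metis abs_le_square_iff abs_norm_cancel)
    then show ?thesis using v(2)[of n] by linarith
  qed
  define F where "F n q = (\<integral>x. l (fst q) (v n x) * l (fst q) (v (snd q) x) \<partial>M)" for n q
  have F: "norm (F n q) \<le> sqrt B * sqrt B" for n q
  proof -
    have "\<bar>F n q\<bar> \<le> sqrt (\<integral>x. (l (fst q) (v n x))\<^sup>2 \<partial>M) * sqrt (\<integral>x. (l (fst q) (v (snd q) x))\<^sup>2 \<partial>M)"
      unfolding F_def by (intro integrable_mult_L2(2) L2_blinfun v(1))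
    also have "\<dots> \<le> sqrt B * sqrt B" using lB B0 by (intro mult_mono real_sqrt_le_mono) auto
    finally show ?thesis by simp
  qed
  obtain r :: "nat \<Rightarrow> nat" where r: "strict_mono r" and Fr: "\<And>q. q \<in> UNIV \<Longrightarrow> \<exists>L. (\<lambda>n. F (r n) q) \<longlonglongrightarrow> L"
    using function_convergent_subsequence[of "UNIV :: (nat \<times> nat) set" F "sqrt B * sqrt B"] F by auto
  define V where "V n = v (r n)" for n
  have V: "V n \<in> L2 M" "(\<integral>x. (norm (V n x))\<^sup>2 \<partial>M) \<le> B" "AE x in M. V n x \<in> S" for n
    using v S by (auto simp: V_def)
  have "convergent (\<lambda>n. \<integral>x. l i (V n x) * l i (V m x) \<partial>M)" for i m
    using Fr[of "(i, r m)"] by (simp add: F_def V_def convergent_def)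
  then have c: "(\<lambda>n. \<integral>x. l i (V n x) * l i (V m x) \<partial>M) \<longlonglongrightarrow> lim (\<lambda>n. \<integral>x. l i (V n x) * l i (V m x) \<partial>M)" for i m
    by (simp add: convergent_LIMSEQ_iff)
  obtain w u where w: "\<And>n. w n \<in> mid_combs V n" and u: "u \<in> L2 M" "AE x in M. u x \<in> S"
    and wu: "\<And>\<kappa> :: 'b \<Rightarrow>\<^sub>L real. (\<lambda>n. \<integral>x. (\<kappa> (w n x - u x))\<^sup>2 \<partial>M) \<longlonglongrightarrow> 0"
    using weak_combs_in_subspace[where v=V, OF refl sn V] by auto
  have "(\<lambda>n. \<Lambda> (V n)) \<longlonglongrightarrow> \<Lambda> u" if \<Lambda>: "L2_functional M \<Lambda>" for \<Lambda>
  proof (rule ccontr)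
    assume "\<not> ?thesis"
    then obtain e where e: "0 < e" and "\<forall>N. \<exists>n\<ge>N. e \<le> norm (\<Lambda> (V n) - \<Lambda> u)"
      unfolding LIMSEQ_iff by (meson not_le)
    then have "infinite {n. e \<le> norm (\<Lambda> (V n) - \<Lambda> u)}"
      by (simp add: infinite_nat_iff_unbounded_le)
    from infinite_enumerate[OF this] obtain s where s: "strict_mono (s :: nat \<Rightarrow> nat)"
      and far: "\<And>n. e \<le> norm (\<Lambda> (V (s n)) - \<Lambda> u)" by auto
    obtain b where b: "0 < b" "\<And>f. f \<in> L2 M \<Longrightarrow> \<bar>\<Lambda> f\<bar> \<le> b * L2_norm M f"
      using L2_functional_bound[OF \<Lambda>] by blast
    have "norm (\<Lambda> (V (s n))) \<le> b * sqrt B" for n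
    proof -
      have "L2_norm M (V (s n)) \<le> sqrt B" unfolding L2_norm_def by (rule real_sqrt_le_mono[OF V(2)])
      then have "b * L2_norm M (V (s n)) \<le> b * sqrt B" using b(1) by simp
      then show ?thesis using b(2)[OF V(1)[of "s n"]] by simp
    qed
    then have "bounded (range (\<lambda>n. \<Lambda> (V (s n))))" by (auto simp: bounded_iff)
    from bounded_imp_convergent_subsequence[OF this] obtain \<beta> t where t: "strict_mono (t :: nat \<Rightarrow> nat)"
      and "((\<lambda>n. \<Lambda> (V (s n))) \<circ> t) \<longlonglongrightarrow> \<beta>" by blast
    then have \<beta>: "(\<lambda>n. \<Lambda> (V (s (t n)))) \<longlonglongrightarrow> \<beta>" by (simp add: o_def)
    define p where "p n = s (t n)" for n
    have p: "strict_mono p" using s t unfolding p_def by (simp add: strict_mono_def)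
    obtain w' u' where w': "\<And>n. w' n \<in> mid_combs (\<lambda>n. V (p n)) n" and u': "u' \<in> L2 M" "AE x in M. u' x \<in> S"
      and wu': "\<And>\<kappa> :: 'b \<Rightarrow>\<^sub>L real. (\<lambda>n. \<integral>x. (\<kappa> (w' n x - u' x))\<^sup>2 \<partial>M) \<longlonglongrightarrow> 0"
      using weak_combs_in_subspace[where v="\<lambda>n. V (p n)", OF refl sn V] by auto
    have eq: "AE x in M. u' x = u x"
    proof -
      \<comment> \<open>The Boolean index selects between the combinations of the subsequence
        \<open>p\<close> and those of the whole sequence.\<close>
      have "AE x in M. (if True then u' else u) x = (if False then u' else u) x"
        by (rule limit_of_mid_combs_unique[where s="\<lambda>j. if j then p else id" and w="\<lambda>j. if j then w' else w"
              and u="\<lambda>j. if j then u' else u", OF sn V(1,2) c])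
          (use p w w' u u' wu wu' in \<open>auto simp: strict_mono_def\<close>)
      then show ?thesis by simp
    qed
    have w'L2: "w' n \<in> L2 M" "(\<integral>x. (norm (w' n x))\<^sup>2 \<partial>M) \<le> B" for n
      using mid_combs_L2[where v="\<lambda>n. V (p n)", OF V(1) V(2) w'] by auto
    have "(\<lambda>n. \<Lambda> (\<lambda>x. w' n x - u' x)) \<longlonglongrightarrow> 0"
    proof (rule L2_functional_tendsto_zero_if_scalarly_null[OF refl \<Lambda> L2_diff[OF w'L2(1) u'(1)] _ wu'])
      show "(\<integral>x. (norm (w' n x - u' x))\<^sup>2 \<partial>M) \<le> 2 * B + 2 * (\<integral>x. (norm (u' x))\<^sup>2 \<partial>M)" for n
        using integral_norm_diff_sq_le[OF w'L2(1)[of n] u'(1)] w'L2(2)[of n] by simp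
    qed
    then have "(\<lambda>n. \<Lambda> (w' n)) \<longlonglongrightarrow> \<Lambda> u'"
      using L2_functional_diff[OF \<Lambda> w'L2(1) u'(1)] by (simp add: LIM_zero_iff)
    moreover have "(\<lambda>n. \<Lambda> (w' n)) \<longlonglongrightarrow> \<beta>"
    proof (rule mid_combs_tendsto[where v="\<lambda>n. V (p n)" and \<Phi>=\<Lambda>, OF _ _ w'])
      show "(\<lambda>n. \<Lambda> (V (p n))) \<longlonglongrightarrow> \<beta>" using \<beta> by (simp add: p_def)
      fix f g assume "f \<in> mid_combs (\<lambda>n. V (p n)) 0" "g \<in> mid_combs (\<lambda>n. V (p n)) 0"
      then have "f \<in> L2 M" "g \<in> L2 M"
        using mid_combs_L2(1)[where v="\<lambda>n. V (p n)", OF V(1) V(2)] by auto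
      then show "\<Lambda> (\<lambda>x. (1/2) *\<^sub>R (f x + g x)) = (\<Lambda> f + \<Lambda> g) / 2" by (rule L2_functional_midpoint[OF \<Lambda>])
    qed
    ultimately have "\<beta> = \<Lambda> u'" by (rule LIMSEQ_unique[rotated])
    then have "\<beta> = \<Lambda> u" using L2_functional_AE_cong[OF \<Lambda> u'(1) u(1) eq] by simp
    then have "(\<lambda>n. norm (\<Lambda> (V (s (t n))) - \<Lambda> u)) \<longlonglongrightarrow> 0"
      using tendsto_norm_zero[OF LIM_zero[OF \<beta>]] by simp
    then have "e \<le> 0" by (rule LIMSEQ_le_const) (use far in auto)
    then show False using e by simp
  qed
  then show ?thesis using r u V unfolding L2_weak_conv_def V_def by blast
qed

end

section \<open>Admissible vector fields are Lipschitz\<close>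

lemma first_exit_point:
  fixes x z :: "'a::euclidean_space"
  assumes \<Omega>: "open \<Omega>" and x: "x \<in> \<Omega>" and z: "z \<notin> \<Omega>"
  obtains s where "0 < s" "s \<le> 1" "x + s *\<^sub>R (z - x) \<notin> \<Omega>" "\<And>t. 0 \<le> t \<Longrightarrow> t < s \<Longrightarrow> x + t *\<^sub>R (z - x) \<in> \<Omega>"
proof -
  define g where "g t = x + t *\<^sub>R (z - x)" for t
  define E where "E = {0..1::real} \<inter> g -` (- \<Omega>)"
  have cont: "continuous_on UNIV g" unfolding g_def by (intro continuous_intros)
  have "closed (g -` (- \<Omega>))" using cont \<Omega> by (intro closed_vimage) (auto simp: closed_Compl)
  then have "compact E" unfolding E_def by (intro compact_Int_closed) auto
  moreover have "1 \<in> E" using z by (simp add: E_def g_def)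
  ultimately obtain s where s: "s \<in> E" "\<And>t. t \<in> E \<Longrightarrow> s \<le> t"
    using compact_attains_inf[of E] by blast
  have "s \<noteq> 0" using s(1) x by (auto simp: E_def g_def)
  show ?thesis
  proof (rule that[of s])
    show "0 < s" "s \<le> 1" "x + s *\<^sub>R (z - x) \<notin> \<Omega>" using s(1) \<open>s \<noteq> 0\<close> by (auto simp: E_def g_def)
    show "x + t *\<^sub>R (z - x) \<in> \<Omega>" if "0 \<le> t" "t < s" for t
    proof (rule ccontr)
      assume "\<not> ?thesis"
      then have "t \<in> E" using that \<open>s \<le> 1\<close> by (auto simp: E_def g_def)
      then show False using s(2) that by fastforce
    qed
  qed
qed

lemma norm_diff_le_along_segment:
  fixes f :: "'a::euclidean_space \<Rightarrow> 'b::euclidean_space"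
  assumes cont: "continuous_on UNIV f"
    and diff: "\<And>t. 0 < t \<Longrightarrow> t < s \<Longrightarrow> f differentiable at (x + t *\<^sub>R (z - x))"
    and bound: "\<And>t. 0 < t \<Longrightarrow> t < s \<Longrightarrow> onorm (frechet_derivative f (at (x + t *\<^sub>R (z - x)))) \<le> L"
    and s: "0 < s"
  shows "norm (f (x + s *\<^sub>R (z - x)) - f x) \<le> L * (s * norm (z - x))"
proof -
  define g where "g t = x + t *\<^sub>R (z - x)" for t
  have g: "(g has_derivative (\<lambda>h. h *\<^sub>R (z - x))) (at t)" for t
    unfolding g_def by (auto intro!: derivative_eq_intros)
  have der: "((\<lambda>t. f (g t)) has_derivative (\<lambda>h. frechet_derivative f (at (g t)) (h *\<^sub>R (z - x)))) (at t)"
    if "0 < t" "t < s" for t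
  proof -
    have "(f has_derivative frechet_derivative f (at (g t))) (at (g t))"
      using diff[OF that] unfolding g_def frechet_derivative_works .
    from diff_chain_at[OF g this] show ?thesis by (simp add: o_def)
  qed
  have "continuous_on {0..s} (\<lambda>t. f (g t))"
    unfolding g_def by (intro continuous_on_compose2[OF cont] continuous_intros) auto
  from mvt_general[OF s this der]
  have "\<exists>t\<in>{0<..<s}. norm (f (g s) - f (g 0)) \<le> norm (frechet_derivative f (at (g t)) ((s - 0) *\<^sub>R (z - x)))" .
  then obtain t where t: "0 < t" "t < s" "norm (f (g s) - f (g 0)) \<le> norm (frechet_derivative f (at (g t)) (s *\<^sub>R (z - x)))"
    by auto
  have "bounded_linear (frechet_derivative f (at (g t)))"
    using diff[OF t(1,2)] unfolding g_def by (simp add: frechet_derivative_works has_derivative_bounded_linear)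
  then have "norm (frechet_derivative f (at (g t)) (s *\<^sub>R (z - x))) \<le> onorm (frechet_derivative f (at (g t))) * norm (s *\<^sub>R (z - x))"
    by (rule onorm)
  also have "\<dots> \<le> L * norm (s *\<^sub>R (z - x))"
    using bound[OF t(1,2)] unfolding g_def by (intro mult_right_mono) auto
  finally show ?thesis using t(3) s by (simp add: g_def)
qed

text \<open>\<open>\<Omega>\<close> need not be convex, so the mean value inequality applies only as
  far as a segment stays inside. If the segment contains a point outside, each endpoint is compared
  with its first exit towards that point, where \<open>f\<close> vanishes, and the two lengths add
  up to at most \<open>norm (x - y)\<close>.\<close>

lemma Lipschitz_if_derivative_bounded:
  fixes f :: "'a::euclidean_space \<Rightarrow> 'b::euclidean_space"
  assumes \<Omega>: "open \<Omega>" and cont: "continuous_on UNIV f" and out: "\<And>x. x \<notin> \<Omega> \<Longrightarrow> f x = 0"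
    and diff: "\<And>x. x \<in> \<Omega> \<Longrightarrow> f differentiable at x"
    and bound: "\<And>x. x \<in> \<Omega> \<Longrightarrow> onorm (frechet_derivative f (at x)) \<le> L" and L: "0 \<le> L"
  shows "norm (f x - f y) \<le> L * norm (x - y)"
proof -
  have exit: "norm (f x) \<le> L * norm (x - z)" if z: "z \<notin> \<Omega>" for x z
  proof (cases "x \<in> \<Omega>")
    case True
    then obtain s where s: "0 < s" "s \<le> 1" "x + s *\<^sub>R (z - x) \<notin> \<Omega>" "\<And>t. 0 \<le> t \<Longrightarrow> t < s \<Longrightarrow> x + t *\<^sub>R (z - x) \<in> \<Omega>"
      using first_exit_point[OF \<Omega> _ z] by metis
    have "norm (f (x + s *\<^sub>R (z - x)) - f x) \<le> L * (s * norm (z - x))"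
      using s by (intro norm_diff_le_along_segment[OF cont]) (auto intro: diff bound)
    also have "\<dots> \<le> L * (1 * norm (z - x))" using s L by (intro mult_left_mono mult_right_mono) auto
    finally show ?thesis using out[OF s(3)] by (simp add: norm_minus_commute)
  next
    case False
    then show ?thesis using out L by simp
  qed
  show ?thesis
  proof (cases "\<forall>t\<in>{0..1}. x + t *\<^sub>R (y - x) \<in> \<Omega>")
    case True
    then have "norm (f (x + 1 *\<^sub>R (y - x)) - f x) \<le> L * (1 * norm (y - x))"
      by (intro norm_diff_le_along_segment[OF cont]) (auto intro: diff bound)
    then show ?thesis by (simp add: norm_minus_commute)
  next
    case False
    then obtain t where t: "0 \<le> t" "t \<le> 1" "x + t *\<^sub>R (y - x) \<notin> \<Omega>" by auto
    have "norm (f x) \<le> L * norm (x - (x + t *\<^sub>R (y - x)))" by (rule exit[OF t(3)])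
    also have "x - (x + t *\<^sub>R (y - x)) = t *\<^sub>R (x - y)" by (simp add: algebra_simps)
    finally have 1: "norm (f x) \<le> L * (t * norm (x - y))" using t by simp
    have "norm (f y) \<le> L * norm (y - (x + t *\<^sub>R (y - x)))" by (rule exit[OF t(3)])
    also have "y - (x + t *\<^sub>R (y - x)) = (1 - t) *\<^sub>R (y - x)" by (simp add: algebra_simps)
    finally have 2: "norm (f y) \<le> L * ((1 - t) * norm (x - y))" using t by (simp add: norm_minus_commute)
    have "norm (f x - f y) \<le> norm (f x) + norm (f y)" by (rule norm_triangle_ineq4)
    also have "\<dots> \<le> L * (t * norm (x - y)) + L * ((1 - t) * norm (x - y))" using 1 2 by (rule add_mono)
    also have "\<dots> = L * norm (x - y)" by (simp add: algebra_simps)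
    finally show ?thesis .
  qed
qed

lemma holder_norm_sup_le:
  assumes "holder_norm \<Omega> \<alpha> f \<le> ennreal c" "x \<in> \<Omega>" "0 \<le> c"
  shows "norm (f x) \<le> c" "onorm (frechet_derivative f (at x)) \<le> c"
proof -
  have "ennreal (norm (f x)) \<le> (SUP x\<in>\<Omega>. ennreal (norm (f x)))"
    using assms(2) by (rule SUP_upper)
  also have "\<dots> \<le> holder_norm \<Omega> \<alpha> f" unfolding holder_norm_def by (intro add_increasing2 order_refl) auto
  finally have "ennreal (norm (f x)) \<le> ennreal c" using assms(1) by (rule order_trans)
  then show "norm (f x) \<le> c" using assms(3) by simp
  have "ennreal (onorm (frechet_derivative f (at x))) \<le> (SUP x\<in>\<Omega>. ennreal (onorm (frechet_derivative f (at x))))"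
    using assms(2) by (rule SUP_upper)
  also have "\<dots> \<le> holder_norm \<Omega> \<alpha> f" unfolding holder_norm_def by (intro add_increasing2 add_increasing order_refl) auto
  finally have "ennreal (onorm (frechet_derivative f (at x))) \<le> ennreal c" using assms(1) by (rule order_trans)
  then show "onorm (frechet_derivative f (at x)) \<le> c" using assms(3) by simp
qed

text \<open>Differentiability is known only inside \<open>\<Omega>\<close>. Continuity of the
  extension by zero across the boundary comes from uniform approximation by continuous functions
  with compact support in \<open>\<Omega>\<close>.\<close>

lemma C0_holder_continuous:
  fixes f :: "'a::euclidean_space \<Rightarrow> 'b::euclidean_space"
  assumes f: "f \<in> C0_holder \<Omega> \<alpha>"
  shows "continuous_on UNIV f"
  unfolding continuous_on_iff
proof (intro ballI allI impI)
  fix x and e :: real assume e: "0 < e"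
  then have "0 < ennreal (e / 3)" by simp
  then obtain g where g: "g \<in> Cc_infinity \<Omega>" "holder_norm \<Omega> \<alpha> (\<lambda>x. f x - g x) < ennreal (e / 3)"
    using f unfolding C0_holder_def by blast
  have near: "norm (f y - g y) \<le> e / 3" for y
  proof (cases "y \<in> \<Omega>")
    case True
    then show ?thesis using holder_norm_sup_le(1)[of \<Omega> \<alpha> "\<lambda>x. f x - g x" "e / 3" y] g(2) e by simp
  next
    case False
    have cl: "closure {x. g x \<noteq> 0} \<subseteq> \<Omega>" using g(1) unfolding Cc_infinity_def by simp
    have "g y = 0" using order_trans[OF closure_subset cl] False by auto
    moreover have "f y = 0" using f False by (simp add: C0_holder_def)
    ultimately show ?thesis using e by simp
  qed
  have "Ck 0 g" using g(1) unfolding Cc_infinity_def by simp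
  then have "continuous_on UNIV g" by simp
  then have "\<exists>d>0. \<forall>y\<in>UNIV. dist y x < d \<longrightarrow> dist (g y) (g x) < e / 3"
    unfolding continuous_on_iff by (elim ballE[of _ _ x] allE[of _ "e / 3"]) (use e in auto)
  then obtain d where d: "0 < d" "\<And>y. dist y x < d \<Longrightarrow> dist (g y) (g x) < e / 3" by auto
  have "dist (f y) (f x) < e" if "dist y x < d" for y
  proof -
    have "dist (f y) (f x) \<le> norm (f y - g y) + dist (g y) (g x) + norm (f x - g x)"
      unfolding dist_norm using norm_triangle_ineq[of "f y - g y" "g y - g x"] norm_triangle_ineq4[of "f y - g x" "f x - g x"]
      by simp
    then show ?thesis using near[of y] near[of x] d(2)[OF that] by simp
  qed
  then show "\<exists>d>0. \<forall>x'\<in>UNIV. dist x' x < d \<longrightarrow> dist (f x') (f x) < e" using d(1) by blast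
qed

lemma admissible_fields:
  fixes \<iota> :: "'v::real_normed_vector \<Rightarrow> 'a::euclidean_space \<Rightarrow> 'a"
  assumes \<Omega>: "open \<Omega>" and adm: "admissible \<Omega> \<iota>"
  shows "\<exists>C>0. \<forall>v. (\<forall>x. norm (\<iota> v x) \<le> C * norm v) \<and> (\<forall>x y. norm (\<iota> v x - \<iota> v y) \<le> C * norm v * norm (x - y))"
    and "\<And>v x. x \<notin> \<Omega> \<Longrightarrow> \<iota> v x = 0" "\<And>v w x. \<iota> (v + w) x = \<iota> v x + \<iota> w x" "\<And>c v x. \<iota> (c *\<^sub>R v) x = c *\<^sub>R \<iota> v x"
proof -
  obtain \<alpha> C where h: "\<And>v. \<iota> v \<in> C0_holder \<Omega> \<alpha>" "\<And>v w x. \<iota> (v + w) x = \<iota> v x + \<iota> w x"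
    "\<And>c v x. \<iota> (c *\<^sub>R v) x = c *\<^sub>R \<iota> v x" and C: "\<And>v. holder_norm \<Omega> \<alpha> (\<iota> v) \<le> ennreal (C * norm v)"
    using adm unfolding admissible_def by auto
  show out: "\<iota> v x = 0" if "x \<notin> \<Omega>" for v x using h(1)[of v] that by (simp add: C0_holder_def)
  show "\<iota> (v + w) x = \<iota> v x + \<iota> w x" for v w x by (rule h)
  show "\<iota> (c *\<^sub>R v) x = c *\<^sub>R \<iota> v x" for c v x by (rule h)
  define D where "D = max C 1"
  have D: "0 < D" by (simp add: D_def)
  have "ennreal (C * norm v) \<le> ennreal (D * norm v)" for v
    by (intro ennreal_leI mult_right_mono) (auto simp: D_def)
  then have hD: "holder_norm \<Omega> \<alpha> (\<iota> v) \<le> ennreal (D * norm v)" for v using C order_trans by blast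
  have D0: "0 \<le> D * norm v" for v using D by simp
  note b = holder_norm_sup_le[OF hD _ D0]
  have "norm (\<iota> v x) \<le> D * norm v" for v x using b(1)[of x v] out[of x v] D0[of v] by (cases "x \<in> \<Omega>") auto
  moreover have "norm (\<iota> v x - \<iota> v y) \<le> D * norm v * norm (x - y)" for v x y
    using h(1)[of v] by (intro Lipschitz_if_derivative_bounded[OF \<Omega> C0_holder_continuous[OF h(1)] out _ b(2) D0]) (auto simp: C0_holder_def)
  ultimately show "\<exists>C>0. \<forall>v. (\<forall>x. norm (\<iota> v x) \<le> C * norm v) \<and> (\<forall>x y. norm (\<iota> v x - \<iota> v y) \<le> C * norm v * norm (x - y))"
    using D by blast
qed

section \<open>Caratheodory flows of fields with square integrable Lipschitz constants\<close>

lemma complete_finite_measure_lebesgue_on: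
  assumes S: "S \<in> lmeasurable"
  shows "complete_finite_measure (lebesgue_on S)"
proof -
  have S': "S \<in> sets lebesgue" using S by auto
  have "complete_measure (lebesgue_on S)"
  proof
    fix A B :: "'a set" assume "B \<subseteq> A" "A \<in> null_sets (lebesgue_on S)"
    then have "A \<subseteq> S" "A \<in> null_sets lebesgue" using S' by (auto simp: null_sets_restrict_space)
    then have "B \<in> null_sets lebesgue" using \<open>B \<subseteq> A\<close> completion.complete2[of B A lborel] by simp
    then show "B \<in> sets (lebesgue_on S)"
      using S' \<open>A \<subseteq> S\<close> \<open>B \<subseteq> A\<close> by (auto simp: sets_restrict_space_iff)
  qed
  then show ?thesis
    using finite_measure_lebesgue_on[OF S] by (intro complete_finite_measure.intro)
qed

lemma complete_finite_measure_interval: "complete_finite_measure (lebesgue_on {p..q::real})"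
  by (rule complete_finite_measure_lebesgue_on) simp

interpretation unit_time: complete_finite_measure unit_time
  by (rule complete_finite_measure_interval)

text \<open>The gain \<open>1 / (2 * \<nu>)\<close> over the final squared weight lets a large rate
  turn the integral operator into a contraction. Both time directions occur because trajectories are
  also solved backwards from time \<open>1\<close>.\<close>

lemma integral_exp_weight_le:
  fixes \<nu> t t0 :: real
  assumes "0 < \<nu>"
  shows "integral {min t0 t..max t0 t} (\<lambda>s. (exp (\<nu> * \<bar>s - t0\<bar>))\<^sup>2) \<le> (exp (\<nu> * \<bar>t - t0\<bar>))\<^sup>2 / (2 * \<nu>)"
proof (cases "t0 \<le> t")
  case True
  have "((\<lambda>s. (exp (\<nu> * \<bar>s - t0\<bar>))\<^sup>2) has_integral exp (2 * \<nu> * (t - t0)) / (2 * \<nu>) - exp (2 * \<nu> * (t0 - t0)) / (2 * \<nu>)) {t0..t}"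
  proof (rule fundamental_theorem_of_calculus[OF True])
    fix s assume "s \<in> {t0..t}"
    then have "(exp (\<nu> * \<bar>s - t0\<bar>))\<^sup>2 = exp (2 * \<nu> * (s - t0))" by (simp flip: exp_double)
    moreover have "((\<lambda>s. exp (2 * \<nu> * (s - t0)) / (2 * \<nu>)) has_vector_derivative exp (2 * \<nu> * (s - t0))) (at s within {t0..t})"
      unfolding has_real_derivative_iff_has_vector_derivative[symmetric]
      using assms by (auto intro!: derivative_eq_intros)
    ultimately show "((\<lambda>s. exp (2 * \<nu> * (s - t0)) / (2 * \<nu>)) has_vector_derivative (exp (\<nu> * \<bar>s - t0\<bar>))\<^sup>2) (at s within {t0..t})"
      by simp
  qed
  then have "integral {t0..t} (\<lambda>s. (exp (\<nu> * \<bar>s - t0\<bar>))\<^sup>2) = exp (2 * \<nu> * (t - t0)) / (2 * \<nu>) - 1 / (2 * \<nu>)"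
    by (simp add: integral_unique)
  moreover have "(exp (\<nu> * \<bar>t - t0\<bar>))\<^sup>2 = exp (2 * \<nu> * (t - t0))" using True by (simp flip: exp_double)
  ultimately show ?thesis using True assms by (simp add: min_def max_def)
next
  case False
  then have le: "t \<le> t0" by simp
  have "((\<lambda>s. (exp (\<nu> * \<bar>s - t0\<bar>))\<^sup>2) has_integral - exp (2 * \<nu> * (t0 - t0)) / (2 * \<nu>) - - exp (2 * \<nu> * (t0 - t)) / (2 * \<nu>)) {t..t0}"
  proof (rule fundamental_theorem_of_calculus[OF le])
    fix s assume "s \<in> {t..t0}"
    then have "(exp (\<nu> * \<bar>s - t0\<bar>))\<^sup>2 = exp (2 * \<nu> * (t0 - s))" by (simp flip: exp_double)
    moreover have "((\<lambda>s. - exp (2 * \<nu> * (t0 - s)) / (2 * \<nu>)) has_vector_derivative exp (2 * \<nu> * (t0 - s))) (at s within {t..t0})"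
      unfolding has_real_derivative_iff_has_vector_derivative[symmetric]
      using assms by (auto intro!: derivative_eq_intros)
    ultimately show "((\<lambda>s. - exp (2 * \<nu> * (t0 - s)) / (2 * \<nu>)) has_vector_derivative (exp (\<nu> * \<bar>s - t0\<bar>))\<^sup>2) (at s within {t..t0})"
      by simp
  qed
  then have "integral {t..t0} (\<lambda>s. (exp (\<nu> * \<bar>s - t0\<bar>))\<^sup>2) = exp (2 * \<nu> * (t0 - t)) / (2 * \<nu>) - 1 / (2 * \<nu>)"
    by (simp add: integral_unique)
  moreover have "(exp (\<nu> * \<bar>t - t0\<bar>))\<^sup>2 = exp (2 * \<nu> * (t0 - t))" using le by (simp flip: exp_double)
  ultimately show ?thesis using False assms by (simp add: min_def max_def)
qed

lemma borel_measurable_subinterval: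
  fixes f :: "real \<Rightarrow> 'c::euclidean_space"
  assumes "f \<in> borel_measurable unit_time" "0 \<le> p" "q \<le> 1"
  shows "f \<in> borel_measurable (lebesgue_on {p..q})"
  by (rule measurable_restrict_mono[OF assms(1)]) (use assms(2,3) in auto)

lemma borel_measurable_continuous_unit_time:
  fixes f :: "real \<Rightarrow> 'c::euclidean_space"
  assumes "continuous_on {0..1} f"
  shows "f \<in> borel_measurable unit_time"
  by (rule continuous_imp_measurable_on_sets_lebesgue[OF assms]) simp

lemma integrable_unit_time_imp:
  fixes f :: "real \<Rightarrow> 'c::euclidean_space"
  assumes "integrable unit_time f" "0 \<le> p" "q \<le> 1"
  shows "integrable (lebesgue_on {p..q}) f" "f integrable_on {p..q}" "f absolutely_integrable_on {p..q}"
proof -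
  show i: "integrable (lebesgue_on {p..q}) f"
    by (rule Equivalence_Lebesgue_Henstock_Integration.integrable_subinterval[OF assms(1)]) (use assms(2,3) in auto)
  show "f integrable_on {p..q}" by (rule integrable_on_lebesgue_on[OF i]) simp
  show "f absolutely_integrable_on {p..q}"
    using i by (simp add: set_integrable_def integrable_restrict_space)
qed

lemma integral_difference_eq:
  fixes f :: "real \<Rightarrow> 'c::euclidean_space"
  assumes "f integrable_on {0..1}" "t \<in> {0..1}" "t0 \<in> {0..1}"
  shows "norm (integral {0..t} f - integral {0..t0} f) = norm (integral {min t0 t..max t0 t} f)"
proof (cases "t0 \<le> t")
  case True
  have "integral {0..t} f = integral {0..t0} f + integral {t0..t} f"
    using assms True integrable_on_subinterval[OF assms(1), of 0 t] by (intro Henstock_Kurzweil_Integration.integral_combine[symmetric]) auto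
  then show ?thesis using True by (simp add: min_def max_def)
next
  case False
  have "integral {0..t0} f = integral {0..t} f + integral {t..t0} f"
    using assms False integrable_on_subinterval[OF assms(1), of 0 t0] by (intro Henstock_Kurzweil_Integration.integral_combine[symmetric]) auto
  then have "integral {0..t} f - integral {0..t0} f = - integral {t..t0} f" by simp
  then show ?thesis using False by (simp add: min_def max_def)
qed

text \<open>\<open>a\<close> will be both the time-dependent bound and the Lipschitz constant of a
  field. The estimates below involve only its bound \<open>A\<close>, so they are uniform over
  bounded sets of velocities.\<close>

locale L2_coefficient =
  fixes a :: "real \<Rightarrow> real" and A :: real
  assumes a_meas: "a \<in> borel_measurable unit_time" and a_nonneg: "0 \<le> a s"
    and a_sq_integrable: "integrable unit_time (\<lambda>s. (a s)\<^sup>2)"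
    and a_sq_le: "(\<integral>s. (a s)\<^sup>2 \<partial>unit_time) \<le> A\<^sup>2" and A_pos: "0 < A"
begin

lemma a_mult_integrable:
  fixes b :: "real \<Rightarrow> real"
  assumes "b \<in> borel_measurable unit_time" "integrable unit_time (\<lambda>s. (b s)\<^sup>2)" "0 \<le> p" "q \<le> 1"
  shows "integrable (lebesgue_on {p..q}) (\<lambda>s. a s * b s)"
    "integral {p..q} (\<lambda>s. a s * b s) \<le> A * sqrt (integral {p..q} (\<lambda>s. (b s)\<^sup>2))"
proof -
  interpret complete_finite_measure "lebesgue_on {p..q}" by (rule complete_finite_measure_interval)
  note i = borel_measurable_subinterval[OF a_meas assms(3,4)] borel_measurable_subinterval[OF assms(1,3,4)]
    integrable_unit_time_imp(1)[OF a_sq_integrable assms(3,4)] integrable_unit_time_imp(1)[OF assms(2-4)]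
  show int: "integrable (lebesgue_on {p..q}) (\<lambda>s. a s * b s)" by (rule integrable_mult_L2(1)[OF i])
  have eq: "integral\<^sup>L (lebesgue_on {p..q}) f = integral {p..q} f" if "integrable (lebesgue_on {p..q}) f" for f :: "real \<Rightarrow> real"
    by (rule lebesgue_integral_eq_integral[OF that]) simp
  have "integral {p..q} (\<lambda>s. (a s)\<^sup>2) \<le> integral {0..1} (\<lambda>s. (a s)\<^sup>2)"
    using assms(3,4) integrable_unit_time_imp(2)[OF a_sq_integrable]
    by (intro integral_subset_le) auto
  also have "\<dots> = (\<integral>s. (a s)\<^sup>2 \<partial>unit_time)"
    by (rule lebesgue_integral_eq_integral[OF a_sq_integrable, symmetric]) simp
  finally have "sqrt (integral {p..q} (\<lambda>s. (a s)\<^sup>2)) \<le> sqrt (A\<^sup>2)"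
    using a_sq_le by (intro real_sqrt_le_mono) simp
  then have "sqrt (integral {p..q} (\<lambda>s. (a s)\<^sup>2)) \<le> A" using A_pos by simp
  moreover have "0 \<le> sqrt (integral {p..q} (\<lambda>s. (b s)\<^sup>2))"
    using i(4) by (simp flip: eq)
  ultimately have "sqrt (integral {p..q} (\<lambda>s. (a s)\<^sup>2)) * sqrt (integral {p..q} (\<lambda>s. (b s)\<^sup>2)) \<le> A * sqrt (integral {p..q} (\<lambda>s. (b s)\<^sup>2))"
    by (rule mult_right_mono)
  then show "integral {p..q} (\<lambda>s. a s * b s) \<le> A * sqrt (integral {p..q} (\<lambda>s. (b s)\<^sup>2))"
    using integrable_mult_L2(2)[OF i] unfolding eq[OF int] eq[OF i(3)] eq[OF i(4)] by linarith
qed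

text \<open>The rate \<open>2 * A\<^sup>2\<close> is chosen so that Cauchy-Schwarz yields the
  contraction factor \<open>A * sqrt (1 / (4 * A\<^sup>2)) = 1/2\<close>.\<close>

definition wt :: "real \<Rightarrow> real \<Rightarrow> real" where
  "wt t0 t = exp (2 * A\<^sup>2 * \<bar>t - t0\<bar>)"

lemma wt_pos: "0 < wt t0 t" and wt_ge_one: "1 \<le> wt t0 t" and wt_self: "wt t0 t0 = 1"
  by (auto simp: wt_def)

lemma wt_le: "t \<in> {0..1} \<Longrightarrow> t0 \<in> {0..1} \<Longrightarrow> wt t0 t \<le> exp (2 * A\<^sup>2)"
  unfolding wt_def by (auto intro!: mult_left_le)

lemma continuous_wt: "continuous_on S (wt t0)"
  unfolding wt_def by (intro continuous_intros)

lemma bounded_by_a_integrable: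
  fixes f :: "real \<Rightarrow> 'c::euclidean_space"
  assumes f: "f \<in> borel_measurable unit_time" and b: "continuous_on {0..1} b"
    and le: "\<And>s. s \<in> {0..1} \<Longrightarrow> norm (f s) \<le> a s * b s"
  shows "integrable unit_time f"
proof (rule Bochner_Integration.integrable_bound[OF _ f])
  have "continuous_on {0..1} (\<lambda>s. (b s)\<^sup>2)" using b by (intro continuous_intros)
  then have "integrable unit_time (\<lambda>s. (b s)\<^sup>2)" by (rule continuous_imp_integrable_real)
  then show "integrable unit_time (\<lambda>s. a s * b s)"
    by (intro a_mult_integrable(1)[OF borel_measurable_continuous_unit_time[OF b]]) auto
  show "AE x in unit_time. norm (f x) \<le> norm (a x * b x)"
    by (rule AE_I2) (use le in \<open>force intro: order_trans[OF _ abs_ge_self]\<close>)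
qed

text \<open>The integral operator is a contraction for Bielecki's weighted norm.\<close>

lemma weighted_integral_bound:
  fixes f :: "real \<Rightarrow> 'c::euclidean_space"
  assumes f: "f \<in> borel_measurable unit_time" and W: "0 \<le> W"
    and le: "\<And>s. s \<in> {0..1} \<Longrightarrow> norm (f s) \<le> a s * (W * wt t0 s)"
    and t: "t \<in> {0..1}" "t0 \<in> {0..1}"
  shows "norm (integral {0..t} f - integral {0..t0} f) \<le> W * wt t0 t / 2"
proof -
  define p q where "p = min t0 t" and "q = max t0 t"
  have pq: "0 \<le> p" "q \<le> 1" using t by (auto simp: p_def q_def)
  have int: "integrable unit_time f"
    by (rule bounded_by_a_integrable[OF f _ le]) (intro continuous_intros continuous_wt)
  have cw: "continuous_on {0..1} (\<lambda>s. W * wt t0 s)" by (intro continuous_intros continuous_wt)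
  have cw2: "integrable unit_time (\<lambda>s. (W * wt t0 s)\<^sup>2)"
    by (intro continuous_imp_integrable_real continuous_intros continuous_wt)
  note m = a_mult_integrable[OF borel_measurable_continuous_unit_time[OF cw] cw2 pq]
  have "norm (integral {0..t} f - integral {0..t0} f) = norm (integral {p..q} f)"
    unfolding p_def q_def using integrable_unit_time_imp(2)[OF int, of 0 1] t by (intro integral_difference_eq) auto
  also have "\<dots> \<le> integral {p..q} (\<lambda>s. a s * (W * wt t0 s))"
    using pq by (intro integral_norm_bound_integral integrable_unit_time_imp(2)[OF int] integrable_on_lebesgue_on[OF m(1)] le) auto
  also have "\<dots> \<le> A * sqrt (integral {p..q} (\<lambda>s. (W * wt t0 s)\<^sup>2))" by (rule m(2))
  also have "integral {p..q} (\<lambda>s. (W * wt t0 s)\<^sup>2) = W\<^sup>2 * integral {p..q} (\<lambda>s. (wt t0 s)\<^sup>2)"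
    by (simp add: power_mult_distrib)
  also have "A * sqrt (W\<^sup>2 * integral {p..q} (\<lambda>s. (wt t0 s)\<^sup>2)) \<le> A * sqrt (W\<^sup>2 * ((wt t0 t)\<^sup>2 / (2 * (2 * A\<^sup>2))))"
    using integral_exp_weight_le[of "2 * A\<^sup>2" t0 t] A_pos unfolding wt_def p_def q_def
    by (intro mult_left_mono real_sqrt_le_mono) auto
  also have "W\<^sup>2 * ((wt t0 t)\<^sup>2 / (2 * (2 * A\<^sup>2))) = (W * wt t0 t / (2 * A))\<^sup>2"
    by (simp add: power_mult_distrib power_divide)
  also have "A * sqrt ((W * wt t0 t / (2 * A))\<^sup>2) = W * wt t0 t / 2"
    using A_pos W wt_pos[of t0 t] by (simp add: real_sqrt_abs)
  finally show ?thesis .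
qed

text \<open>At a maximum of \<open>w / wt t0\<close> the weighted bound absorbs half of the
  left-hand side, whence the factor \<open>2\<close>. Returning from the weighted to the plain bound
  costs at most the largest weight, \<open>exp (2 * A\<^sup>2)\<close>.\<close>

lemma Gronwall:
  fixes f :: "real \<Rightarrow> 'c::euclidean_space" and w :: "real \<Rightarrow> real"
  assumes f: "f \<in> borel_measurable unit_time" and w: "continuous_on {0..1} w"
    and w0: "\<And>s. s \<in> {0..1} \<Longrightarrow> 0 \<le> w s"
    and le: "\<And>s. s \<in> {0..1} \<Longrightarrow> norm (f s) \<le> a s * w s"
    and t0: "t0 \<in> {0..1}"
    and w_le: "\<And>s. s \<in> {0..1} \<Longrightarrow> w s \<le> \<rho> + norm (integral {0..s} f - integral {0..t0} f)"
    and t: "t \<in> {0..1}"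
  shows "w t \<le> 2 * \<rho> * exp (2 * A\<^sup>2)"
proof -
  have "continuous_on {0..1} (\<lambda>s. w s / wt t0 s)"
    using wt_pos by (intro continuous_intros w continuous_wt) (auto simp: less_imp_neq[symmetric])
  then obtain m where m: "m \<in> {0..1}" "\<And>s. s \<in> {0..1} \<Longrightarrow> w s / wt t0 s \<le> w m / wt t0 m"
    using continuous_attains_sup[of "{0..1::real}" "\<lambda>s. w s / wt t0 s"] by auto
  define W where "W = w m / wt t0 m"
  have W0: "0 \<le> W" using w0[OF m(1)] wt_pos[of t0 m] by (simp add: W_def)
  have wW: "w s \<le> W * wt t0 s" if "s \<in> {0..1}" for s
    using m(2)[OF that] wt_pos[of t0 s] by (simp add: W_def pos_divide_le_eq)
  have "norm (f s) \<le> a s * (W * wt t0 s)" if "s \<in> {0..1}" for s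
    using le[OF that] mult_left_mono[OF wW[OF that] a_nonneg[of s]] by linarith
  from weighted_integral_bound[OF f W0 this m(1) t0]
  have "w m \<le> \<rho> + W * wt t0 m / 2" using w_le[OF m(1)] by linarith
  moreover have "w m = W * wt t0 m" using wt_pos[of t0 m] by (simp add: W_def)
  ultimately have *: "W * wt t0 m \<le> 2 * \<rho>" by simp
  moreover have "W * 1 \<le> W * wt t0 m" using W0 wt_ge_one by (intro mult_left_mono) auto
  ultimately have "W \<le> 2 * \<rho>" by simp
  then have "W * wt t0 t \<le> 2 * \<rho> * exp (2 * A\<^sup>2)"
    using W0 wt_le[OF t t0] wt_pos[of t0 t] by (intro mult_mono) auto
  then show ?thesis using wW[OF t] by linarith
qed

end

locale L2_Lipschitz_field = L2_coefficient a A for a A +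
  fixes u :: "real \<Rightarrow> 'a::euclidean_space \<Rightarrow> 'a"
  assumes u_meas: "continuous_on {0..1} \<gamma> \<Longrightarrow> (\<lambda>s. u s (\<gamma> s)) \<in> borel_measurable unit_time"
    and u_bound: "norm (u s x) \<le> a s"
    and u_Lip: "norm (u s x - u s y) \<le> a s * norm (x - y)"
begin

definition solution :: "(real \<Rightarrow> 'a) \<Rightarrow> bool" where
  "solution \<gamma> \<longleftrightarrow> continuous_on {0..1} \<gamma> \<and> (\<forall>t\<in>{0..1}. \<gamma> t = \<gamma> 0 + integral {0..t} (\<lambda>s. u s (\<gamma> s)))"

lemma u_integrable: "continuous_on {0..1} \<gamma> \<Longrightarrow> integrable unit_time (\<lambda>s. u s (\<gamma> s))"
  by (rule bounded_by_a_integrable[of _ "\<lambda>_. 1"]) (use u_meas u_bound in auto)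

lemma u_integrable_on: "continuous_on {0..1} \<gamma> \<Longrightarrow> t \<le> 1 \<Longrightarrow> (\<lambda>s. u s (\<gamma> s)) integrable_on {0..t}"
  by (rule integrable_unit_time_imp(2)[OF u_integrable]) auto

lemma integral_u_diff:
  assumes "continuous_on {0..1} \<gamma>" "continuous_on {0..1} \<eta>" "t \<le> 1"
  shows "integral {0..t} (\<lambda>s. u s (\<gamma> s) - u s (\<eta> s)) = integral {0..t} (\<lambda>s. u s (\<gamma> s)) - integral {0..t} (\<lambda>s. u s (\<eta> s))"
  using assms by (intro Henstock_Kurzweil_Integration.integral_diff u_integrable_on)

text \<open>The base time is free: \<open>t0 = 0\<close> gives Lipschitz dependence on initial
  values, \<open>t0 = 1\<close> the same for the inverse flow, and agreement at any one time gives
  uniqueness.\<close>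

lemma solutions_close:
  assumes \<gamma>: "solution \<gamma>" and \<eta>: "solution \<eta>" and t: "t \<in> {0..1}" "t0 \<in> {0..1}"
  shows "norm (\<gamma> t - \<eta> t) \<le> 2 * norm (\<gamma> t0 - \<eta> t0) * exp (2 * A\<^sup>2)"
proof (rule Gronwall[where f="\<lambda>s. u s (\<gamma> s) - u s (\<eta> s)" and w="\<lambda>s. norm (\<gamma> s - \<eta> s)", OF _ _ _ _ t(2) _ t(1)])
  have c: "continuous_on {0..1} \<gamma>" "continuous_on {0..1} \<eta>" using \<gamma> \<eta> by (auto simp: solution_def)
  show "(\<lambda>s. u s (\<gamma> s) - u s (\<eta> s)) \<in> borel_measurable unit_time"
    using u_meas[OF c(1)] u_meas[OF c(2)] by measurable
  show "continuous_on {0..1} (\<lambda>s. norm (\<gamma> s - \<eta> s))" by (intro continuous_intros c)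
  fix s :: real assume s: "s \<in> {0..1}"
  show "0 \<le> norm (\<gamma> s - \<eta> s)" by simp
  show "norm (u s (\<gamma> s) - u s (\<eta> s)) \<le> a s * norm (\<gamma> s - \<eta> s)" by (rule u_Lip)
  have eq: "\<gamma> r - \<eta> r = (\<gamma> 0 - \<eta> 0) + integral {0..r} (\<lambda>s. u s (\<gamma> s) - u s (\<eta> s))" if "r \<in> {0..1}" for r
  proof -
    have "\<gamma> r = \<gamma> 0 + integral {0..r} (\<lambda>s. u s (\<gamma> s))" "\<eta> r = \<eta> 0 + integral {0..r} (\<lambda>s. u s (\<eta> s))"
      using \<gamma> \<eta> that unfolding solution_def by blast+
    then show ?thesis using integral_u_diff[OF c, of r] that by simp
  qed
  have d: "\<gamma> s - \<eta> s = (\<gamma> t0 - \<eta> t0) + (integral {0..s} (\<lambda>s. u s (\<gamma> s) - u s (\<eta> s)) - integral {0..t0} (\<lambda>s. u s (\<gamma> s) - u s (\<eta> s)))"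
    unfolding eq[OF s] eq[OF t(2)] by simp
  show "norm (\<gamma> s - \<eta> s) \<le> norm (\<gamma> t0 - \<eta> t0)
      + norm (integral {0..s} (\<lambda>s. u s (\<gamma> s) - u s (\<eta> s)) - integral {0..t0} (\<lambda>s. u s (\<gamma> s) - u s (\<eta> s)))"
    unfolding d by (rule norm_triangle_ineq)
qed

text \<open>Banach's fixed point theorem for the unknown \<open>h\<close>, the trajectory divided by
  \<open>wt t0\<close>. In the sup norm of \<open>h\<close> the operator contracts by
  \<open>1/2\<close>, so the whole time interval is covered at once.\<close>

lemma solution_exists:
  assumes t0: "t0 \<in> {0..1}"
  shows "\<exists>\<gamma>. solution \<gamma> \<and> \<gamma> t0 = x"
proof -
  \<comment> \<open>The complete space used consists of bounded continuous functions on the whole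
    line, so times outside \<open>{0..1}\<close> are clamped to the endpoints.\<close>
  define c where "c t = max 0 (min 1 t)" for t :: real
  have c01: "c t \<in> {0..1}" for t by (auto simp: c_def)
  have c_id: "c t = t" if "t \<in> {0..1}" for t using that by (auto simp: c_def)
  have c_cont: "continuous_on UNIV c" unfolding c_def by (intro continuous_intros)
  define G where "G h s = wt t0 s *\<^sub>R apply_bcontfun h s" for h :: "real \<Rightarrow>\<^sub>C 'a" and s
  have G_cont: "continuous_on {0..1} (G h)" for h
    unfolding G_def by (intro continuous_intros continuous_wt continuous_on_apply_bcontfun)
  define I where "I h t = integral {0..t} (\<lambda>s. u s (G h s))" for h t
  have I_cont: "continuous_on {0..1} (I h)" for h
    unfolding I_def by (rule indefinite_integral_continuous_1[OF u_integrable_on[OF G_cont]]) simp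
  define q where "q h t = (1 / wt t0 t) *\<^sub>R (x + (I h t - I h t0))" for h t
  have q_cont: "continuous_on {0..1} (q h)" for h
    unfolding q_def using wt_pos by (intro continuous_intros continuous_wt I_cont) (auto simp: less_imp_neq[symmetric])
  have qc: "(\<lambda>t. q h (c t)) \<in> bcontfun" for h
  proof -
    have "continuous_on UNIV (\<lambda>t. q h (c t))"
      by (rule continuous_on_compose2[OF q_cont c_cont]) (use c01 in auto)
    moreover have "bounded (range (\<lambda>t. q h (c t)))"
      by (rule bounded_subset[OF compact_imp_bounded[OF compact_continuous_image[OF q_cont compact_Icc]]])
        (use c01 in blast)
    ultimately show ?thesis by (simp add: bcontfun_def)
  qed
  define Q where "Q h = Bcontfun (\<lambda>t. q h (c t))" for h
  have Q: "apply_bcontfun (Q h) t = q h (c t)" for h t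
    unfolding Q_def by (simp add: Bcontfun_inverse[OF qc])
  have "dist (Q h) (Q k) \<le> 1/2 * dist h k" for h k
  proof (rule dist_bound)
    fix t
    have "norm (integral {0..c t} (\<lambda>s. u s (G h s) - u s (G k s)) - integral {0..t0} (\<lambda>s. u s (G h s) - u s (G k s)))
        \<le> dist h k * wt t0 (c t) / 2"
    proof (rule weighted_integral_bound[OF _ _ _ c01 t0])
      show "(\<lambda>s. u s (G h s) - u s (G k s)) \<in> borel_measurable unit_time"
        using u_meas[OF G_cont[of h]] u_meas[OF G_cont[of k]] by measurable
      fix s
      have "norm (u s (G h s) - u s (G k s)) \<le> a s * norm (G h s - G k s)" by (rule u_Lip)
      also have "norm (G h s - G k s) = wt t0 s * dist (apply_bcontfun h s) (apply_bcontfun k s)"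
        using wt_pos[of t0 s] by (simp add: G_def dist_norm flip: scaleR_diff_right)
      also have "a s * \<dots> \<le> a s * (wt t0 s * dist h k)"
        using wt_pos[of t0 s] by (intro mult_left_mono dist_bounded a_nonneg) auto
      finally show "norm (u s (G h s) - u s (G k s)) \<le> a s * (dist h k * wt t0 s)" by (simp add: mult.commute)
    qed simp
    then have "norm ((I h (c t) - I h t0) - (I k (c t) - I k t0)) \<le> dist h k * wt t0 (c t) / 2"
      using c01[of t] t0 by (simp add: I_def integral_u_diff[OF G_cont G_cont] algebra_simps)
    moreover have "q h (c t) - q k (c t) = (1 / wt t0 (c t)) *\<^sub>R ((I h (c t) - I h t0) - (I k (c t) - I k t0))"
      by (simp add: q_def algebra_simps)
    ultimately show "dist (apply_bcontfun (Q h) t) (apply_bcontfun (Q k) t) \<le> 1/2 * dist h k"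
      using wt_pos[of t0 "c t"] by (simp add: Q dist_norm divide_le_eq mult.commute)
  qed
  then have "\<exists>!h. Q h = h" by (intro banach_fix_type[of "1/2"]) auto
  then obtain h where h: "Q h = h" by blast
  have G_eq: "G h t = x + (I h t - I h t0)" if "t \<in> {0..1}" for t
  proof -
    have "apply_bcontfun h t = q h t" using Q[of h t] h c_id[OF that] by simp
    then show ?thesis using wt_pos[of t0 t] by (simp add: G_def q_def)
  qed
  have "solution (G h)"
    unfolding solution_def
  proof (intro conjI ballI G_cont)
    fix t :: real assume t: "t \<in> {0..1}"
    have "I h 0 = 0" by (simp add: I_def)
    then show "G h t = G h 0 + integral {0..t} (\<lambda>s. u s (G h s))"
      using G_eq[OF t] G_eq[of 0] by (simp add: I_def)
  qed
  moreover have "G h t0 = x" using G_eq[OF t0] by simp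
  ultimately show ?thesis by blast
qed

text \<open>\<open>\<gamma> t - \<eta> t = F t + r t\<close>, where \<open>F\<close> integrates the
  difference of the field along the two curves. Gronwall's inequality is applied to the norm of
  \<open>F\<close>, so that the defect \<open>r\<close> enters through its \<open>L\<^sup>2\<close>
  norm and its value at \<open>t\<close>; both are within reach of pointwise convergence with a
  uniform bound.\<close>

lemma solution_perturbed:
  assumes \<gamma>: "solution \<gamma>" and \<eta>: "continuous_on {0..1} \<eta>" and f: "integrable unit_time f"
    and eq: "\<And>t. t \<in> {0..1} \<Longrightarrow> \<eta> t = \<gamma> 0 + integral {0..t} f"
    and t: "t \<in> {0..1}"
  defines "r \<equiv> \<lambda>t. integral {0..t} (\<lambda>s. u s (\<eta> s)) - integral {0..t} f"
  shows "norm (\<gamma> t - \<eta> t) \<le> 2 * (A * sqrt (integral {0..1} (\<lambda>s. (norm (r s))\<^sup>2))) * exp (2 * A\<^sup>2) + norm (r t)"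
proof -
  have \<gamma>c: "continuous_on {0..1} \<gamma>" using \<gamma> by (simp add: solution_def)
  define F where "F t = integral {0..t} (\<lambda>s. u s (\<gamma> s) - u s (\<eta> s))" for t
  have dint: "integrable unit_time (\<lambda>s. u s (\<gamma> s) - u s (\<eta> s))"
    using u_integrable[OF \<gamma>c] u_integrable[OF \<eta>] by simp
  have F_cont: "continuous_on {0..1} F"
    unfolding F_def by (rule indefinite_integral_continuous_1[OF integrable_unit_time_imp(2)[OF dint]]) auto
  have r_cont: "continuous_on {0..1} r"
    unfolding r_def
    by (intro continuous_intros indefinite_integral_continuous_1 u_integrable_on[OF \<eta>] integrable_unit_time_imp(2)[OF f]) auto
  have split: "\<gamma> s - \<eta> s = F s + r s" if "s \<in> {0..1}" for s
  proof -
    have "\<gamma> s = \<gamma> 0 + integral {0..s} (\<lambda>s. u s (\<gamma> s))" using \<gamma> that unfolding solution_def by blast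
    then show ?thesis using eq[OF that] integral_u_diff[OF \<gamma>c \<eta>, of s] that by (simp add: F_def r_def)
  qed
  define \<rho> where "\<rho> = A * sqrt (integral {0..1} (\<lambda>s. (norm (r s))\<^sup>2))"
  have cF: "continuous_on {0..1} (\<lambda>s. norm (F s))" and cr: "continuous_on {0..1} (\<lambda>s. norm (r s))"
    by (intro continuous_intros F_cont r_cont)+
  have sF: "integrable unit_time (\<lambda>s. (norm (F s))\<^sup>2)" and sr: "integrable unit_time (\<lambda>s. (norm (r s))\<^sup>2)"
    by (intro continuous_imp_integrable_real continuous_intros F_cont r_cont)+
  note aF = a_mult_integrable[OF borel_measurable_continuous_unit_time[OF cF] sF]
  note ar = a_mult_integrable[OF borel_measurable_continuous_unit_time[OF cr] sr]
  have "norm (F t) \<le> 2 * \<rho> * exp (2 * A\<^sup>2)"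
  proof (rule Gronwall[where f="\<lambda>s. a s * norm (F s)" and ?t0.0=0, OF _ cF _ _ _ _ t])
    show "(\<lambda>s. a s * norm (F s)) \<in> borel_measurable unit_time"
      using aF(1)[of 0 1] by simp
    fix s :: real assume s: "s \<in> {0..1}"
    show "norm (a s * norm (F s)) \<le> a s * norm (F s)" using a_nonneg[of s] by (simp add: abs_mult)
    have i1: "(\<lambda>s. a s * norm (F s)) integrable_on {0..s}" and i2: "(\<lambda>s. a s * norm (r s)) integrable_on {0..s}"
      using s by (auto intro!: integrable_on_lebesgue_on[OF aF(1)] integrable_on_lebesgue_on[OF ar(1)])
    have "norm (F s) \<le> integral {0..s} (\<lambda>s. a s * norm (F s) + a s * norm (r s))"
      unfolding F_def
    proof (rule integral_norm_bound_integral[OF integrable_unit_time_imp(2)[OF dint]])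
      fix z assume z: "z \<in> {0..s}"
      have "norm (u z (\<gamma> z) - u z (\<eta> z)) \<le> a z * norm (\<gamma> z - \<eta> z)" by (rule u_Lip)
      also have "\<gamma> z - \<eta> z = F z + r z" using z s by (intro split) auto
      also have "a z * norm (F z + r z) \<le> a z * (norm (F z) + norm (r z))"
        by (intro mult_left_mono norm_triangle_ineq a_nonneg)
      finally show "norm (u z (\<gamma> z) - u z (\<eta> z)) \<le> a z * norm (integral {0..z} (\<lambda>s. u s (\<gamma> s) - u s (\<eta> s))) + a z * norm (r z)"
        by (simp add: F_def distrib_left)
    qed (use s i1 i2 in \<open>auto simp: F_def intro!: Henstock_Kurzweil_Integration.integrable_add\<close>)
    also have "\<dots> = integral {0..s} (\<lambda>s. a s * norm (F s)) + integral {0..s} (\<lambda>s. a s * norm (r s))"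
      by (rule Henstock_Kurzweil_Integration.integral_add[OF i1 i2])
    also have "integral {0..s} (\<lambda>s. a s * norm (r s)) \<le> A * sqrt (integral {0..s} (\<lambda>s. (norm (r s))\<^sup>2))"
      using s by (intro ar(2)) auto
    also have "\<dots> \<le> \<rho>"
      unfolding \<rho>_def using s A_pos
      by (intro mult_left_mono real_sqrt_le_mono integral_subset_le integrable_unit_time_imp(2)[OF sr]) auto
    also have "integral {0..s} (\<lambda>s. a s * norm (F s)) + \<rho>
      \<le> \<rho> + norm (integral {0..s} (\<lambda>s. a s * norm (F s)) - integral {0..0} (\<lambda>s. a s * norm (F s)))"
      by simp
    finally show "norm (F s) \<le> \<rho> + norm (integral {0..s} (\<lambda>s. a s * norm (F s)) - integral {0..0} (\<lambda>s. a s * norm (F s)))"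
      by simp
  qed auto
  then show ?thesis using norm_triangle_ineq[of "F t" "r t"] by (simp add: split[OF t] \<rho>_def)
qed

end

section \<open>Flows of square integrable velocities\<close>

lemma is_flow_mem: "is_flow \<Omega> u \<phi> \<Longrightarrow> x \<in> \<Omega> \<Longrightarrow> t \<in> {0..1} \<Longrightarrow> \<phi> t x \<in> \<Omega>"
  unfolding is_flow_def by blast

locale velocity_fields =
  fixes \<Omega> :: "'a::euclidean_space set" and \<iota> :: "'v::real_normed_vector \<Rightarrow> 'a \<Rightarrow> 'a" and C :: real
  assumes open_\<Omega>: "open \<Omega>"
    and \<iota>_outside: "x \<notin> \<Omega> \<Longrightarrow> \<iota> v x = 0"
    and \<iota>_add: "\<iota> (v + w) x = \<iota> v x + \<iota> w x" and \<iota>_scaleR: "\<iota> (c *\<^sub>R v) x = c *\<^sub>R \<iota> v x"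
    and C_pos: "0 < C"
    and \<iota>_bound: "norm (\<iota> v x) \<le> C * norm v"
    and \<iota>_Lip: "norm (\<iota> v x - \<iota> v y) \<le> C * norm v * norm (x - y)"
begin

lemma \<iota>_diff: "\<iota> (v - w) x = \<iota> v x - \<iota> w x"
  using \<iota>_add[of v "- 1 *\<^sub>R w" x] \<iota>_scaleR[of "-1" w x] by simp

lemma continuous_\<iota>: "continuous_on S (\<iota> v)"
proof (rule continuous_on_subset[OF lipschitz_on_continuous_on subset_UNIV])
  show "(C * norm v)-lipschitz_on UNIV (\<iota> v)"
    using \<iota>_Lip C_pos by (intro lipschitz_onI) (auto simp: dist_norm)
qed

lemma continuous_\<iota>_velocity: "continuous_on S (\<lambda>v. \<iota> v x)"
proof (rule continuous_on_subset[OF lipschitz_on_continuous_on subset_UNIV])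
  show "C-lipschitz_on UNIV (\<lambda>v. \<iota> v x)"
    using \<iota>_bound C_pos by (intro lipschitz_onI) (auto simp: dist_norm simp flip: \<iota>_diff)
qed

definition energy :: "(real \<Rightarrow> 'v) \<Rightarrow> real" where
  "energy v = (\<integral>s. (norm (v s))\<^sup>2 \<partial>unit_time)"

lemma field_measurable:
  assumes v: "strongly_measurable unit_time v" and \<gamma>: "continuous_on {0..1} \<gamma>"
  shows "(\<lambda>s. \<iota> (v s) (\<gamma> s)) \<in> borel_measurable unit_time"
proof (rule unit_time.strongly_measurable_Caratheodory[OF v, of "\<lambda>s b. \<iota> b (\<gamma> s)"])
  show "(\<lambda>s. \<iota> b (\<gamma> s)) \<in> borel_measurable unit_time" for b
    by (rule borel_measurable_continuous_unit_time)
      (rule continuous_on_compose2[OF continuous_\<iota>[of UNIV] \<gamma>], simp)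
  show "continuous_on UNIV (\<lambda>b. \<iota> b (\<gamma> s))" for s by (rule continuous_\<iota>_velocity)
qed

text \<open>The summand \<open>1\<close> keeps the constant positive for zero velocity; a common
  energy bound \<open>B\<close> gives one constant for a whole sequence.\<close>

lemma L2_Lipschitz_field:
  assumes v: "v \<in> L2 unit_time" and B: "energy v \<le> B"
  shows "L2_Lipschitz_field (\<lambda>s. C * norm (v s)) (sqrt (C\<^sup>2 * B + 1)) (\<lambda>s. \<iota> (v s))"
proof
  have "0 \<le> energy v" by (simp add: energy_def)
  then have B0: "0 \<le> B" using B by simp
  have sm: "strongly_measurable unit_time v" by (rule unit_time.L2_strongly_measurable[OF v])
  have "(\<lambda>s. norm (v s)) \<in> borel_measurable unit_time"
    by (rule unit_time.strongly_measurable_compose[OF sm]) (rule continuous_on_norm_id)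
  then show "(\<lambda>s. C * norm (v s)) \<in> borel_measurable unit_time" by measurable
  show "integrable unit_time (\<lambda>s. (C * norm (v s))\<^sup>2)"
    using unit_time.L2_integrable[OF v] by (simp add: power_mult_distrib)
  show "(\<integral>s. (C * norm (v s))\<^sup>2 \<partial>unit_time) \<le> (sqrt (C\<^sup>2 * B + 1))\<^sup>2"
    using B B0 mult_left_mono[OF B, of "C\<^sup>2"] by (simp add: power_mult_distrib energy_def)
  have "0 < C\<^sup>2 * B + 1" using B0 by (intro add_nonneg_pos) auto
  then show "0 < sqrt (C\<^sup>2 * B + 1)" by simp
  show "0 \<le> C * norm (v s)" for s using C_pos by simp
  show "continuous_on {0..1} \<gamma> \<Longrightarrow> (\<lambda>s. \<iota> (v s) (\<gamma> s)) \<in> borel_measurable unit_time" for \<gamma>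
    by (rule field_measurable[OF sm])
  show "norm (\<iota> (v s) x) \<le> C * norm (v s)" for s x by (rule \<iota>_bound)
  show "norm (\<iota> (v s) x - \<iota> (v s) y) \<le> C * norm (v s) * norm (x - y)" for s x y by (rule \<iota>_Lip)
qed

definition Lip_const :: "real \<Rightarrow> real" where
  "Lip_const B = 2 * exp (2 * (sqrt (C\<^sup>2 * B + 1))\<^sup>2)"

lemma Lip_const_pos: "0 < Lip_const B"
  by (simp add: Lip_const_def)

lemma flow_solution:
  assumes v: "v \<in> L2 unit_time" and B: "energy v \<le> B" and \<phi>: "is_flow \<Omega> (\<lambda>t. \<iota> (v t)) \<phi>" and x: "x \<in> \<Omega>"
  shows "L2_Lipschitz_field.solution (\<lambda>s. \<iota> (v s)) (\<lambda>t. \<phi> t x)" "\<phi> 0 x = x"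
proof -
  interpret L2_Lipschitz_field "\<lambda>s. C * norm (v s)" "sqrt (C\<^sup>2 * B + 1)" "\<lambda>s. \<iota> (v s)"
    by (rule L2_Lipschitz_field[OF v B])
  have eq: "\<phi> t x = x + integral {0..t} (\<lambda>s. \<iota> (v s) (\<phi> s x))" if "t \<in> {0..1}" for t
    using \<phi> x that unfolding is_flow_def by blast
  have "(\<lambda>s. \<iota> (v s) (\<phi> s x)) absolutely_integrable_on {0..1}"
    using \<phi> x unfolding is_flow_def by simp
  then have "continuous_on {0..1} (\<lambda>t. x + integral {0..t} (\<lambda>s. \<iota> (v s) (\<phi> s x)))"
    by (intro continuous_intros indefinite_integral_continuous_1 set_lebesgue_integral_eq_integral(1))
  then have cont: "continuous_on {0..1} (\<lambda>t. \<phi> t x)"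
    by (rule continuous_on_cong[THEN iffD1, rotated 2]) (simp_all add: eq)
  show "\<phi> 0 x = x" using eq[of 0] by simp
  then show "solution (\<lambda>t. \<phi> t x)" unfolding solution_def using cont eq by simp
qed

text \<open>Points outside \<open>\<Omega>\<close> are stationary, so by uniqueness no trajectory enters or leaves \<open>\<Omega>\<close>.\<close>

lemma solution_stays:
  assumes v: "v \<in> L2 unit_time" and \<gamma>: "L2_Lipschitz_field.solution (\<lambda>s. \<iota> (v s)) \<gamma>"
    and t: "t \<in> {0..1}" "t' \<in> {0..1}" "\<gamma> t \<in> \<Omega>"
  shows "\<gamma> t' \<in> \<Omega>"
proof (rule ccontr)
  assume out: "\<gamma> t' \<notin> \<Omega>"
  interpret L2_Lipschitz_field "\<lambda>s. C * norm (v s)" "sqrt (C\<^sup>2 * energy v + 1)" "\<lambda>s. \<iota> (v s)"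
    by (rule L2_Lipschitz_field[OF v order_refl])
  have "solution (\<lambda>_. \<gamma> t')" unfolding solution_def using \<iota>_outside[OF out] by simp
  from solutions_close[OF \<gamma> this t(1,2)] have "\<gamma> t = \<gamma> t'" by simp
  then show False using t(3) out by simp
qed

lemma flow_is_flow:
  assumes v: "v \<in> L2 unit_time"
  shows "is_flow \<Omega> (\<lambda>t. \<iota> (v t)) (flow \<Omega> \<iota> v)"
proof -
  interpret L2_Lipschitz_field "\<lambda>s. C * norm (v s)" "sqrt (C\<^sup>2 * energy v + 1)" "\<lambda>s. \<iota> (v s)"
    by (rule L2_Lipschitz_field[OF v order_refl])
  have "\<forall>x. \<exists>\<gamma>. solution \<gamma> \<and> \<gamma> 0 = x" using solution_exists[of 0] by simp
  from choice[OF this] obtain \<gamma> where \<gamma>: "\<And>x. solution (\<gamma> x)" "\<And>x. \<gamma> x 0 = x" by blast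
  have "is_flow \<Omega> (\<lambda>t. \<iota> (v t)) (\<lambda>t x. \<gamma> x t)"
    unfolding is_flow_def
  proof (intro ballI conjI)
    fix x and t :: real assume x: "x \<in> \<Omega>" and t: "t \<in> {0..1}"
    show "\<gamma> x t \<in> \<Omega>" by (rule solution_stays[OF v \<gamma>(1), of 0]) (use x t \<gamma>(2) in auto)
    have c: "continuous_on {0..1} (\<gamma> x)" using \<gamma>(1)[of x] by (simp add: solution_def)
    show "(\<lambda>s. \<iota> (v s) (\<gamma> x s)) absolutely_integrable_on {0..t}"
      by (rule integrable_unit_time_imp(3)[OF u_integrable[OF c]]) (use t in auto)
    show "\<gamma> x t = x + integral {0..t} (\<lambda>s. \<iota> (v s) (\<gamma> x s))"
      using \<gamma>(1)[of x] t unfolding solution_def \<gamma>(2) by blast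
  qed
  then show ?thesis unfolding flow_def by (rule someI[of "is_flow \<Omega> (\<lambda>t. \<iota> (v t))"])
qed

lemma flow_Lipschitz:
  assumes v: "v \<in> L2 unit_time" and B: "energy v \<le> B" and x: "x \<in> \<Omega>" "y \<in> \<Omega>"
  shows "norm (flow \<Omega> \<iota> v 1 x - flow \<Omega> \<iota> v 1 y) \<le> Lip_const B * norm (x - y)"
    "norm (x - y) \<le> Lip_const B * norm (flow \<Omega> \<iota> v 1 x - flow \<Omega> \<iota> v 1 y)"
proof -
  interpret L2_Lipschitz_field "\<lambda>s. C * norm (v s)" "sqrt (C\<^sup>2 * B + 1)" "\<lambda>s. \<iota> (v s)"
    by (rule L2_Lipschitz_field[OF v B])
  note fx = flow_solution[OF v B flow_is_flow[OF v] x(1)] and fy = flow_solution[OF v B flow_is_flow[OF v] x(2)]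
  show "norm (flow \<Omega> \<iota> v 1 x - flow \<Omega> \<iota> v 1 y) \<le> Lip_const B * norm (x - y)"
    using solutions_close[OF fx(1) fy(1), of 1 0] by (simp add: fx(2) fy(2) Lip_const_def mult_ac)
  show "norm (x - y) \<le> Lip_const B * norm (flow \<Omega> \<iota> v 1 x - flow \<Omega> \<iota> v 1 y)"
    using solutions_close[OF fx(1) fy(1), of 0 1] by (simp add: fx(2) fy(2) Lip_const_def mult_ac)
qed

text \<open>For surjectivity the equation is solved backwards from time \<open>1\<close>, and
  uniqueness identifies the result with the flow. Injectivity is the lower Lipschitz bound.\<close>

lemma flow_bij:
  assumes v: "v \<in> L2 unit_time"
  shows "bij_betw (flow \<Omega> \<iota> v 1) \<Omega> \<Omega>"
  unfolding bij_betw_def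
proof
  show "inj_on (flow \<Omega> \<iota> v 1) \<Omega>"
    using flow_Lipschitz(2)[OF v order_refl] by (force intro: inj_onI)
  interpret L2_Lipschitz_field "\<lambda>s. C * norm (v s)" "sqrt (C\<^sup>2 * energy v + 1)" "\<lambda>s. \<iota> (v s)"
    by (rule L2_Lipschitz_field[OF v order_refl])
  show "flow \<Omega> \<iota> v 1 ` \<Omega> = \<Omega>"
  proof
    show "flow \<Omega> \<iota> v 1 ` \<Omega> \<subseteq> \<Omega>"
    proof (rule image_subsetI)
      fix x assume "x \<in> \<Omega>"
      then show "flow \<Omega> \<iota> v 1 x \<in> \<Omega>" by (rule is_flow_mem[OF flow_is_flow[OF v]]) simp
    qed
    show "\<Omega> \<subseteq> flow \<Omega> \<iota> v 1 ` \<Omega>"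
    proof
      fix y assume y: "y \<in> \<Omega>"
      obtain \<gamma> where \<gamma>: "solution \<gamma>" "\<gamma> 1 = y" using solution_exists[of 1 y] by auto
      have x: "\<gamma> 0 \<in> \<Omega>" by (rule solution_stays[OF v \<gamma>(1), of 1]) (use \<gamma>(2) y in auto)
      note f = flow_solution[OF v order_refl flow_is_flow[OF v] x]
      have "norm (flow \<Omega> \<iota> v 1 (\<gamma> 0) - \<gamma> 1) \<le> 0"
        using solutions_close[OF f(1) \<gamma>(1), of 1 0] by (simp add: f(2))
      then have "y = flow \<Omega> \<iota> v 1 (\<gamma> 0)" using \<gamma>(2) by simp
      then show "y \<in> flow \<Omega> \<iota> v 1 ` \<Omega>" using x by blast
    qed
  qed
qed

lemma field_integrable:
  assumes \<eta>: "continuous_on {0..1} \<eta>" and w: "w \<in> L2 unit_time"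
  shows "integrable unit_time (\<lambda>s. \<iota> (w s) (\<eta> s))"
  by (rule L2_Lipschitz_field.u_integrable[OF L2_Lipschitz_field[OF w order_refl] \<eta>])

lemma norm_integral_field_le:
  assumes \<eta>: "continuous_on {0..1} \<eta>" and t: "t \<in> {0..1}" and w: "w \<in> L2 unit_time"
  shows "norm (integral {0..t} (\<lambda>s. \<iota> (w s) (\<eta> s))) \<le> C * L2_norm unit_time w"
proof -
  have nw: "(\<lambda>s. norm (w s)) \<in> borel_measurable unit_time"
    by (rule unit_time.strongly_measurable_compose[OF unit_time.L2_strongly_measurable[OF w]]) (rule continuous_on_norm_id)
  note n = unit_time.integral_sq_le[OF nw unit_time.L2_integrable[OF w]]
  have i: "integrable unit_time (\<lambda>s. C * norm (w s))" using n(1) by simp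
  have "norm (integral {0..t} (\<lambda>s. \<iota> (w s) (\<eta> s))) \<le> integral {0..t} (\<lambda>s. C * norm (w s))"
    using t by (intro integral_norm_bound_integral integrable_unit_time_imp(2)[OF field_integrable[OF \<eta> w]]
        integrable_unit_time_imp(2)[OF i] \<iota>_bound) auto
  also have "\<dots> \<le> integral {0..1} (\<lambda>s. C * norm (w s))"
    using t C_pos by (intro integral_subset_le integrable_unit_time_imp(2)[OF i]) auto
  also have "\<dots> = (\<integral>s. C * norm (w s) \<partial>unit_time)"
    by (rule lebesgue_integral_eq_integral[OF i, symmetric]) simp
  also have "\<dots> \<le> C * L2_norm unit_time w"
    using n(2) C_pos by (simp add: L2_norm_def measure_restrict_space)
  finally show ?thesis .
qed

text \<open>Along a fixed curve \<open>\<eta>\<close> the displacement is linear in the velocity, so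
  weak convergence can be tested with its components.\<close>

lemma field_functional:
  assumes \<eta>: "continuous_on {0..1} \<eta>" and t: "t \<in> {0..1}"
  shows "L2_functional unit_time (\<lambda>w. integral {0..t} (\<lambda>s. \<iota> (w s) (\<eta> s)) \<bullet> b)"
proof -
  have int_on: "(\<lambda>s. \<iota> (w s) (\<eta> s)) integrable_on {0..t}" if w: "w \<in> L2 unit_time" for w
    by (rule integrable_unit_time_imp(2)[OF field_integrable[OF \<eta> w]]) (use t in auto)
  show ?thesis
    unfolding L2_functional_def
  proof (intro conjI ballI allI exI)
    fix w w' :: "real \<Rightarrow> 'v" assume w: "w \<in> L2 unit_time" "w' \<in> L2 unit_time"
    show "integral {0..t} (\<lambda>s. \<iota> (w s + w' s) (\<eta> s)) \<bullet> b
        = integral {0..t} (\<lambda>s. \<iota> (w s) (\<eta> s)) \<bullet> b + integral {0..t} (\<lambda>s. \<iota> (w' s) (\<eta> s)) \<bullet> b"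
      unfolding \<iota>_add Henstock_Kurzweil_Integration.integral_add[OF int_on[OF w(1)] int_on[OF w(2)]]
      by (rule inner_add_left)
  next
    fix c and w :: "real \<Rightarrow> 'v"
    show "integral {0..t} (\<lambda>s. \<iota> (c *\<^sub>R w s) (\<eta> s)) \<bullet> b = c * (integral {0..t} (\<lambda>s. \<iota> (w s) (\<eta> s)) \<bullet> b)"
      unfolding \<iota>_scaleR by simp
  next
    fix w :: "real \<Rightarrow> 'v" assume w: "w \<in> L2 unit_time"
    have "\<bar>integral {0..t} (\<lambda>s. \<iota> (w s) (\<eta> s)) \<bullet> b\<bar> \<le> norm (integral {0..t} (\<lambda>s. \<iota> (w s) (\<eta> s))) * norm b"
      by (rule Cauchy_Schwarz_ineq2)
    also have "\<dots> \<le> C * L2_norm unit_time w * norm b"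
      by (rule mult_right_mono[OF norm_integral_field_le[OF \<eta> t w] norm_ge_zero])
    finally show "\<bar>integral {0..t} (\<lambda>s. \<iota> (w s) (\<eta> s)) \<bullet> b\<bar> \<le> C * norm b * L2_norm unit_time w"
      by (simp add: mult_ac)
  qed
qed

text \<open>Along the limit trajectory \<open>\<eta>\<close> the defect \<open>r n\<close> tends to
  zero at each time by weak convergence and is uniformly bounded, hence tends to zero in
  \<open>L\<^sup>2\<close>. Then \<open>solution_perturbed\<close> applies to each
  \<open>vs n\<close>, with the common constant \<open>A\<close>.\<close>

lemma flow_weakly_continuous:
  assumes conv: "L2_weak_conv unit_time vs v" and B: "\<And>n. energy (vs n) \<le> B" and x: "x \<in> \<Omega>"
  shows "(\<lambda>n. flow \<Omega> \<iota> (vs n) 1 x) \<longlonglongrightarrow> flow \<Omega> \<iota> v 1 x"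
proof -
  have vs: "vs n \<in> L2 unit_time" for n using conv unfolding L2_weak_conv_def by blast
  have v: "v \<in> L2 unit_time" using conv unfolding L2_weak_conv_def by blast
  define A where "A = sqrt (C\<^sup>2 * B + 1)"
  define \<eta> where "\<eta> t = flow \<Omega> \<iota> v t x" for t
  note fv = flow_solution[OF v order_refl flow_is_flow[OF v] x]
  interpret V: L2_Lipschitz_field "\<lambda>s. C * norm (v s)" "sqrt (C\<^sup>2 * energy v + 1)" "\<lambda>s. \<iota> (v s)"
    by (rule L2_Lipschitz_field[OF v order_refl])
  have \<eta>: "continuous_on {0..1} \<eta>" using fv(1) unfolding \<eta>_def V.solution_def by simp
  define r where "r n t = integral {0..t} (\<lambda>s. \<iota> (vs n s) (\<eta> s)) - integral {0..t} (\<lambda>s. \<iota> (v s) (\<eta> s))" for n t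
  have field: "L2_Lipschitz_field (\<lambda>s. C * norm (vs n s)) A (\<lambda>s. \<iota> (vs n s))" for n
    unfolding A_def by (rule L2_Lipschitz_field[OF vs B])
  note int = field_integrable[OF \<eta> vs] and intv = field_integrable[OF \<eta> v]
  have r_cont: "continuous_on {0..1} (r n)" for n
    unfolding r_def
    by (intro continuous_intros indefinite_integral_continuous_1 integrable_unit_time_imp(2)[OF int]
        integrable_unit_time_imp(2)[OF intv]) auto
  have r_lim: "(\<lambda>n. r n t) \<longlonglongrightarrow> 0" if t: "t \<in> {0..1}" for t
  proof -
    have "(\<lambda>n. integral {0..t} (\<lambda>s. \<iota> (vs n s) (\<eta> s))) \<longlonglongrightarrow> integral {0..t} (\<lambda>s. \<iota> (v s) (\<eta> s))"
      unfolding tendsto_componentwise_iff[of _ "integral {0..t} (\<lambda>s. \<iota> (v s) (\<eta> s))"]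
    proof
      fix b :: 'a
      show "(\<lambda>n. integral {0..t} (\<lambda>s. \<iota> (vs n s) (\<eta> s)) \<bullet> b) \<longlonglongrightarrow> integral {0..t} (\<lambda>s. \<iota> (v s) (\<eta> s)) \<bullet> b"
        using conv field_functional[OF \<eta> t, of b] unfolding L2_weak_conv_def by blast
    qed
    then show ?thesis unfolding r_def by (rule LIM_zero)
  qed
  define R where "R = C * sqrt B + C * L2_norm unit_time v"
  have r_le: "norm (r n t) \<le> R" if t: "t \<in> {0..1}" for n t
  proof -
    have "L2_norm unit_time (vs n) \<le> sqrt B"
      unfolding L2_norm_def using B[of n] by (intro real_sqrt_le_mono) (simp add: energy_def)
    then have "C * L2_norm unit_time (vs n) \<le> C * sqrt B" using C_pos by simp
    then show ?thesis
      using norm_triangle_ineq4[of "integral {0..t} (\<lambda>s. \<iota> (vs n s) (\<eta> s))" "integral {0..t} (\<lambda>s. \<iota> (v s) (\<eta> s))"]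
        norm_integral_field_le[OF \<eta> t vs[of n]] norm_integral_field_le[OF \<eta> t v]
      unfolding r_def R_def by linarith
  qed
  have "(\<lambda>n. integral {0..1} (\<lambda>s. (norm (r n s))\<^sup>2)) \<longlonglongrightarrow> integral {0..1} (\<lambda>s::real. 0::real)"
  proof (rule dominated_convergence(2)[where h="\<lambda>_. R\<^sup>2"])
    show "(\<lambda>s. (norm (r n s))\<^sup>2) integrable_on {0..1}" for n
      by (intro integrable_continuous_real continuous_intros r_cont)
    show "norm ((norm (r n s))\<^sup>2) \<le> R\<^sup>2" if "s \<in> {0..1}" for n s
      using power_mono[OF r_le[OF that, of n], of 2] by simp
    show "(\<lambda>n. (norm (r n s))\<^sup>2) \<longlonglongrightarrow> 0" if "s \<in> {0..1}" for s
      using tendsto_power[OF tendsto_norm_zero[OF r_lim[OF that]], of 2] by simp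
  qed (rule integrable_const_ivl)
  then have r2: "(\<lambda>n. integral {0..1} (\<lambda>s. (norm (r n s))\<^sup>2)) \<longlonglongrightarrow> 0" by simp
  have "(\<lambda>n. 2 * (A * sqrt (integral {0..1} (\<lambda>s. (norm (r n s))\<^sup>2))) * exp (2 * A\<^sup>2) + norm (r n 1))
      \<longlonglongrightarrow> 2 * (A * sqrt 0) * exp (2 * A\<^sup>2) + norm (0 :: 'a)"
    using r_lim[of 1] by (intro tendsto_intros r2) auto
  then have lim0: "(\<lambda>n. 2 * (A * sqrt (integral {0..1} (\<lambda>s. (norm (r n s))\<^sup>2))) * exp (2 * A\<^sup>2) + norm (r n 1)) \<longlonglongrightarrow> 0"
    by simp
  have "\<forall>n. norm (flow \<Omega> \<iota> (vs n) 1 x - flow \<Omega> \<iota> v 1 x)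
      \<le> 2 * (A * sqrt (integral {0..1} (\<lambda>s. (norm (r n s))\<^sup>2))) * exp (2 * A\<^sup>2) + norm (r n 1)"
  proof
    fix n
    note fn = flow_solution[OF vs B flow_is_flow[OF vs] x, of n]
    have eq: "\<eta> t = flow \<Omega> \<iota> (vs n) 0 x + integral {0..t} (\<lambda>s. \<iota> (v s) (\<eta> s))" if "t \<in> {0..1}" for t
      using fv that unfolding fn(2) V.solution_def \<eta>_def by simp
    from L2_Lipschitz_field.solution_perturbed[OF field fn(1) \<eta> intv eq, of 1]
    show "norm (flow \<Omega> \<iota> (vs n) 1 x - flow \<Omega> \<iota> v 1 x)
      \<le> 2 * (A * sqrt (integral {0..1} (\<lambda>s. (norm (r n s))\<^sup>2))) * exp (2 * A\<^sup>2) + norm (r n 1)"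
      by (simp add: \<eta>_def r_def)
  qed
  then have "(\<lambda>n. flow \<Omega> \<iota> (vs n) 1 x - flow \<Omega> \<iota> v 1 x) \<longlonglongrightarrow> 0"
    by (rule Lim_null_comparison[OF always_eventually lim0])
  then show ?thesis by (rule LIM_zero_cancel)
qed

end

section \<open>Composition with bi-Lipschitz maps\<close>

text \<open>As in the library proof that Lipschitz images of negligible sets are negligible, cover by
  dyadic cubes inside an open superset; a cube of side \<open>h\<close> is mapped into one of side \<open>2 L d h\<close>.\<close>

lemma emeasure_Lipschitz_image_le:
  fixes f :: "'a::euclidean_space \<Rightarrow> 'a"
  assumes S: "S \<in> sets lebesgue" "bounded S" and L: "0 < L"
    and f: "\<And>x y. x \<in> S \<Longrightarrow> y \<in> S \<Longrightarrow> norm (f x - f y) \<le> L * norm (x - y)"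
    and fS: "f ` S \<in> sets lebesgue"
  shows "emeasure lebesgue (f ` S) \<le> ennreal ((2 * L * DIM('a)) ^ DIM('a)) * emeasure lebesgue S"
proof -
  define c where "c = (2 * L * DIM('a)) ^ DIM('a)"
  have c0: "0 \<le> c" using L by (simp add: c_def)
  have main: "emeasure lebesgue (f ` S) \<le> ennreal c * (emeasure lebesgue S + ennreal e)" if e: "0 < e" for e
  proof -
    obtain U where U: "open U" "S \<subseteq> U" "U - S \<in> lmeasurable" "emeasure lebesgue (U - S) < ennreal e"
      using sets_lebesgue_outer_open[OF S(1) e] .
    obtain R where R: "0 < R" "\<And>x. x \<in> S \<Longrightarrow> norm x \<le> R" using S(2) bounded_pos by blast
    define b :: 'a where "b = R *\<^sub>R One"
    have Sb: "S \<subseteq> cbox (- b) b"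
    proof
      fix x assume "x \<in> S"
      then have "\<bar>x \<bullet> i\<bar> \<le> R" if "i \<in> Basis" for i using Basis_le_norm[OF that, of x] R(2) by force
      then show "x \<in> cbox (- b) b" by (force simp: mem_box b_def abs_le_iff)
    qed
    have ne: "box (- b) b \<noteq> {}" using R(1) by (simp add: box_ne_empty b_def)
    \<comment> \<open>Each cube of the covering meets \<open>S\<close>, and at a point of
      \<open>S\<close> the gauge confines it to \<open>U\<close>; so the cubes have total measure at
      most that of \<open>S\<close> plus \<open>e\<close>.\<close>
    have g: "gauge (\<lambda>x. if x \<in> U then U else UNIV)" using U(1) by (simp add: gauge_def)
    obtain D where D: "countable D" "\<Union> D \<subseteq> cbox (- b) b"
      "\<And>K. K \<in> D \<Longrightarrow> interior K \<noteq> {} \<and> (\<exists>c d. K = cbox c d)"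
      "pairwise (\<lambda>A B. interior A \<inter> interior B = {}) D"
      "\<And>K. K \<in> D \<Longrightarrow> \<exists>x \<in> S \<inter> K. K \<subseteq> (if x \<in> U then U else UNIV)"
      "\<And>u v. cbox u v \<in> D \<Longrightarrow> \<exists>n. \<forall>i \<in> Basis. v \<bullet> i - u \<bullet> i = (b \<bullet> i - (- b) \<bullet> i) / 2^n"
      "S \<subseteq> \<Union> D"
      by (rule covering_lemma[OF Sb ne g], rule that) (assumption | blast)+
    have KU: "K \<subseteq> U" if K: "K \<in> D" for K
    proof -
      obtain x where x: "x \<in> S" "K \<subseteq> (if x \<in> U then U else UNIV)" using D(5)[OF K] by blast
      have "x \<in> U" using x(1) U(2) by blast
      then show ?thesis using x(2) by simp
    qed
    have cube: "\<exists>Q. Q \<in> sets lebesgue \<and> f ` (S \<inter> K) \<subseteq> Q \<and> emeasure lebesgue Q = ennreal c * emeasure lebesgue (interior K)" if K: "K \<in> D" for K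
    proof -
      obtain u v where uv: "K = cbox u v" using D(3)[OF K] by blast
      obtain n where n: "\<And>i. i \<in> Basis \<Longrightarrow> v \<bullet> i - u \<bullet> i = (b \<bullet> i - (- b) \<bullet> i) / 2^n"
        using D(6) K uv by blast
      define h where "h = 2 * R / 2 ^ n"
      have h: "0 < h" using R by (simp add: h_def)
      have side: "v \<bullet> i - u \<bullet> i = h" if "i \<in> Basis" for i using n[OF that] that by (simp add: b_def h_def)
      have uv_le: "u \<bullet> i \<le> v \<bullet> i" if "i \<in> Basis" for i using side[OF that] h by simp
      obtain x0 where x0: "x0 \<in> S" "x0 \<in> K" using D(5)[OF K] by blast
      \<comment> \<open>Half the side of the target cube: two points of a cube of side
        \<open>h\<close> are at most \<open>DIM('a) * h\<close> apart, and \<open>f\<close>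
        stretches this by at most \<open>L\<close>.\<close>
      define w :: 'a where "w = (L * DIM('a) * h) *\<^sub>R One"
      define Q where "Q = cbox (f x0 - w) (f x0 + w)"
      have "f x \<in> Q" if x: "x \<in> S" "x \<in> K" for x
      proof -
        have "norm (x - x0) \<le> (\<Sum>i\<in>Basis. \<bar>(x - x0) \<bullet> i\<bar>)" by (rule norm_le_l1)
        also have "\<dots> \<le> (\<Sum>i\<in>(Basis :: 'a set). h)"
        proof (rule sum_mono)
          fix i :: 'a assume i: "i \<in> Basis"
          have "u \<bullet> i \<le> x \<bullet> i" "x \<bullet> i \<le> v \<bullet> i" "u \<bullet> i \<le> x0 \<bullet> i" "x0 \<bullet> i \<le> v \<bullet> i"
            using x(2) x0(2) i unfolding uv mem_box by auto
          then show "\<bar>(x - x0) \<bullet> i\<bar> \<le> h" using side[OF i] by (simp add: inner_diff_left abs_le_iff)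
        qed
        finally have "norm (x - x0) \<le> DIM('a) * h" by simp
        then have "L * norm (x - x0) \<le> L * (DIM('a) * h)" using L by (intro mult_left_mono) auto
        then have fx: "norm (f x - f x0) \<le> L * DIM('a) * h" using f[OF x(1) x0(1)] by (simp add: mult_ac)
        have "\<bar>(f x - f x0) \<bullet> i\<bar> \<le> L * DIM('a) * h" if "i \<in> Basis" for i
          using Basis_le_norm[OF that, of "f x - f x0"] fx by linarith
        then show ?thesis
          unfolding Q_def mem_box w_def by (force simp: inner_diff_left inner_add_left abs_le_iff algebra_simps)
      qed
      moreover have "emeasure lebesgue Q = ennreal c * emeasure lebesgue (interior K)"
      proof -
        have "emeasure lebesgue Q = ennreal (\<Prod>i\<in>(Basis :: 'a set). 2 * (L * DIM('a) * h))"
          unfolding Q_def w_def using L h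
          by (subst emeasure_completion) (auto simp: emeasure_lborel_cbox_eq inner_diff_left inner_add_left algebra_simps intro!: arg_cong[where f=ennreal] prod.cong)
        also have "(\<Prod>i\<in>(Basis :: 'a set). 2 * (L * DIM('a) * h)) = c * h ^ DIM('a)"
          by (simp add: c_def power_mult_distrib mult_ac)
        also have "ennreal (c * h ^ DIM('a)) = ennreal c * ennreal (h ^ DIM('a))"
          using c0 h by (intro ennreal_mult) auto
        also have "ennreal (h ^ DIM('a)) = emeasure lebesgue (interior K)"
        proof -
          have "emeasure lebesgue (box u v) = ennreal (\<Prod>i\<in>(Basis :: 'a set). h)"
            using side h uv_le by (simp add: emeasure_lborel_box_eq inner_diff_left)
          then show ?thesis unfolding uv interior_cbox by simp
        qed
        finally show ?thesis .
      qed
      ultimately show ?thesis by (intro exI[of _ Q]) (auto simp: Q_def)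
    qed
    then have "\<forall>K\<in>D. \<exists>Q. Q \<in> sets lebesgue \<and> f ` (S \<inter> K) \<subseteq> Q \<and> emeasure lebesgue Q = ennreal c * emeasure lebesgue (interior K)" by blast
    from bchoice[OF this] obtain Q where Q: "\<And>K. K \<in> D \<Longrightarrow> Q K \<in> sets lebesgue" "\<And>K. K \<in> D \<Longrightarrow> f ` (S \<inter> K) \<subseteq> Q K"
      "\<And>K. K \<in> D \<Longrightarrow> emeasure lebesgue (Q K) = ennreal c * emeasure lebesgue (interior K)" by blast
    \<comment> \<open>\<open>D\<close> may be finite, so its enumeration is padded with empty sets.
      \<open>I\<close> takes interiors because only these are pairwise disjoint; they have the same
      measure as the cubes.\<close>
    define P where "P n = (if n \<in> to_nat_on D ` D then Q (from_nat_into D n) else {})" for n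
    define I where "I n = (if n \<in> to_nat_on D ` D then interior (from_nat_into D n) else {})" for n
    have mem: "from_nat_into D n \<in> D" if "n \<in> to_nat_on D ` D" for n using that D(1) by auto
    have Pm: "P n \<in> sets lebesgue" and PI: "emeasure lebesgue (P n) = ennreal c * emeasure lebesgue (I n)" for n
      using Q mem by (auto simp: P_def I_def)
    have Im: "I n \<in> sets lebesgue" for n by (auto simp: I_def)
    have "f ` S \<subseteq> (\<Union>n. P n)"
    proof
      fix y assume "y \<in> f ` S"
      then obtain x K where x: "x \<in> S" "y = f x" "K \<in> D" "x \<in> K" using D(7) by blast
      then have "y \<in> P (to_nat_on D K)" using Q(2)[of K] D(1) by (auto simp: P_def)
      then show "y \<in> (\<Union>n. P n)" by blast
    qed
    then have "emeasure lebesgue (f ` S) \<le> emeasure lebesgue (\<Union>n. P n)"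
      using Pm by (intro emeasure_mono) auto
    also have "\<dots> \<le> (\<Sum>n. emeasure lebesgue (P n))"
      using Pm by (intro emeasure_subadditive_countably) auto
    also have "\<dots> = ennreal c * (\<Sum>n. emeasure lebesgue (I n))" by (simp add: PI)
    also have "(\<Sum>n. emeasure lebesgue (I n)) = emeasure lebesgue (\<Union>n. I n)"
    proof (rule suminf_emeasure)
      show "disjoint_family I"
        unfolding disjoint_family_on_def
      proof (intro ballI impI)
        fix m n :: nat assume mn: "m \<noteq> n"
        show "I m \<inter> I n = {}"
        proof (cases "m \<in> to_nat_on D ` D \<and> n \<in> to_nat_on D ` D")
          case True
          then obtain K K' where "K \<in> D" "K' \<in> D" "m = to_nat_on D K" "n = to_nat_on D K'" by blast
          then show ?thesis using mn D(1,4) by (auto simp: I_def pairwise_def)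
        qed (auto simp: I_def)
      qed
    qed (use Im in auto)
    also have "emeasure lebesgue (\<Union>n. I n) \<le> emeasure lebesgue U"
    proof (rule emeasure_mono)
      show "(\<Union>n. I n) \<subseteq> U"
        using KU[OF mem] interior_subset by (fastforce simp: I_def split: if_splits)
    qed (use U(1) in auto)
    also have "emeasure lebesgue U = emeasure lebesgue (S \<union> (U - S))" using U(2) by (simp add: Un_absorb1)
    also have "\<dots> \<le> emeasure lebesgue S + emeasure lebesgue (U - S)"
      using S(1) U(3) by (intro emeasure_subadditive) auto
    also have "\<dots> \<le> emeasure lebesgue S + ennreal e" using U(4) by (intro add_left_mono) auto
    finally show ?thesis by (simp add: mult_left_mono)
  qed
  have fin: "emeasure lebesgue S \<noteq> top"
    by (rule fmeasurableD2[OF bounded_set_imp_lmeasurable[OF S(2,1)]])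
  obtain s where s: "emeasure lebesgue S = ennreal s" "0 \<le> s"
    using fin by (cases "emeasure lebesgue S" rule: ennreal_cases) (simp_all del: emeasure_completion)
  have "emeasure lebesgue (f ` S) \<le> ennreal (c * s)"
  proof (rule ennreal_le_epsilon)
    fix e :: real assume e: "0 < e"
    have "emeasure lebesgue (f ` S) \<le> ennreal c * (emeasure lebesgue S + ennreal (e / (c + 1)))"
      using e c0 by (intro main) auto
    also have "\<dots> = ennreal (c * s + c * (e / (c + 1)))"
      using e c0 s by (simp add: ennreal_mult[symmetric] ennreal_plus[symmetric] distrib_left del: ennreal_plus)
    also have "\<dots> \<le> ennreal (c * s + e)"
      using e c0 by (intro ennreal_leI add_left_mono) (simp add: field_simps)
    finally show "emeasure lebesgue (f ` S) \<le> ennreal (c * s) + ennreal e"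
      using e c0 s by simp
  qed
  then show ?thesis using c0 s by (simp add: c_def ennreal_mult)
qed

text \<open>Truncation at height \<open>K\<close> comes first, so that the almost everywhere
  approximation by continuous functions can be truncated too and dominated convergence applies. The
  bound on \<open>g\<close> serves dominated convergence again once \<open>g\<close> is composed
  with inverse flows.\<close>

lemma L2_lebesgue_on_bounded_continuous_dense:
  fixes T :: "'a::euclidean_space \<Rightarrow> real"
  assumes \<Omega>: "\<Omega> \<in> lmeasurable" and T: "T \<in> L2 (lebesgue_on \<Omega>)" and e: "0 < e"
  shows "\<exists>g K. continuous_on UNIV g \<and> (\<forall>x. \<bar>g x\<bar> \<le> K) \<and> (\<integral>x. (T x - g x)\<^sup>2 \<partial>lebesgue_on \<Omega>) < e"
proof -
  interpret complete_finite_measure "lebesgue_on \<Omega>" by (rule complete_finite_measure_lebesgue_on[OF \<Omega>])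
  have Tm: "T \<in> borel_measurable (lebesgue_on \<Omega>)" and Ti: "integrable (lebesgue_on \<Omega>) (\<lambda>x. (T x)\<^sup>2)"
    using T by (auto simp: L2_real_iff)
  define cl where "cl K y = max (- K) (min K y)" for K y :: real
  have cl_le: "\<bar>cl K y\<bar> \<le> K" if "0 \<le> K" for K y using that by (auto simp: cl_def)
  have cl_diff: "\<bar>y - cl K y\<bar> \<le> \<bar>y\<bar>" if "0 \<le> K" for K y using that by (auto simp: cl_def)
  have cl_cont: "continuous_on UNIV (cl K)" for K unfolding cl_def by (intro continuous_intros)
  have [measurable]: "cl K \<in> borel_measurable borel" for K by (rule borel_measurable_continuous_onI[OF cl_cont])
  note [measurable] = Tm
  have "(\<lambda>n. \<integral>x. (T x - cl (real n) (T x))\<^sup>2 \<partial>lebesgue_on \<Omega>) \<longlonglongrightarrow> (\<integral>x. 0 \<partial>lebesgue_on \<Omega>)"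
  proof (rule integral_dominated_convergence[OF _ _ Ti])
    show "AE x in lebesgue_on \<Omega>. (\<lambda>n. (T x - cl (real n) (T x))\<^sup>2) \<longlonglongrightarrow> 0"
    proof (rule AE_I2)
      fix x
      obtain N :: nat where N: "\<bar>T x\<bar> \<le> real N" using real_arch_simple by blast
      have "cl (real n) (T x) = T x" if "N \<le> n" for n
      proof -
        have "real N \<le> real n" using that by simp
        then show ?thesis using N unfolding cl_def by linarith
      qed
      then have "eventually (\<lambda>n. 0 = (T x - cl (real n) (T x))\<^sup>2) sequentially"
        unfolding eventually_sequentially by (intro exI[of _ N]) simp
      then show "(\<lambda>n. (T x - cl (real n) (T x))\<^sup>2) \<longlonglongrightarrow> 0"
        by (rule Lim_transform_eventually[OF tendsto_const])
    qed
    show "AE x in lebesgue_on \<Omega>. norm ((T x - cl (real n) (T x))\<^sup>2) \<le> (T x)\<^sup>2" for n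
      using cl_diff[of "real n"] by (intro AE_I2) (simp add: abs_le_square_iff[symmetric])
  qed simp_all
  then have "(\<lambda>n. \<integral>x. (T x - cl (real n) (T x))\<^sup>2 \<partial>lebesgue_on \<Omega>) \<longlonglongrightarrow> 0" by simp
  then have "eventually (\<lambda>n. (\<integral>x. (T x - cl (real n) (T x))\<^sup>2 \<partial>lebesgue_on \<Omega>) < e / 4) sequentially"
    using e by (intro order_tendstoD(2)) auto
  then obtain m where m: "(\<integral>x. (T x - cl (real m) (T x))\<^sup>2 \<partial>lebesgue_on \<Omega>) < e / 4"
    by (auto simp: eventually_sequentially)
  define K where "K = real m"
  have K: "0 \<le> K" by (simp add: K_def)
  have "T measurable_on \<Omega>" using Tm \<Omega> by (subst measurable_on_iff_borel_measurable) auto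
  then obtain N g where N: "negligible N" and g: "\<And>n. continuous_on UNIV (g n)"
    and glim: "\<And>x. x \<notin> N \<Longrightarrow> (\<lambda>n. g n x) \<longlonglongrightarrow> (if x \<in> \<Omega> then T x else 0)"
    unfolding measurable_on_def by blast
  have gm [measurable]: "g n \<in> borel_measurable (lebesgue_on \<Omega>)" for n
    using continuous_imp_measurable_on_sets_lebesgue[OF continuous_on_subset[OF g subset_UNIV]] \<Omega> by auto
  have "AE x in lebesgue. x \<notin> N" using N by (simp add: negligible_iff_null_sets AE_not_in)
  then have AE_N: "AE x in lebesgue_on \<Omega>. x \<notin> N" using \<Omega> by (subst AE_restrict_space_iff) auto
  have "(\<lambda>n. \<integral>x. (cl K (T x) - cl K (g n x))\<^sup>2 \<partial>lebesgue_on \<Omega>) \<longlonglongrightarrow> (\<integral>x. 0 \<partial>lebesgue_on \<Omega>)"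
  proof (rule integral_dominated_convergence[where w="\<lambda>_. (2 * K)\<^sup>2"])
    show "AE x in lebesgue_on \<Omega>. (\<lambda>n. (cl K (T x) - cl K (g n x))\<^sup>2) \<longlonglongrightarrow> 0"
      using AE_N AE_space
    proof eventually_elim
      case (elim x)
      then have "(\<lambda>n. g n x) \<longlonglongrightarrow> T x" using glim[of x] by simp
      then have "(\<lambda>n. cl K (g n x)) \<longlonglongrightarrow> cl K (T x)"
        by (intro continuous_on_tendsto_compose[OF cl_cont]) auto
      then have "(\<lambda>n. (cl K (T x) - cl K (g n x))\<^sup>2) \<longlonglongrightarrow> (cl K (T x) - cl K (T x))\<^sup>2"
        by (intro tendsto_intros)
      then show ?case by simp
    qed
    show "AE x in lebesgue_on \<Omega>. norm ((cl K (T x) - cl K (g n x))\<^sup>2) \<le> (2 * K)\<^sup>2" for n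
    proof (rule AE_I2)
      fix x
      have "\<bar>cl K (T x) - cl K (g n x)\<bar> \<le> 2 * K" using cl_le[OF K, of "T x"] cl_le[OF K, of "g n x"] by linarith
      then show "norm ((cl K (T x) - cl K (g n x))\<^sup>2) \<le> (2 * K)\<^sup>2" using power_mono[of "\<bar>cl K (T x) - cl K (g n x)\<bar>" "2 * K" 2] by simp
    qed
  qed simp_all
  then have "(\<lambda>n. \<integral>x. (cl K (T x) - cl K (g n x))\<^sup>2 \<partial>lebesgue_on \<Omega>) \<longlonglongrightarrow> 0" by simp
  then have "eventually (\<lambda>n. (\<integral>x. (cl K (T x) - cl K (g n x))\<^sup>2 \<partial>lebesgue_on \<Omega>) < e / 4) sequentially"
    using e by (intro order_tendstoD(2)) auto
  then obtain n where n: "(\<integral>x. (cl K (T x) - cl K (g n x))\<^sup>2 \<partial>lebesgue_on \<Omega>) < e / 4"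
    by (auto simp: eventually_sequentially)
  have clL2: "(\<lambda>x. cl K (h x)) \<in> L2 (lebesgue_on \<Omega>)" if [measurable]: "h \<in> borel_measurable (lebesgue_on \<Omega>)" for h
  proof (rule L2_bound[where h="\<lambda>_. K\<^sup>2"])
    show "strongly_measurable (lebesgue_on \<Omega>) (\<lambda>x. cl K (h x))" by (simp add: strongly_measurable_real_iff)
    show "AE x in lebesgue_on \<Omega>. (norm (cl K (h x)))\<^sup>2 \<le> K\<^sup>2"
      using cl_le[OF K] by (intro AE_I2 power_mono) auto
  qed simp
  have d: "(\<lambda>x. T x - cl K (T x)) \<in> L2 (lebesgue_on \<Omega>)" "(\<lambda>x. cl K (g n x) - cl K (T x)) \<in> L2 (lebesgue_on \<Omega>)"
    by (intro L2_diff T clL2 Tm gm)+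
  have "(\<integral>x. (T x - cl K (g n x))\<^sup>2 \<partial>lebesgue_on \<Omega>)
      \<le> 2 * (\<integral>x. (T x - cl K (T x))\<^sup>2 \<partial>lebesgue_on \<Omega>) + 2 * (\<integral>x. (cl K (g n x) - cl K (T x))\<^sup>2 \<partial>lebesgue_on \<Omega>)"
    using integral_norm_diff_sq_le[OF d] by simp
  also have "\<dots> < e" using m n by (simp add: K_def power2_commute[of "cl _ (g n _)"])
  finally have "(\<integral>x. (T x - cl K (g n x))\<^sup>2 \<partial>lebesgue_on \<Omega>) < e" .
  moreover have "continuous_on UNIV (\<lambda>x. cl K (g n x))"
    by (rule continuous_on_compose2[OF cl_cont g]) simp
  ultimately show ?thesis using cl_le[OF K] by (intro exI[of _ "\<lambda>x. cl K (g n x)"] exI[of _ K]) simp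
qed

text \<open>Composition with \<open>\<psi>\<close> calls for a measure bound on preimages under
  \<open>\<psi>\<close>. These are images under \<open>\<phi>\<close>, so the Lipschitz bound is
  placed on \<open>\<phi>\<close>.\<close>

locale Lipschitz_inverse =
  fixes \<Omega> :: "'a::euclidean_space set" and \<phi> :: "'a \<Rightarrow> 'a" and E :: real
  assumes open_\<Omega>: "open \<Omega>" and bounded_\<Omega>: "bounded \<Omega>" and bij: "bij_betw \<phi> \<Omega> \<Omega>" and E_pos: "0 < E"
    and Lip: "\<And>x y. x \<in> \<Omega> \<Longrightarrow> y \<in> \<Omega> \<Longrightarrow> norm (\<phi> x - \<phi> y) \<le> E * norm (x - y)"
begin

abbreviation \<psi> :: "'a \<Rightarrow> 'a" where "\<psi> \<equiv> inv_into \<Omega> \<phi>"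

definition c :: real where "c = (2 * E * DIM('a)) ^ DIM('a)"

lemma c_nonneg: "0 \<le> c"
  using E_pos by (simp add: c_def)

lemma \<Omega>_lmeasurable: "\<Omega> \<in> lmeasurable"
  using open_\<Omega> bounded_\<Omega> by (rule lmeasurable_open[rotated])

lemma \<psi>_in: "x \<in> \<Omega> \<Longrightarrow> \<psi> x \<in> \<Omega>"
  using bij by (simp add: bij_betw_def inv_into_into)

lemma \<phi>_\<psi>: "x \<in> \<Omega> \<Longrightarrow> \<phi> (\<psi> x) = x"
  using bij by (simp add: bij_betw_def f_inv_into_f)

lemma \<psi>_\<phi>: "x \<in> \<Omega> \<Longrightarrow> \<psi> (\<phi> x) = x"
  using bij by (simp add: bij_betw_def)

text \<open>A continuous map preserves Lebesgue measurability of sets if it sends null sets to null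
  sets, which the Lipschitz bound ensures.\<close>

lemma image_lebesgue:
  assumes "B \<in> sets lebesgue" "B \<subseteq> \<Omega>"
  shows "\<phi> ` B \<in> sets lebesgue"
proof (rule sets_lebesgue_continuous_image[OF assms(1) _ _ assms(2)])
  show "continuous_on \<Omega> \<phi>"
    using Lip E_pos by (intro lipschitz_on_continuous_on[of E] lipschitz_onI) (auto simp: dist_norm)
  fix N assume N: "negligible N" "N \<subseteq> \<Omega>"
  show "negligible (\<phi> ` N)"
  proof (rule negligible_locally_Lipschitz_image[OF order_refl N(1)])
    fix x assume x: "x \<in> N"
    show "\<exists>T B. open T \<and> x \<in> T \<and> (\<forall>y\<in>N \<inter> T. norm (\<phi> y - \<phi> x) \<le> B * norm (y - x))"
      using x N(2) Lip by (intro exI[of _ UNIV] exI[of _ E]) auto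
  qed
qed

lemma vimage_eq: "B \<subseteq> \<Omega> \<Longrightarrow> \<psi> -` B \<inter> \<Omega> = \<phi> ` B"
proof (intro equalityI subsetI)
  fix x assume "B \<subseteq> \<Omega>" "x \<in> \<psi> -` B \<inter> \<Omega>"
  then show "x \<in> \<phi> ` B" using \<phi>_\<psi>[of x] by (intro image_eqI[of _ _ "\<psi> x"]) auto
next
  fix x assume "B \<subseteq> \<Omega>" "x \<in> \<phi> ` B"
  then show "x \<in> \<psi> -` B \<inter> \<Omega>" using \<psi>_\<phi> bij by (auto simp: bij_betw_def)
qed

lemma \<psi>_measurable: "\<psi> \<in> measurable (lebesgue_on \<Omega>) (lebesgue_on \<Omega>)"
proof (rule measurableI)
  show "x \<in> space (lebesgue_on \<Omega>) \<Longrightarrow> \<psi> x \<in> space (lebesgue_on \<Omega>)" for x using \<psi>_in by simp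
  fix B assume "B \<in> sets (lebesgue_on \<Omega>)"
  then have B: "B \<in> sets lebesgue" "B \<subseteq> \<Omega>"
    using \<Omega>_lmeasurable by (auto simp: sets_restrict_space_iff fmeasurableD)
  show "\<psi> -` B \<inter> space (lebesgue_on \<Omega>) \<in> sets (lebesgue_on \<Omega>)"
    using image_lebesgue[OF B] vimage_eq[OF B(2)] \<Omega>_lmeasurable
    by (simp add: sets_restrict_space_iff fmeasurableD) (metis inf_le2)
qed

text \<open>The image measure under \<open>\<psi>\<close> gives \<open>B\<close> the measure of the
  image of \<open>B\<close> under \<open>\<phi>\<close>, which is at most \<open>c\<close> times
  that of \<open>B\<close>; comparing measures compares the integrals.\<close>

lemma nn_integral_comp_le:
  assumes f: "f \<in> borel_measurable (lebesgue_on \<Omega>)"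
  shows "(\<integral>\<^sup>+x. f (\<psi> x) \<partial>lebesgue_on \<Omega>) \<le> ennreal c * (\<integral>\<^sup>+x. f x \<partial>lebesgue_on \<Omega>)"
proof -
  let ?M = "lebesgue_on \<Omega>"
  have "(\<integral>\<^sup>+x. f (\<psi> x) \<partial>?M) = (\<integral>\<^sup>+x. f x \<partial>distr ?M ?M \<psi>)"
    using f by (intro nn_integral_distr[OF \<psi>_measurable, symmetric]) simp
  also have "\<dots> \<le> (\<integral>\<^sup>+x. f x \<partial>scale_measure (ennreal c) ?M)"
  proof (rule nn_integral_mono_measure)
    have "emeasure (distr ?M ?M \<psi>) \<le> emeasure (scale_measure (ennreal c) ?M)"
    proof (rule le_funI)
      fix B
      show "emeasure (distr ?M ?M \<psi>) B \<le> emeasure (scale_measure (ennreal c) ?M) B"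
      proof (cases "B \<in> sets ?M")
        case True
        then have B: "B \<in> sets lebesgue" "B \<subseteq> \<Omega>"
          using \<Omega>_lmeasurable by (auto simp: sets_restrict_space_iff fmeasurableD)
        have "emeasure (distr ?M ?M \<psi>) B = emeasure ?M (\<phi> ` B)"
          using True vimage_eq[OF B(2)] by (simp add: emeasure_distr[OF \<psi>_measurable])
        also have "\<dots> = emeasure lebesgue (\<phi> ` B)"
        proof (rule emeasure_restrict_space)
          show "\<phi> ` B \<subseteq> \<Omega>" using B(2) bij by (auto simp: bij_betw_def)
        qed (use \<Omega>_lmeasurable in auto)
        also have "\<dots> \<le> ennreal c * emeasure lebesgue B"
          unfolding c_def
        proof (rule emeasure_Lipschitz_image_le[OF B(1) bounded_subset[OF bounded_\<Omega> B(2)] E_pos _ image_lebesgue[OF B]])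
          show "norm (\<phi> x - \<phi> y) \<le> E * norm (x - y)" if "x \<in> B" "y \<in> B" for x y
            using that B(2) by (intro Lip) auto
        qed
        also have "emeasure lebesgue B = emeasure ?M B"
          using B \<Omega>_lmeasurable by (intro emeasure_restrict_space[symmetric]) auto
        finally show ?thesis by simp
      qed (simp add: emeasure_notin_sets)
    qed
    then show "distr ?M ?M \<psi> \<le> scale_measure (ennreal c) ?M"
      unfolding le_measure_iff by (simp add: space_scale_measure)
  qed simp
  also have "\<dots> = ennreal c * (\<integral>\<^sup>+x. f x \<partial>?M)" by (rule nn_integral_scale_measure[OF f])
  finally show ?thesis .
qed

lemma L2_comp:
  fixes T :: "'a \<Rightarrow> real"
  assumes T: "T \<in> L2 (lebesgue_on \<Omega>)"
  shows "(\<lambda>x. T (\<psi> x)) \<in> L2 (lebesgue_on \<Omega>)"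
    "(\<integral>x. (T (\<psi> x))\<^sup>2 \<partial>lebesgue_on \<Omega>) \<le> c * (\<integral>x. (T x)\<^sup>2 \<partial>lebesgue_on \<Omega>)"
proof -
  interpret complete_finite_measure "lebesgue_on \<Omega>" by (rule complete_finite_measure_lebesgue_on[OF \<Omega>_lmeasurable])
  have Tm: "T \<in> borel_measurable (lebesgue_on \<Omega>)" and Ti: "integrable (lebesgue_on \<Omega>) (\<lambda>x. (T x)\<^sup>2)"
    using T by (auto simp: L2_real_iff)
  have cm: "(\<lambda>x. T (\<psi> x)) \<in> borel_measurable (lebesgue_on \<Omega>)" by (rule measurable_compose[OF \<psi>_measurable Tm])
  have "(\<integral>\<^sup>+x. ennreal ((T (\<psi> x))\<^sup>2) \<partial>lebesgue_on \<Omega>) \<le> ennreal c * (\<integral>\<^sup>+x. ennreal ((T x)\<^sup>2) \<partial>lebesgue_on \<Omega>)"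
    using Tm by (intro nn_integral_comp_le[of "\<lambda>x. ennreal ((T x)\<^sup>2)"]) measurable
  also have "\<dots> = ennreal (c * (\<integral>x. (T x)\<^sup>2 \<partial>lebesgue_on \<Omega>))"
    using Ti c_nonneg by (simp add: nn_integral_eq_integral ennreal_mult)
  finally have le: "(\<integral>\<^sup>+x. ennreal ((T (\<psi> x))\<^sup>2) \<partial>lebesgue_on \<Omega>) \<le> ennreal (c * (\<integral>x. (T x)\<^sup>2 \<partial>lebesgue_on \<Omega>))" .
  have ci: "integrable (lebesgue_on \<Omega>) (\<lambda>x. (T (\<psi> x))\<^sup>2)"
  proof (rule integrableI_bounded)
    show "(\<integral>\<^sup>+x. ennreal (norm ((T (\<psi> x))\<^sup>2)) \<partial>lebesgue_on \<Omega>) < \<infinity>"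
      using le_less_trans[OF le] by simp
  qed (use cm in measurable)
  then show "(\<lambda>x. T (\<psi> x)) \<in> L2 (lebesgue_on \<Omega>)" using cm by (simp add: L2_real_iff)
  have "0 \<le> c * (\<integral>x. (T x)\<^sup>2 \<partial>lebesgue_on \<Omega>)" using c_nonneg by simp
  then show "(\<integral>x. (T (\<psi> x))\<^sup>2 \<partial>lebesgue_on \<Omega>) \<le> c * (\<integral>x. (T x)\<^sup>2 \<partial>lebesgue_on \<Omega>)"
    using le by (simp add: nn_integral_eq_integral[OF ci])
qed

end

text \<open>Pointwise convergence of the inverses is of use only for continuous functions, so
  \<open>T\<close> is replaced by a bounded continuous \<open>g\<close>. The replacement error is
  uniform in \<open>n\<close> because all maps share the constant \<open>E\<close>.\<close>

lemma L2_comp_tendsto: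
  fixes T :: "'a::euclidean_space \<Rightarrow> real"
  assumes \<phi>s: "\<And>n. Lipschitz_inverse \<Omega> (\<phi>s n) E" and \<phi>: "Lipschitz_inverse \<Omega> \<phi> E"
    and lim: "\<And>x. x \<in> \<Omega> \<Longrightarrow> (\<lambda>n. inv_into \<Omega> (\<phi>s n) x) \<longlonglongrightarrow> inv_into \<Omega> \<phi> x"
    and T: "T \<in> L2 (lebesgue_on \<Omega>)"
  shows "(\<lambda>n. \<integral>x. (T (inv_into \<Omega> (\<phi>s n) x) - T (inv_into \<Omega> \<phi> x))\<^sup>2 \<partial>lebesgue_on \<Omega>) \<longlonglongrightarrow> 0"
proof (rule LIMSEQ_I)
  fix e :: real assume e: "0 < e"
  let ?M = "lebesgue_on \<Omega>"
  interpret \<Phi>: Lipschitz_inverse \<Omega> \<phi> E by (rule \<phi>)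
  interpret complete_finite_measure ?M by (rule complete_finite_measure_lebesgue_on[OF \<Phi>.\<Omega>_lmeasurable])
  define c where "c = \<Phi>.c"
  have c: "0 \<le> c" by (simp add: c_def \<Phi>.c_nonneg)
  \<comment> \<open>Each composed replacement error is at most \<open>c * d \<le> e / 16\<close>, so
    \<open>H\<close> contributes at most \<open>e / 4\<close>; together with \<open>G\<close> the
    total stays below \<open>e / 2 + e / 8\<close>.\<close>
  define d where "d = e / (16 * (c + 1))"
  have d: "0 < d" using e c by (simp add: d_def)
  have cd: "c * d \<le> e / 16" using e c by (simp add: d_def field_simps)
  obtain g K where g: "continuous_on UNIV g" "\<And>x. \<bar>g x\<bar> \<le> K" and gT: "(\<integral>x. (T x - g x)\<^sup>2 \<partial>?M) < d"
    using L2_lebesgue_on_bounded_continuous_dense[OF \<Phi>.\<Omega>_lmeasurable T d] by blast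
  have gm: "g \<in> borel_measurable ?M"
    using continuous_imp_measurable_on_sets_lebesgue[OF continuous_on_subset[OF g(1) subset_UNIV]] \<Phi>.\<Omega>_lmeasurable by auto
  have gL2: "g \<in> L2 ?M"
  proof (rule L2_bound[where h="\<lambda>_. K\<^sup>2"])
    show "strongly_measurable ?M g" using gm by (simp add: strongly_measurable_real_iff)
    show "AE x in ?M. (norm (g x))\<^sup>2 \<le> K\<^sup>2" using g(2) by (intro AE_I2 power_mono) auto
  qed simp
  have hL2: "(\<lambda>x. T x - g x) \<in> L2 ?M" by (rule L2_diff[OF T gL2])
  have comp: "(\<lambda>x. T (inv_into \<Omega> \<phi>' x) - g (inv_into \<Omega> \<phi>' x)) \<in> L2 ?M"
      "(\<integral>x. (T (inv_into \<Omega> \<phi>' x) - g (inv_into \<Omega> \<phi>' x))\<^sup>2 \<partial>?M) \<le> e / 16" "(\<lambda>x. g (inv_into \<Omega> \<phi>' x)) \<in> L2 ?M"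
    if L: "Lipschitz_inverse \<Omega> \<phi>' E" for \<phi>'
  proof -
    show "(\<lambda>x. T (inv_into \<Omega> \<phi>' x) - g (inv_into \<Omega> \<phi>' x)) \<in> L2 ?M"
      by (rule Lipschitz_inverse.L2_comp(1)[OF L hL2])
    show "(\<lambda>x. g (inv_into \<Omega> \<phi>' x)) \<in> L2 ?M" by (rule Lipschitz_inverse.L2_comp(1)[OF L gL2])
    have "(\<integral>x. (T (inv_into \<Omega> \<phi>' x) - g (inv_into \<Omega> \<phi>' x))\<^sup>2 \<partial>?M) \<le> c * (\<integral>x. (T x - g x)\<^sup>2 \<partial>?M)"
      using Lipschitz_inverse.L2_comp(2)[OF L hL2] by (simp add: c_def Lipschitz_inverse.c_def[OF L] \<Phi>.c_def)
    also have "\<dots> \<le> c * d" using gT c by (intro mult_left_mono) auto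
    finally show "(\<integral>x. (T (inv_into \<Omega> \<phi>' x) - g (inv_into \<Omega> \<phi>' x))\<^sup>2 \<partial>?M) \<le> e / 16" using cd by linarith
  qed
  define G where "G n x = g (inv_into \<Omega> (\<phi>s n) x) - g (inv_into \<Omega> \<phi> x)" for n x
  have GL2: "G n \<in> L2 ?M" for n unfolding G_def by (rule L2_diff[OF comp(3)[OF \<phi>s] comp(3)[OF \<phi>]])
  have "(\<lambda>n. \<integral>x. (G n x)\<^sup>2 \<partial>?M) \<longlonglongrightarrow> (\<integral>x. 0 \<partial>?M)"
  proof (rule integral_dominated_convergence[where w="\<lambda>_. (2 * K)\<^sup>2"])
    show "(\<lambda>x. (G n x)\<^sup>2) \<in> borel_measurable ?M" for n using L2_integrable[OF GL2, of n] by simp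
    show "AE x in ?M. (\<lambda>n. (G n x)\<^sup>2) \<longlonglongrightarrow> 0"
    proof (rule AE_I2)
      fix x assume "x \<in> space ?M"
      then have "(\<lambda>n. g (inv_into \<Omega> (\<phi>s n) x)) \<longlonglongrightarrow> g (inv_into \<Omega> \<phi> x)"
        by (intro continuous_on_tendsto_compose[OF g(1) lim]) auto
      then have "(\<lambda>n. (G n x)\<^sup>2) \<longlonglongrightarrow> (g (inv_into \<Omega> \<phi> x) - g (inv_into \<Omega> \<phi> x))\<^sup>2"
        unfolding G_def by (intro tendsto_intros)
      then show "(\<lambda>n. (G n x)\<^sup>2) \<longlonglongrightarrow> 0" by simp
    qed
    show "AE x in ?M. norm ((G n x)\<^sup>2) \<le> (2 * K)\<^sup>2" for n
    proof (rule AE_I2)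
      fix x
      have "\<bar>G n x\<bar> \<le> 2 * K"
        using g(2)[of "inv_into \<Omega> (\<phi>s n) x"] g(2)[of "inv_into \<Omega> \<phi> x"] unfolding G_def by linarith
      then show "norm ((G n x)\<^sup>2) \<le> (2 * K)\<^sup>2" using power_mono[of "\<bar>G n x\<bar>" "2 * K" 2] by simp
    qed
  qed simp_all
  then have "(\<lambda>n. \<integral>x. (G n x)\<^sup>2 \<partial>?M) \<longlonglongrightarrow> 0" by simp
  then have "eventually (\<lambda>n. (\<integral>x. (G n x)\<^sup>2 \<partial>?M) < e / 16) sequentially"
    using e by (intro order_tendstoD(2)) auto
  then obtain N where N: "\<And>n. N \<le> n \<Longrightarrow> (\<integral>x. (G n x)\<^sup>2 \<partial>?M) < e / 16"
    unfolding eventually_sequentially by blast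
  have "norm ((\<integral>x. (T (inv_into \<Omega> (\<phi>s n) x) - T (inv_into \<Omega> \<phi> x))\<^sup>2 \<partial>?M) - 0) < e" if n: "N \<le> n" for n
  proof -
    define H where "H x = (T (inv_into \<Omega> (\<phi>s n) x) - g (inv_into \<Omega> (\<phi>s n) x)) - (T (inv_into \<Omega> \<phi> x) - g (inv_into \<Omega> \<phi> x))" for x
    have HL2: "H \<in> L2 ?M" unfolding H_def by (rule L2_diff[OF comp(1)[OF \<phi>s] comp(1)[OF \<phi>]])
    have H: "(\<integral>x. (H x)\<^sup>2 \<partial>?M) \<le> e / 4"
      using integral_norm_diff_sq_le[OF comp(1)[OF \<phi>s[of n]] comp(1)[OF \<phi>]] comp(2)[OF \<phi>s[of n]] comp(2)[OF \<phi>]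
      unfolding H_def by simp
    have "(\<integral>x. (norm (H x - (-1) *\<^sub>R G n x))\<^sup>2 \<partial>?M) \<le> 2 * (\<integral>x. (norm (H x))\<^sup>2 \<partial>?M) + 2 * (\<integral>x. (norm ((-1) *\<^sub>R G n x))\<^sup>2 \<partial>?M)"
      by (rule integral_norm_diff_sq_le[OF HL2 L2_scaleR[OF GL2]])
    then have "(\<integral>x. (H x + G n x)\<^sup>2 \<partial>?M) \<le> 2 * (\<integral>x. (H x)\<^sup>2 \<partial>?M) + 2 * (\<integral>x. (G n x)\<^sup>2 \<partial>?M)" by simp
    moreover have "H x + G n x = T (inv_into \<Omega> (\<phi>s n) x) - T (inv_into \<Omega> \<phi> x)" for x
      by (simp add: H_def G_def)
    ultimately show ?thesis using H N[OF n] e by simp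
  qed
  then show "\<exists>N. \<forall>n\<ge>N. norm ((\<integral>x. (T (inv_into \<Omega> (\<phi>s n) x) - T (inv_into \<Omega> \<phi> x))\<^sup>2 \<partial>?M) - 0) < e" by blast
qed

section \<open>Stability\<close>

lemma weak_conv_add_strong:
  fixes fs zs :: "nat \<Rightarrow> 'a \<Rightarrow> 'b::real_normed_vector"
  assumes M: "complete_finite_measure M"
    and fs: "\<And>n. fs n \<in> L2 M" "f \<in> L2 M" "(\<lambda>n. \<integral>x. (norm (fs n x - f x))\<^sup>2 \<partial>M) \<longlonglongrightarrow> 0"
    and zs: "L2_weak_conv M zs z"
  shows "L2_weak_conv M (\<lambda>n x. fs n x + zs n x) (\<lambda>x. f x + z x)"
proof -
  interpret complete_finite_measure M by (rule M)
  have zL2: "zs n \<in> L2 M" for n using zs unfolding L2_weak_conv_def by blast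
  have z: "z \<in> L2 M" using zs unfolding L2_weak_conv_def by blast
  have "(\<lambda>n. l (\<lambda>x. fs n x + zs n x)) \<longlonglongrightarrow> l (\<lambda>x. f x + z x)" if l: "L2_functional M l" for l
  proof -
    have "(\<lambda>n. l (\<lambda>x. fs n x - f x)) \<longlonglongrightarrow> 0"
      by (rule L2_functional_tendsto_zero[OF l L2_diff[OF fs(1,2)] fs(3)])
    then have "(\<lambda>n. l (fs n)) \<longlonglongrightarrow> l f"
      unfolding L2_functional_diff[OF l fs(1,2)] by (rule LIM_zero_cancel)
    moreover have "(\<lambda>n. l (zs n)) \<longlonglongrightarrow> l z" using zs l unfolding L2_weak_conv_def by blast
    ultimately have "(\<lambda>n. l (fs n) + l (zs n)) \<longlonglongrightarrow> l f + l z" by (rule tendsto_add)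
    then show ?thesis by (simp add: L2_functional_add[OF l fs(1) zL2] L2_functional_add[OF l fs(2) z])
  qed
  then show ?thesis unfolding L2_weak_conv_def using L2_add[OF fs(1) zL2] L2_add[OF fs(2) z] by blast
qed

lemma subsequence_at_top_if_unbounded:
  fixes a :: "nat \<Rightarrow> real"
  assumes "\<not> (\<exists>B. \<forall>n. a n \<le> B)"
  shows "\<exists>s. strict_mono (s :: nat \<Rightarrow> nat) \<and> filterlim (\<lambda>n. a (s n)) at_top sequentially"
proof -
  have inf: "\<exists>n>m. real k \<le> a n" for m k
  proof (rule ccontr)
    assume "\<not> ?thesis"
    then have lt: "a n < real k" if "m < n" for n using that by (meson not_le)
    have "a n \<le> max (real k) (Max (a ` {..m}))" for n
    proof (cases "m < n")
      case True
      then show ?thesis using lt[OF True] by simp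
    next
      case False
      then have "a n \<le> Max (a ` {..m})" by (intro Max_ge) auto
      then show ?thesis by simp
    qed
    then show False using assms by blast
  qed
  have "\<exists>s. \<forall>k. real k \<le> a (s k) \<and> s k < s (Suc k)"
    by (rule dependent_nat_choice) (use inf in blast)+
  then obtain s :: "nat \<Rightarrow> nat" where s: "\<And>k. real k \<le> a (s k)" "\<And>k. s k < s (Suc k)" by auto
  have "filterlim (\<lambda>n. a (s n)) at_top sequentially"
    by (rule filterlim_at_top_mono[OF filterlim_real_sequentially]) (use s(1) in auto)
  then show ?thesis using s(2) by (auto simp: strict_mono_Suc_iff)
qed

text \<open>Coercivity is assumed for sequences whose norms tend to infinity; an unbounded sequence
  contains such a subsequence, along which \<open>E\<close> would exceed \<open>B\<close>.\<close>

lemma bounded_if_coercive: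
  fixes N E :: "nat \<Rightarrow> real"
  assumes coercive: "\<And>s :: nat \<Rightarrow> nat. strict_mono s \<Longrightarrow> filterlim (\<lambda>n. N (s n)) at_top sequentially \<Longrightarrow>
      filterlim (\<lambda>n. E (s n)) at_top sequentially"
    and bounded: "\<And>n. E n \<le> B"
  shows "\<exists>B. \<forall>n. N n \<le> B"
proof (rule ccontr)
  assume "\<not> ?thesis"
  then obtain s :: "nat \<Rightarrow> nat" where s: "strict_mono s" "filterlim (\<lambda>n. N (s n)) at_top sequentially"
    using subsequence_at_top_if_unbounded by blast
  have "eventually (\<lambda>n. B + 1 \<le> E (s n)) sequentially"
    using coercive[OF s] unfolding filterlim_at_top by blast
  then obtain n where "B + 1 \<le> E (s n)" by (auto simp: eventually_sequentially)
  then show False using bounded[of "s n"] by simp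
qed

text \<open>Each term is eventually above its lower bound minus \<open>d\<close>, so the three
  bounds can be added as real numbers although the limits inferior may be infinite.\<close>

lemma liminf_le_sum3:
  fixes a b c j :: "nat \<Rightarrow> real"
  assumes a: "ereal A \<le> liminf (\<lambda>n. ereal (a n))" and b: "ereal B \<le> liminf (\<lambda>n. ereal (b n))"
    and c: "ereal C \<le> liminf (\<lambda>n. ereal (c n))"
    and le: "\<And>n. a n + p * b n + q * c n \<le> j n" and j: "j \<longlonglongrightarrow> J" and p: "0 < p" "0 < q"
  shows "A + p * B + q * C \<le> J"
proof (rule field_le_epsilon)
  fix e :: real assume e: "0 < e"
  \<comment> \<open>One \<open>d\<close> is lost for \<open>a\<close>, one for \<open>j\<close>, and
    \<open>p * d\<close> and \<open>q * d\<close> for the weighted terms.\<close>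
  define d where "d = e / (2 + p + q)"
  have d: "0 < d" using e p by (simp add: d_def)
  have ev: "eventually (\<lambda>n. X - d < x n) sequentially" if "ereal X \<le> liminf (\<lambda>n. ereal (x n))" for X and x :: "nat \<Rightarrow> real"
  proof -
    have "ereal (X - d) < liminf (\<lambda>n. ereal (x n))" using d that by (intro less_le_trans[OF _ that]) simp
    then have "eventually (\<lambda>n. ereal (X - d) < ereal (x n)) sequentially" by (rule less_LiminfD)
    then show ?thesis by simp
  qed
  have "eventually (\<lambda>n. j n < J + d) sequentially" using d by (intro order_tendstoD(2)[OF j]) simp
  with ev[OF a] ev[OF b] ev[OF c]
  have "eventually (\<lambda>n. A + p * B + q * C \<le> J + e) sequentially"
  proof eventually_elim
    case (elim n)
    have "p * (B - d) \<le> p * b n" "q * (C - d) \<le> q * c n" using elim p by simp_all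
    then have "A + p * B + q * C \<le> J + d * (2 + p + q)" using elim le[of n] by (simp add: algebra_simps)
    also have "d * (2 + p + q) = e" using p by (simp add: d_def)
    finally show ?case .
  qed
  then show "A + p * B + q * C \<le> J + e" by simp
qed

context velocity_fields
begin

lemma Lipschitz_inverse_flow:
  assumes "bounded \<Omega>" "v \<in> L2 unit_time" "energy v \<le> B"
  shows "Lipschitz_inverse \<Omega> (flow \<Omega> \<iota> v 1) (Lip_const B)"
  by unfold_locales (use assms open_\<Omega> Lip_const_pos flow_bij flow_Lipschitz(1) in auto)

text \<open>The preimage of \<open>x\<close> under the flow of \<open>vs n\<close> and the limit
  preimage \<open>y\<close> are both moved by that flow, whose lower Lipschitz bound is uniform in
  \<open>n\<close>. Their images are \<open>x\<close> and a point tending to \<open>x\<close>, so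
  forward convergence at the single point \<open>y\<close> is enough.\<close>

lemma inverse_flow_tendsto:
  assumes conv: "L2_weak_conv unit_time vs v" and B: "\<And>n. energy (vs n) \<le> B" and x: "x \<in> \<Omega>"
  shows "(\<lambda>n. inv_into \<Omega> (flow \<Omega> \<iota> (vs n) 1) x) \<longlonglongrightarrow> inv_into \<Omega> (flow \<Omega> \<iota> v 1) x"
proof -
  have vs: "vs n \<in> L2 unit_time" for n using conv unfolding L2_weak_conv_def by blast
  have v: "v \<in> L2 unit_time" using conv unfolding L2_weak_conv_def by blast
  have inv: "inv_into \<Omega> (flow \<Omega> \<iota> w 1) x \<in> \<Omega>" "flow \<Omega> \<iota> w 1 (inv_into \<Omega> (flow \<Omega> \<iota> w 1) x) = x"
    if "w \<in> L2 unit_time" for w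
    using flow_bij[OF that] x by (auto simp: bij_betw_def inv_into_into f_inv_into_f)
  define y where "y = inv_into \<Omega> (flow \<Omega> \<iota> v 1) x"
  have y: "y \<in> \<Omega>" "flow \<Omega> \<iota> v 1 y = x" using inv[OF v] by (simp_all add: y_def)
  have "(\<lambda>n. Lip_const B * norm (x - flow \<Omega> \<iota> (vs n) 1 y)) \<longlonglongrightarrow> Lip_const B * norm (x - x)"
    using flow_weakly_continuous[OF conv B y(1)] unfolding y(2) by (intro tendsto_intros)
  then have lim0: "(\<lambda>n. Lip_const B * norm (x - flow \<Omega> \<iota> (vs n) 1 y)) \<longlonglongrightarrow> 0" by simp
  have "norm (inv_into \<Omega> (flow \<Omega> \<iota> (vs n) 1) x - y) \<le> Lip_const B * norm (x - flow \<Omega> \<iota> (vs n) 1 y)" for n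
    using flow_Lipschitz(2)[OF vs[of n] B[of n] inv(1)[OF vs[of n]] y(1)] by (simp add: inv(2)[OF vs])
  then have "\<forall>n. norm (inv_into \<Omega> (flow \<Omega> \<iota> (vs n) 1) x - y) \<le> Lip_const B * norm (x - flow \<Omega> \<iota> (vs n) 1 y)" ..
  then have "(\<lambda>n. inv_into \<Omega> (flow \<Omega> \<iota> (vs n) 1) x - y) \<longlonglongrightarrow> 0"
    by (rule Lim_null_comparison[OF always_eventually lim0])
  then show ?thesis unfolding y_def by (rule LIM_zero_cancel)
qed

end

lemma L2_weak_conv_subseq:
  fixes fs :: "nat \<Rightarrow> 'a \<Rightarrow> 'b::real_normed_vector"
  assumes "L2_weak_conv M fs f" "strict_mono (r :: nat \<Rightarrow> nat)"
  shows "L2_weak_conv M (\<lambda>n. fs (r n)) f"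
  unfolding L2_weak_conv_def
proof (intro conjI allI impI)
  show "fs (r n) \<in> L2 M" for n using assms(1) unfolding L2_weak_conv_def by blast
  show "f \<in> L2 M" using assms(1) unfolding L2_weak_conv_def by blast
  fix l :: "('a \<Rightarrow> 'b) \<Rightarrow> real" assume "L2_functional M l"
  then have "(\<lambda>n. l (fs n)) \<longlonglongrightarrow> l f" using assms(1) unfolding L2_weak_conv_def by blast
  then show "(\<lambda>n. l (fs (r n))) \<longlonglongrightarrow> l f" using LIMSEQ_subseq_LIMSEQ[OF _ assms(2)] by (simp add: o_def)
qed

theorem theorem3p3:
  fixes \<Omega> :: "'a::euclidean_space set"
    and T :: "'a \<Rightarrow> real"
    and \<iota> :: "'v::banach \<Rightarrow> 'a \<Rightarrow> 'a"
    and K :: "('a \<Rightarrow> real) \<Rightarrow> 'y::banach"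
    and D :: "'y \<Rightarrow> 'y \<Rightarrow> real"
    and E1 :: "(real \<Rightarrow> 'v) \<Rightarrow> real"
    and E2 :: "('a \<Rightarrow> real) \<Rightarrow> real"
    and lam1 lam2 :: real
    and g :: 'y
    and gs :: "nat \<Rightarrow> 'y"
    and vs :: "nat \<Rightarrow> real \<Rightarrow> 'v"
    and zs :: "nat \<Rightarrow> 'a \<Rightarrow> real"
  assumes domain: "open \<Omega>" "connected \<Omega>" "\<Omega> \<noteq> {}" "bounded \<Omega>"
    and T: "T \<in> L2 (lebesgue_on \<Omega>)"
    and V_reflexive: "reflexive TYPE('v)"
    and V_admissible: "admissible \<Omega> \<iota>"
    and D_nonneg: "\<And>f h. 0 \<le> D f h"
    and E1_nonneg: "\<And>v. v \<in> L2 unit_time \<Longrightarrow> 0 \<le> E1 v"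
    and E2_nonneg: "\<And>z. z \<in> L2 (lebesgue_on \<Omega>) \<Longrightarrow> 0 \<le> E2 z"
    and A1_continuous:
      "\<And>xs x. \<lbrakk>\<And>n. xs n \<in> L2 (lebesgue_on \<Omega>); x \<in> L2 (lebesgue_on \<Omega>);
          (\<lambda>n. L2_norm (lebesgue_on \<Omega>) (\<lambda>p. xs n p - x p)) \<longlonglongrightarrow> 0\<rbrakk>
        \<Longrightarrow> (\<lambda>n. K (xs n)) \<longlonglongrightarrow> K x"
    and A1_weak:
      "\<And>xs x. L2_weak_conv (lebesgue_on \<Omega>) xs x \<Longrightarrow> weak_conv (\<lambda>n. K (xs n)) (K x)"
    and A2_lsc: "\<And>h. seq_lsc weak_conv (\<lambda>f. D f h)"
    and A2_continuous: "\<And>f. continuous_on UNIV (D f)"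
    and A3: "\<And>f h. D f h = 0 \<Longrightarrow> f = h"
    and D_diagonal: "\<And>f. D f f = 0"
    and A4: "\<exists>C>0. \<forall>f g h. \<bar>D f h - D f g\<bar> \<le> C * D g h"
    and A5_E2:
      "\<And>h fs ys. \<lbrakk>\<And>n. fs n \<in> L2 (lebesgue_on \<Omega>); \<And>n. ys n \<in> L2 (lebesgue_on \<Omega>);
          bounded (range (\<lambda>n. L2_norm (lebesgue_on \<Omega>) (fs n)));
          filterlim (\<lambda>n. L2_norm (lebesgue_on \<Omega>) (ys n)) at_top sequentially\<rbrakk>
        \<Longrightarrow> filterlim (\<lambda>n. D (K (\<lambda>p. fs n p + ys n p)) h + E2 (ys n)) at_top sequentially"
    and A5_E1:
      "\<And>ws. \<lbrakk>\<And>n. ws n \<in> L2 unit_time;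
          filterlim (\<lambda>n. L2_norm unit_time (ws n)) at_top sequentially\<rbrakk>
        \<Longrightarrow> filterlim (\<lambda>n. E1 (ws n)) at_top sequentially"
    and A6_E1: "seq_lsc (L2_weak_conv unit_time) E1"
    and A6_E2: "seq_lsc (L2_weak_conv (lebesgue_on \<Omega>)) E2"
    and lambda_pos: "0 < lam1" "0 < lam2"
    and data: "gs \<longlonglongrightarrow> g"
    and minimizers: "\<And>n. is_minimizer \<Omega> (J_fun \<Omega> \<iota> T K D E1 E2 lam1 lam2 (gs n)) (vs n) (zs n)"
  shows "\<exists>r v z. strict_mono (r :: nat \<Rightarrow> nat) \<and>
           L2_weak_conv unit_time (\<lambda>n. vs (r n)) v \<and>
           L2_weak_conv (lebesgue_on \<Omega>) (\<lambda>n. zs (r n)) z \<and>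
           is_minimizer \<Omega> (J_fun \<Omega> \<iota> T K D E1 E2 lam1 lam2 g) v z"
proof -
  let ?M = "lebesgue_on \<Omega>"
  have \<Omega>m: "\<Omega> \<in> lmeasurable" using domain(1,4) by (rule lmeasurable_open[rotated])
  interpret M: complete_finite_measure ?M by (rule complete_finite_measure_lebesgue_on[OF \<Omega>m])
  obtain c where c: "0 < c"
    "\<forall>v. (\<forall>x. norm (\<iota> v x) \<le> c * norm v) \<and> (\<forall>x y. norm (\<iota> v x - \<iota> v y) \<le> c * norm v * norm (x - y))"
    using admissible_fields(1)[OF domain(1) V_admissible] by auto
  interpret velocity_fields \<Omega> \<iota> c
    using c domain(1) admissible_fields(2-4)[OF domain(1) V_admissible] by unfold_locales auto
  define J where "J = (\<lambda>g. J_fun \<Omega> \<iota> T K D E1 E2 lam1 lam2 g)"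
  have vs: "vs n \<in> L2 unit_time" and zs: "zs n \<in> L2 ?M" for n
    using minimizers[of n] unfolding is_minimizer_def by auto
  have min: "J (gs n) (vs n) (zs n) \<le> J (gs n) w y" if "w \<in> L2 unit_time" "y \<in> L2 ?M" for n w y
    using minimizers[of n] that unfolding is_minimizer_def J_def by blast
  define f where "f w x = T (inv_into \<Omega> (flow \<Omega> \<iota> w 1) x)" for w x
  have J: "J h w y = D (K (\<lambda>x. f w x + y x)) h + lam1 * E1 w + lam2 * E2 y" for h w y
    by (simp add: J_def J_fun_def reconstruction_def f_def[abs_def])
  have D_tendsto: "(\<lambda>n. D h (gs n)) \<longlonglongrightarrow> D h g" for h
    by (rule continuous_on_tendsto_compose[OF A2_continuous data]) auto
  obtain C where C: "0 < C" "\<And>f g h. \<bar>D f h - D f g\<bar> \<le> C * D g h" using A4 by blast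
  \<comment> \<open>In (A4) the datum \<open>gs n\<close> is put into the second argument of
    \<open>D\<close>, where \<open>D\<close> is continuous; the limit is \<open>C * D g g\<close>,
    which vanishes by \<open>D_diagonal\<close>.\<close>
  define \<epsilon> where "\<epsilon> n = C * D g (gs n)" for n
  have \<epsilon>_lim: "\<epsilon> \<longlonglongrightarrow> 0"
    unfolding \<epsilon>_def using tendsto_mult_left[OF D_tendsto[of g], of C] by (simp add: D_diagonal)
  have D_g: "D h g \<le> D h (gs n) + \<epsilon> n" for h n
    using C(2)[of h "gs n" g] unfolding \<epsilon>_def by linarith
  \<comment> \<open>On the left \<open>gs n\<close> is replaced by the fixed datum \<open>g\<close>,
    since (A5) and the lower semicontinuity in (A2) concern a fixed datum; the price
    \<open>\<epsilon> n\<close> tends to zero.\<close>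
  have key: "D (K (\<lambda>x. f (vs n) x + zs n x)) g + lam1 * E1 (vs n) + lam2 * E2 (zs n) \<le> J (gs n) w y + \<epsilon> n"
    if "w \<in> L2 unit_time" "y \<in> L2 ?M" for n w y
    using min[OF that, of n] D_g[of "K (\<lambda>x. f (vs n) x + zs n x)" n] unfolding J by linarith
  have J_lim: "(\<lambda>n. J (gs n) w y + \<epsilon> n) \<longlonglongrightarrow> J g w y" for w y
    using tendsto_add[OF tendsto_add[OF tendsto_add[OF D_tendsto[of "K (\<lambda>x. f w x + y x)"]
          tendsto_const[of "lam1 * E1 w"]] tendsto_const[of "lam2 * E2 y"]] \<epsilon>_lim]
    unfolding J by simp
  have "Bseq (\<lambda>n. J (gs n) (\<lambda>_. 0) (\<lambda>_. 0) + \<epsilon> n)" by (rule convergent_imp_Bseq[OF convergentI[OF J_lim]])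
  then obtain b where b: "\<And>n. J (gs n) (\<lambda>_. 0) (\<lambda>_. 0) + \<epsilon> n \<le> b" unfolding Bseq_def by (force simp: abs_le_iff)
  have sum_le: "D (K (\<lambda>x. f (vs n) x + zs n x)) g + lam1 * E1 (vs n) + lam2 * E2 (zs n) \<le> b" for n
    using key[OF unit_time.L2_zero M.L2_zero, of n] b[of n] by linarith
  have nonneg: "0 \<le> lam1 * E1 (vs n)" "0 \<le> lam2 * E2 (zs n)" for n
    using E1_nonneg[OF vs] E2_nonneg[OF zs] lambda_pos by simp_all
  have E1_le: "E1 (vs n) \<le> b / lam1" and E2_le: "E2 (zs n) \<le> b / lam2"
    and D_le: "D (K (\<lambda>x. f (vs n) x + zs n x)) g \<le> b" for n
    using sum_le[of n] nonneg[of n] D_nonneg[of "K (\<lambda>x. f (vs n) x + zs n x)" g] lambda_pos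
    by (simp_all add: pos_le_divide_eq mult.commute)
  have "\<exists>B. \<forall>n. L2_norm unit_time (vs n) \<le> B"
    by (rule bounded_if_coercive[OF _ E1_le]) (rule A5_E1[OF vs])
  then obtain B1 where B1: "\<And>n. L2_norm unit_time (vs n) \<le> B1" by blast
  define B where "B = B1\<^sup>2"
  have B: "energy (vs n) \<le> B" for n
    using power_mono[OF B1[of n] unit_time.L2_norm_nonneg, of 2]
    unfolding B_def energy_def unit_time.L2_norm_sq .
  have L: "Lipschitz_inverse \<Omega> (flow \<Omega> \<iota> w 1) (Lip_const B')" if "w \<in> L2 unit_time" "energy w \<le> B'" for w B'
    by (rule Lipschitz_inverse_flow[OF domain(4) that])
  have fL2: "f w \<in> L2 ?M" if "w \<in> L2 unit_time" for w
    unfolding f_def by (rule Lipschitz_inverse.L2_comp(1)[OF L[OF that order_refl] T])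
  \<comment> \<open>Bounded velocities share a Lipschitz constant, so the deformed templates are
    bounded in \<open>L\<^sup>2\<close>. (A5) asks for this bound before it can control the sources,
    which is why the velocities are bounded first.\<close>
  define F where "F = (2 * Lip_const B * DIM('a)) ^ DIM('a) * (\<integral>x. (T x)\<^sup>2 \<partial>?M)"
  have "(\<integral>x. (f (vs n) x)\<^sup>2 \<partial>?M) \<le> F" for n
    using Lipschitz_inverse.L2_comp(2)[OF L[OF vs B] T, of n]
    unfolding Lipschitz_inverse.c_def[OF L[OF vs B]] F_def f_def .
  then have "L2_norm ?M (f (vs n)) \<le> sqrt F" for n unfolding L2_norm_def by simp
  then have fbdd: "norm (L2_norm ?M (f (vs n))) \<le> sqrt F" for n using M.L2_norm_nonneg[of "f (vs n)"] by simp
  have "\<exists>B. \<forall>n. L2_norm ?M (zs n) \<le> B"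
  proof (rule bounded_if_coercive)
    \<comment> \<open>(A5) has weight \<open>1\<close> on \<open>E2\<close>, so \<open>D\<close> and
      \<open>E2\<close> are bounded separately and \<open>lam2\<close> is divided out.\<close>
    show "D (K (\<lambda>x. f (vs n) x + zs n x)) g + E2 (zs n) \<le> b + b / lam2" for n
      using D_le[of n] E2_le[of n] by linarith
    fix s :: "nat \<Rightarrow> nat" assume "filterlim (\<lambda>n. L2_norm ?M (zs (s n))) at_top sequentially"
    moreover have "bounded (range (\<lambda>n. L2_norm ?M (f (vs (s n)))))"
      unfolding bounded_iff using fbdd by blast
    ultimately show "filterlim (\<lambda>n. D (K (\<lambda>x. f (vs (s n)) x + zs (s n) x)) g + E2 (zs (s n))) at_top sequentially"
      by (intro A5_E2[of "\<lambda>n. f (vs (s n))" "\<lambda>n. zs (s n)"] fL2 vs zs)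
  qed
  then obtain B2 where B2: "\<And>n. L2_norm ?M (zs n) \<le> B2" by blast
  have zB: "(\<integral>x. (norm (zs n x))\<^sup>2 \<partial>?M) \<le> B2\<^sup>2" for n
    using power_mono[OF B2[of n] M.L2_norm_nonneg, of 2] unfolding M.L2_norm_sq .
  obtain r1 v where r1: "strict_mono (r1 :: nat \<Rightarrow> nat)" and v1: "L2_weak_conv unit_time (\<lambda>n. vs (r1 n)) v"
    using unit_time.weakly_convergent_subsequence[where v=vs, OF V_reflexive vs B[unfolded energy_def]] by blast
  obtain r2 z where r2: "strict_mono (r2 :: nat \<Rightarrow> nat)" and z2: "L2_weak_conv ?M (\<lambda>n. zs (r1 (r2 n))) z"
    using M.weakly_convergent_subsequence[where v="\<lambda>n. zs (r1 n)", OF reflexive_real zs zB] by blast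
  define r where "r n = r1 (r2 n)" for n
  have r: "strict_mono r" using r1 r2 by (simp add: r_def strict_mono_def)
  have vr: "L2_weak_conv unit_time (\<lambda>n. vs (r n)) v"
    unfolding r_def by (rule L2_weak_conv_subseq[OF v1 r2])
  have zr: "L2_weak_conv ?M (\<lambda>n. zs (r n)) z" using z2 unfolding r_def .
  have v: "v \<in> L2 unit_time" and z: "z \<in> L2 ?M" using vr zr unfolding L2_weak_conv_def by blast+
  \<comment> \<open>The strong convergence of the deformed templates requires one Lipschitz constant
    for the sequence and for the limit, and the energy of \<open>v\<close> has not been compared
    with \<open>B\<close>.\<close>
  define B' where "B' = max B (energy v)"
  have B': "energy (vs n) \<le> B'" "energy v \<le> B'" for n using B[of n] by (simp_all add: B'_def)
  have "(\<lambda>n. \<integral>x. (f (vs (r n)) x - f v x)\<^sup>2 \<partial>?M) \<longlonglongrightarrow> 0"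
    unfolding f_def
    by (rule L2_comp_tendsto[OF L[OF vs B'(1)] L[OF v B'(2)] inverse_flow_tendsto[OF vr B'(1)] T])
  then have "(\<lambda>n. \<integral>x. (norm (f (vs (r n)) x - f v x))\<^sup>2 \<partial>?M) \<longlonglongrightarrow> 0" by simp
  from weak_conv_add_strong[OF M.complete_finite_measure_axioms fL2[OF vs] fL2[OF v] this zr]
  have "L2_weak_conv ?M (\<lambda>n x. f (vs (r n)) x + zs (r n) x) (\<lambda>x. f v x + z x)" .
  from A1_weak[OF this] have D_lsc: "ereal (D (K (\<lambda>x. f v x + z x)) g)
      \<le> liminf (\<lambda>n. ereal (D (K (\<lambda>x. f (vs (r n)) x + zs (r n) x)) g))"
    using A2_lsc[of g] unfolding seq_lsc_def by blast
  have E1_lsc: "ereal (E1 v) \<le> liminf (\<lambda>n. ereal (E1 (vs (r n))))"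
    using A6_E1 vr unfolding seq_lsc_def by blast
  have E2_lsc: "ereal (E2 z) \<le> liminf (\<lambda>n. ereal (E2 (zs (r n))))"
    using A6_E2 zr unfolding seq_lsc_def by blast
  have "J g v z \<le> J g w y" if wy: "w \<in> L2 unit_time" "y \<in> L2 ?M" for w y
    unfolding J[of g v z]
    by (rule liminf_le_sum3[OF D_lsc E1_lsc E2_lsc key[OF wy] _ lambda_pos])
      (use LIMSEQ_subseq_LIMSEQ[OF J_lim r] in \<open>simp add: o_def\<close>)
  then have "is_minimizer \<Omega> (J_fun \<Omega> \<iota> T K D E1 E2 lam1 lam2 g) v z"
    unfolding is_minimizer_def using v z by (simp add: J_def)
  with r vr zr show ?thesis by blast
qed

end
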